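(* Let $t,k,\mathsf n\ge1$ be integers, $N=2^{\mathsf n}$, and $|\alpha\rangle\in\mathbb C^N$ a unit vector. Let $\mathcal C_t$ be the channel on operators on $(\mathbb C^N)^{\otimes t}$ \[ \mathcal C_t(\eta)=\mathbb E_{P\sim\mathcal P_{\mathsf n},\,\theta\sim(-\pi,\pi)}\big(e^{\mathrm i\frac\theta2P}\big)^{\otimes t}\eta\big(e^{-\mathrm i\frac\theta2P}\big)^{\otimes t}, \] with $P$ uniform on $\mathcal P_{\mathsf n}=\{\mathbf 1_2,\sigma^x,\sigma^y,\sigma^z\}^{\otimes\mathsf n}\setminus\{\mathbf 1_N\}$ and $\theta$ uniform, independent, and let $\mathcal S_{\mathrm{Haar},t}=\mathbb E_{U\sim\mathrm{SU}(N)}(U|\alpha\rangle\langle\alpha|U^\dagger)^{\otimes t}$ with $U$ Haar-distributed. Then \[ \Big\|\mathcal C_t^k\big(|\alpha\rangle^{\otimes t}\langle\alpha|^{\otimes t}\big)-\mathcal S_{\mathrm{Haar},t}\Big\|_1\le\binom{N+t-1}{t}^{1/2}\Big(1-\frac1{2t}\frac N{N+1}-\frac N{2(N^2-1)}\Big)^k. \]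
   Context: $\|\cdot\|_1$ is the Schatten $1$-norm (sum of singular values); $\mathcal C_t^k$ denotes the $k$-fold composition of $\mathcal C_t$. *)

theory Defs
  imports "HOL-Probability.Probability" "Jordan_Normal_Form.Char_Poly"
begin

definition dag :: "complex mat \<Rightarrow> complex mat" where
  "dag A = mat (dim_col A) (dim_row A) (\<lambda>(i,j). cnj (A $$ (j,i)))"

definition kron :: "complex mat \<Rightarrow> complex mat \<Rightarrow> complex mat" where
  "kron A B = mat (dim_row A * dim_row B) (dim_col A * dim_col B)
     (\<lambda>(i,j). A $$ (i div dim_row B, j div dim_col B) * B $$ (i mod dim_row B, j mod dim_col B))"

fun kron_pow :: "nat \<Rightarrow> complex mat \<Rightarrow> complex mat" where
  "kron_pow 0 A = 1\<^sub>m 1"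
| "kron_pow (Suc t) A = kron (kron_pow t A) A"

definition mexp :: "complex mat \<Rightarrow> complex mat" where
  "mexp A = mat (dim_row A) (dim_col A) (\<lambda>(i,j). \<Sum>m. (A ^\<^sub>m m) $$ (i,j) / of_nat (fact m))"

text \<open>Schatten 1-norm: sum of singular values, i.e. of the square roots of the eigenvalues
  of \<open>A\<^sup>\<dagger> A\<close> counted with algebraic multiplicity.\<close>
definition trace_norm :: "complex mat \<Rightarrow> real" where
  "trace_norm A = (let p = char_poly (dag A * A) in
     \<Sum>z\<in>{z. poly p z = 0}. of_nat (order z p) * sqrt (Re z))"

definition SU :: "nat \<Rightarrow> complex mat set" where
  "SU N = {U. U \<in> carrier_mat N N \<and> U * dag U = 1\<^sub>m N \<and> det U = 1}"

definition pauli :: "nat \<Rightarrow> complex mat" where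
  "pauli a = (if a = 0 then 1\<^sub>m 2
     else if a = 1 then mat 2 2 (\<lambda>(i,j). if i \<noteq> j then 1 else 0)
     else if a = 2 then mat 2 2 (\<lambda>(i,j). if i = 0 \<and> j = 1 then - \<i> else if i = 1 \<and> j = 0 then \<i> else 0)
     else mat 2 2 (\<lambda>(i,j). if i = j then (if i = 0 then 1 else -1) else 0))"

fun pauli_string :: "nat \<Rightarrow> (nat \<Rightarrow> nat) \<Rightarrow> complex mat" where
  "pauli_string 0 s = 1\<^sub>m 1"
| "pauli_string (Suc n) s = kron (pauli_string n s) (pauli (s n))"

definition Paulis :: "nat \<Rightarrow> complex mat set" where
  "Paulis n = pauli_string n ` ({..<n} \<rightarrow>\<^sub>E {..<4}) - {1\<^sub>m (2^n)}"

definition chan :: "nat \<Rightarrow> nat \<Rightarrow> complex mat \<Rightarrow> complex mat" where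
  "chan n t \<eta> = mat ((2^n)^t) ((2^n)^t) (\<lambda>(i,j).
     (1 / of_nat (card (Paulis n))) * (\<Sum>P\<in>Paulis n.
        integral\<^sup>L (uniform_measure lborel {-pi<..<pi})
          (\<lambda>\<theta>. (kron_pow t (mexp ((\<i> * complex_of_real (\<theta>/2)) \<cdot>\<^sub>m P)) * \<eta>
                 * kron_pow t (mexp ((- \<i> * complex_of_real (\<theta>/2)) \<cdot>\<^sub>m P))) $$ (i,j))))"

definition matspace :: "nat \<Rightarrow> (nat \<times> nat \<Rightarrow> complex) measure" where
  "matspace N = PiM ({..<N} \<times> {..<N}) (\<lambda>_. borel)"

definition is_haar_SU :: "nat \<Rightarrow> (nat \<times> nat \<Rightarrow> complex) measure \<Rightarrow> bool" where
  "is_haar_SU N \<mu> \<longleftrightarrow> prob_space \<mu> \<and> sets \<mu> = sets (matspace N)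
     \<and> {f \<in> space \<mu>. mat N N f \<in> SU N} \<in> sets \<mu>
     \<and> emeasure \<mu> {f \<in> space \<mu>. mat N N f \<in> SU N} = 1
     \<and> (\<forall>V\<in>SU N. distr \<mu> (matspace N)
            (\<lambda>f. restrict (\<lambda>(i,j). (V * mat N N f) $$ (i,j)) ({..<N} \<times> {..<N})) = \<mu>)"

definition haar_state :: "nat \<Rightarrow> nat \<Rightarrow> (nat \<times> nat \<Rightarrow> complex) measure \<Rightarrow> complex mat \<Rightarrow> complex mat" where
  "haar_state N t \<mu> \<rho> = mat (N^t) (N^t) (\<lambda>(i,j).
     integral\<^sup>L \<mu> (\<lambda>f. kron_pow t (mat N N f * \<rho> * dag (mat N N f)) $$ (i,j)))"

definition ketbra :: "complex vec \<Rightarrow> complex mat" where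
  "ketbra a = mat (dim_vec a) (dim_vec a) (\<lambda>(i,j). a $ i * cnj (a $ j))"

end

theory Submission
  imports Defs "Jordan_Normal_Form.Schur_Decomposition"
begin

text \<open>
  Averaging \<open>\<theta>\<close> over a full period turns conjugation by the tensor powers of \<open>exp (\<i> \<theta> P / 2)\<close> into the
  pinching onto the eigenspaces of \<open>ad P\<close>, where \<open>P\<close> acts by the sum over the \<open>t\<close> tensor factors.
  The eigenvalues of \<open>ad P\<close> are even integers of modulus at most \<open>2 t\<close>, so one minus the pinching
  dominates \<open>(ad P)\<^sup>2 / (4 t\<^sup>2)\<close>. Summing over all Pauli strings \<open>P\<close> with the completeness relation
  evaluates the quadratic form of the resulting Casimir operator on operators \<open>X\<close> on the symmetric subspace: it is a
  multiple of \<open>\<parallel>X\<parallel>\<^sup>2\<close> minus a multiple of \<open>\<parallel>tr\<^sub>1 X\<parallel>\<^sup>2\<close>. Hence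
  \<open>\<langle>X, C X\<rangle> \<le> \<lambda> \<parallel>X\<parallel>\<^sup>2 + K \<parallel>tr\<^sub>1 X\<parallel>\<^sup>2\<close>.

  The partial trace intertwines the channels for \<open>t + 1\<close> and \<open>t\<close> factors. By induction on \<open>t\<close> the error term
  therefore decays along the iterates of a traceless \<open>X\<close> at least as fast as \<open>\<lambda>\<^sup>2\<^sup>k\<close>. The moments
  \<open>\<langle>X, C\<^sup>k X\<rangle>\<close> are log-convex, and this forces them to be bounded by \<open>\<lambda>\<^sup>k \<parallel>X\<parallel>\<^sup>2\<close>, without decomposing
  the operator space into irreducible representations.

  The Haar state is fixed by the channel, and its Hilbert--Schmidt distance to the initial state is at most one, since
  both have the same overlap with it. The trace norm exceeds the Hilbert--Schmidt norm by at most
  the square root of the rank, which is at most the number of multisets of size \<open>t\<close> over \<open>N\<close> letters.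
\<close>

section \<open>Tensor powers acting on kernels over words\<close>

text \<open>The one-step estimate alone is not a contraction. Every eigenvalue of
  \<open>(ad P)^2\<close> is compared with \<open>4 t^2\<close>. On symmetric operators with
  vanishing partial trace, the sum of \<open>(ad P)^2\<close> over the \<open>N^2 - 1\<close>
  strings has the value \<open>2 t N (N + t - 1)\<close>. Division by \<open>4 t^2 (N^2 - 1)\<close>
  gives the rate, and splitting \<open>N + t - 1\<close> into \<open>N - 1\<close> and
  \<open>t\<close> gives the two subtracted terms of the theorem. On operators that come from fewer
  factors the Casimir value is smaller while the divisor stays \<open>4 t^2\<close>, so the gap
  obtained there would be too small. The partial trace repairs this: it sees the same operator with
  fewer factors, hence with a smaller divisor, and the rate increases with the number of factors.
  What is left is a recursion whose error has the same geometric order as the claimed bound.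
  Iterating it directly would cost a factor growing with \<open>k\<close>. Log-convexity removes
  this factor: the ratios of consecutive moments cannot decrease, so a single bad ratio would
  already produce a strictly larger exponential rate, which the recursion excludes.\<close>

text \<open>
  A matrix on \<open>t\<close> tensor factors is represented by its kernel \<open>X u v\<close> indexed by words of length \<open>t\<close>. It lives on
  the symmetric subspace iff it depends on \<open>u\<close> and on \<open>v\<close> only through their multisets of letters; for Hermitian
  kernels the condition on \<open>u\<close> suffices.
\<close>

definition words :: "nat \<Rightarrow> nat \<Rightarrow> nat list set" where
  "words N t = {u. length u = t \<and> set u \<subseteq> {..<N}}"

fun tensor_pow :: "(nat \<Rightarrow> nat \<Rightarrow> complex) \<Rightarrow> nat list \<Rightarrow> nat list \<Rightarrow> complex" where
  "tensor_pow A [] [] = 1"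
| "tensor_pow A (a # u) (b # v) = A a b * tensor_pow A u v"
| "tensor_pow A _ _ = 0"

definition mat_mul :: "nat \<Rightarrow> (nat \<Rightarrow> nat \<Rightarrow> complex) \<Rightarrow> (nat \<Rightarrow> nat \<Rightarrow> complex) \<Rightarrow> nat \<Rightarrow> nat \<Rightarrow> complex" where
  "mat_mul N A B a b = (\<Sum>c<N. A a c * B c b)"

definition adj :: "(nat \<Rightarrow> nat \<Rightarrow> complex) \<Rightarrow> nat \<Rightarrow> nat \<Rightarrow> complex" where
  "adj A a b = cnj (A b a)"

definition unitary_on :: "nat \<Rightarrow> (nat \<Rightarrow> nat \<Rightarrow> complex) \<Rightarrow> bool" where
  "unitary_on N A \<longleftrightarrow> (\<forall>a<N. \<forall>b<N. mat_mul N (adj A) A a b = of_bool (a = b) \<and> mat_mul N A (adj A) a b = of_bool (a = b))"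

definition tensor_act :: "nat \<Rightarrow> nat \<Rightarrow> (nat \<Rightarrow> nat \<Rightarrow> complex) \<Rightarrow> (nat list \<Rightarrow> complex) \<Rightarrow> nat list \<Rightarrow> complex" where
  "tensor_act N t A G u = (\<Sum>x\<in>words N t. tensor_pow A u x * G x)"

definition conj_by :: "nat \<Rightarrow> nat \<Rightarrow> (nat \<Rightarrow> nat \<Rightarrow> complex) \<Rightarrow> (nat list \<Rightarrow> nat list \<Rightarrow> complex)
    \<Rightarrow> nat list \<Rightarrow> nat list \<Rightarrow> complex" where
  "conj_by N t A X u v = (\<Sum>x\<in>words N t. \<Sum>y\<in>words N t. tensor_pow A u x * X x y * cnj (tensor_pow A v y))"

definition hs_inner :: "nat \<Rightarrow> nat \<Rightarrow> (nat list \<Rightarrow> nat list \<Rightarrow> complex) \<Rightarrow> (nat list \<Rightarrow> nat list \<Rightarrow> complex) \<Rightarrow> complex" where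
  "hs_inner N t X Y = (\<Sum>u\<in>words N t. \<Sum>v\<in>words N t. cnj (X u v) * Y u v)"

definition partial_tr :: "nat \<Rightarrow> (nat list \<Rightarrow> nat list \<Rightarrow> complex) \<Rightarrow> nat list \<Rightarrow> nat list \<Rightarrow> complex" where
  "partial_tr N X u v = (\<Sum>a<N. X (a # u) (a # v))"

definition full_tr :: "nat \<Rightarrow> nat \<Rightarrow> (nat list \<Rightarrow> nat list \<Rightarrow> complex) \<Rightarrow> complex" where
  "full_tr N t X = (\<Sum>u\<in>words N t. X u u)"

definition perm_invariant :: "nat \<Rightarrow> nat \<Rightarrow> (nat list \<Rightarrow> 'b) \<Rightarrow> bool" where
  "perm_invariant N t G \<longleftrightarrow> (\<forall>u\<in>words N t. \<forall>v\<in>words N t. mset u = mset v \<longrightarrow> G u = G v)"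

definition herm_sym :: "nat \<Rightarrow> nat \<Rightarrow> (nat list \<Rightarrow> nat list \<Rightarrow> complex) \<Rightarrow> bool" where
  "herm_sym N t X \<longleftrightarrow> (\<forall>u\<in>words N t. \<forall>v\<in>words N t. X v u = cnj (X u v))
     \<and> (\<forall>v\<in>words N t. perm_invariant N t (\<lambda>u. X u v))"

lemma lsymD: "perm_invariant N t G \<Longrightarrow> u \<in> words N t \<Longrightarrow> v \<in> words N t \<Longrightarrow> mset u = mset v \<Longrightarrow> G u = G v"
  by (rule perm_invariant_def[THEN iffD1, rule_format])

lemma herm_symD:
  assumes "herm_sym N t X"
  shows "u \<in> words N t \<Longrightarrow> v \<in> words N t \<Longrightarrow> X v u = cnj (X u v)"
    and "u \<in> words N t \<Longrightarrow> u' \<in> words N t \<Longrightarrow> v \<in> words N t \<Longrightarrow> mset u = mset u' \<Longrightarrow> X u v = X u' v"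
proof -
  show "X v u = cnj (X u v)" if "u \<in> words N t" "v \<in> words N t"
    by (rule conjunct1[OF assms[unfolded herm_sym_def], rule_format, OF that])
  show "X u v = X u' v" if "u \<in> words N t" "u' \<in> words N t" "v \<in> words N t" "mset u = mset u'"
    by (rule lsymD[OF conjunct2[OF assms[unfolded herm_sym_def], rule_format, OF that(3)] that(1,2,4)])
qed

lemma herm_symI:
  assumes "\<And>u v. u \<in> words N t \<Longrightarrow> v \<in> words N t \<Longrightarrow> X v u = cnj (X u v)"
    and "\<And>u u' v. u \<in> words N t \<Longrightarrow> u' \<in> words N t \<Longrightarrow> v \<in> words N t \<Longrightarrow> mset u = mset u' \<Longrightarrow> X u v = X u' v"
  shows "herm_sym N t X"
  unfolding herm_sym_def perm_invariant_def by (intro conjI ballI impI assms)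

lemma finite_words [simp]: "finite (words N t)"
proof -
  have "words N t = {u. set u \<subseteq> {..<N} \<and> length u = t}" by (auto simp: words_def)
  then show ?thesis by (simp add: finite_lists_length_eq)
qed

lemma words_0 [simp]: "words N 0 = {[]}"
  by (auto simp: words_def)

lemma Cons_in_words [simp]: "a # u \<in> words N (Suc t) \<longleftrightarrow> a < N \<and> u \<in> words N t"
  by (auto simp: words_def)

lemma words_Suc: "words N (Suc t) = (\<lambda>(a, u). a # u) ` ({..<N} \<times> words N t)"
  by (auto simp: words_def length_Suc_conv image_iff)

lemma sum_words_Suc: "(\<Sum>w\<in>words N (Suc t). f w) = (\<Sum>a<N. \<Sum>u\<in>words N t. f (a # u))"
  unfolding words_Suc
  by (subst sum.reindex) (auto simp: inj_on_def sum.cartesian_product case_prod_unfold)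

lemma words_SucE: assumes "w \<in> words N (Suc t)"
  obtains a u where "w = a # u" "a < N" "u \<in> words N t"
  using assms by (auto simp: words_Suc)

lemma adj_adj [simp]: "adj (adj A) = A" by (simp add: adj_def fun_eq_iff)

lemma tensor_pow_adj: "tensor_pow (adj A) u v = cnj (tensor_pow A v u)"
  by (induction A v u rule: tensor_pow.induct) (auto simp: adj_def)

lemma unitary_on_adj: "unitary_on N A \<Longrightarrow> unitary_on N (adj A)"
  by (auto simp: unitary_on_def)

lemma tensor_act_0 [simp]: "tensor_act N 0 A G [] = G []" by (simp add: tensor_act_def)

lemma tensor_act_Cons: "tensor_act N (Suc t) A G (a # u) = (\<Sum>b<N. A a b * tensor_act N t A (\<lambda>x. G (b # x)) u)"
  by (simp add: tensor_act_def sum_words_Suc sum_distrib_left mult.assoc)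

lemma tensor_act_cong:
  assumes "\<And>x. x \<in> words N t \<Longrightarrow> G x = H x" shows "tensor_act N t A G u = tensor_act N t A H u"
  using assms by (simp add: tensor_act_def)

lemma tensor_act_scale: "tensor_act N t A (\<lambda>x. c * G x) u = c * tensor_act N t A G u"
  by (simp add: tensor_act_def sum_distrib_left mult.left_commute)

lemma tensor_pow_mat_mul: "u \<in> words N t \<Longrightarrow> v \<in> words N t \<Longrightarrow> tensor_pow (mat_mul N A B) u v = (\<Sum>x\<in>words N t. tensor_pow A u x * tensor_pow B x v)"
proof (induction t arbitrary: u v)
  case (Suc t)
  obtain a u' b v' where [simp]: "u = a # u'" "u' \<in> words N t" "v = b # v'" "v' \<in> words N t"
    using Suc.prems by (elim words_SucE) auto
  show ?case
    by (simp add: Suc.IH sum_words_Suc mat_mul_def[of N A B a b] sum_product ac_simps)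
qed simp

lemma tensor_pow_one:
  assumes "\<And>a b. a < N \<Longrightarrow> b < N \<Longrightarrow> A a b = of_bool (a = b)"
    and "u \<in> words N t" "v \<in> words N t"
  shows "tensor_pow A u v = of_bool (u = v)"
  using assms(2,3)
proof (induction t arbitrary: u v)
  case (Suc t)
  then obtain a u' b v' where "u = a # u'" "u' \<in> words N t" "a < N" "v = b # v'" "v' \<in> words N t" "b < N"
    by (elim words_SucE) auto
  then show ?case using Suc.IH assms(1) by simp
qed simp

lemma tensor_pow_unit:
  assumes "unitary_on N A" "x \<in> words N t" "y \<in> words N t"
  shows "(\<Sum>u\<in>words N t. cnj (tensor_pow A u x) * tensor_pow A u y) = of_bool (x = y)"
proof -
  have "(\<Sum>u\<in>words N t. cnj (tensor_pow A u x) * tensor_pow A u y) = tensor_pow (mat_mul N (adj A) A) x y"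
    using assms by (simp add: tensor_pow_mat_mul tensor_pow_adj)
  also have "\<dots> = of_bool (x = y)"
    by (rule tensor_pow_one) (use assms in \<open>auto simp: unitary_on_def\<close>)
  finally show ?thesis .
qed

lemma conj_by_cong:
  assumes "\<And>x y. x \<in> words N t \<Longrightarrow> y \<in> words N t \<Longrightarrow> X x y = Y x y"
  shows "conj_by N t A X u v = conj_by N t A Y u v"
  using assms by (simp add: conj_by_def)

lemma conj_by_sum: "conj_by N t A (\<lambda>x y. \<Sum>i\<in>I. X i x y) u v = (\<Sum>i\<in>I. conj_by N t A (X i) u v)"
  by (simp add: conj_by_def sum_distrib_left sum_distrib_right sum.swap[of _ I])

lemma conj_by_diff: "conj_by N t A (\<lambda>x y. X x y - Y x y) u v = conj_by N t A X u v - conj_by N t A Y u v"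
  by (simp add: conj_by_def sum_subtractf algebra_simps)

text \<open>Splits conjugation into two one-sided actions, with conjugates around the one on
  columns, so that facts on \<open>tensor_act\<close> carry over to kernels.\<close>

lemma conj_by_eq_tensor_act: "conj_by N t A X u v = tensor_act N t A (\<lambda>x. cnj (tensor_act N t A (\<lambda>y. cnj (X x y)) v)) u"
  by (simp add: conj_by_def tensor_act_def sum_distrib_left sum_distrib_right ac_simps)

lemma conj_by_mat_mul:
  assumes "u \<in> words N t" "v \<in> words N t"
  shows "conj_by N t A (conj_by N t B X) u v = conj_by N t (mat_mul N A B) X u v"
proof -
  let ?W = "words N t"
  have "conj_by N t A (conj_by N t B X) u v = (\<Sum>x\<in>?W. \<Sum>y\<in>?W. \<Sum>x'\<in>?W. \<Sum>y'\<in>?W.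
      (tensor_pow A u x * tensor_pow B x x') * X x' y' * cnj (tensor_pow A v y * tensor_pow B y y'))"
    by (simp add: conj_by_def sum_distrib_left sum_distrib_right ac_simps)
  also have "\<dots> = (\<Sum>x\<in>?W. \<Sum>x'\<in>?W. \<Sum>y\<in>?W. \<Sum>y'\<in>?W.
      (tensor_pow A u x * tensor_pow B x x') * X x' y' * cnj (tensor_pow A v y * tensor_pow B y y'))"
    by (intro sum.cong refl sum.swap)
  also have "\<dots> = (\<Sum>x'\<in>?W. \<Sum>x\<in>?W. \<Sum>y'\<in>?W. \<Sum>y\<in>?W.
      (tensor_pow A u x * tensor_pow B x x') * X x' y' * cnj (tensor_pow A v y * tensor_pow B y y'))"
    by (subst sum.swap) (intro sum.cong refl sum.swap)
  also have "\<dots> = (\<Sum>x'\<in>?W. \<Sum>y'\<in>?W. \<Sum>x\<in>?W. \<Sum>y\<in>?W.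
      (tensor_pow A u x * tensor_pow B x x') * X x' y' * cnj (tensor_pow A v y * tensor_pow B y y'))"
    by (intro sum.cong refl sum.swap)
  also have "\<dots> = (\<Sum>x'\<in>?W. \<Sum>y'\<in>?W. \<Sum>y\<in>?W. \<Sum>x\<in>?W.
      (tensor_pow A u x * tensor_pow B x x') * X x' y' * cnj (tensor_pow A v y * tensor_pow B y y'))"
    by (intro sum.cong refl sum.swap)
  also have "\<dots> = (\<Sum>x'\<in>?W. \<Sum>y'\<in>?W. (\<Sum>x\<in>?W. tensor_pow A u x * tensor_pow B x x') * X x' y' * cnj (\<Sum>y\<in>?W. tensor_pow A v y * tensor_pow B y y'))"
    by (simp add: sum_distrib_left sum_distrib_right )
  also have "\<dots> = conj_by N t (mat_mul N A B) X u v"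
    using assms by (simp add: conj_by_def tensor_pow_mat_mul)
  finally show ?thesis .
qed

lemma conj_by_one:
  assumes "\<And>a b. a < N \<Longrightarrow> b < N \<Longrightarrow> A a b = of_bool (a = b)"
    and "u \<in> words N t" "v \<in> words N t"
  shows "conj_by N t A X u v = X u v"
proof -
  have "conj_by N t A X u v = (\<Sum>x\<in>words N t. if u = x then \<Sum>y\<in>words N t. if v = y then X x y else 0 else 0)"
    unfolding conj_by_def using assms by (intro sum.cong refl) (auto simp: tensor_pow_one[OF assms(1)] of_bool_def
        if_distrib[where f = cnj] if_distrib[where f = "(*) _"] cong: if_cong)
  also have "\<dots> = X u v" using assms by simp
  finally show ?thesis .
qed

lemma conj_by_adj_conj_by:
  assumes "unitary_on N A" "u \<in> words N t" "v \<in> words N t"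
  shows "conj_by N t (adj A) (conj_by N t A X) u v = X u v" "conj_by N t A (conj_by N t (adj A) X) u v = X u v"
  using assms by (auto simp: conj_by_mat_mul unitary_on_def intro!: conj_by_one)

lemma conj_by_mat_cong:
  assumes "\<And>a b. a < N \<Longrightarrow> b < N \<Longrightarrow> A a b = B a b" and "u \<in> words N t" "v \<in> words N t"
  shows "conj_by N t A X u v = conj_by N t B X u v"
proof -
  have "tensor_pow A x y = tensor_pow B x y" if "x \<in> words N t" "y \<in> words N t" for x y
    using that
  proof (induction t arbitrary: x y)
    case (Suc t)
    then obtain a u' b v' where "x = a # u'" "u' \<in> words N t" "a < N" "y = b # v'" "v' \<in> words N t" "b < N"
      by (elim words_SucE) auto
    then show ?case using Suc.IH assms(1) by simp
  qed simp
  then show ?thesis using assms(2,3) by (simp add: conj_by_def)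
qed

lemma hs_inner_conj_by_adj: "hs_inner N t (conj_by N t A X) Y = hs_inner N t X (conj_by N t (adj A) Y)"
proof -
  let ?W = "words N t"
  have "hs_inner N t (conj_by N t A X) Y = (\<Sum>u\<in>?W. \<Sum>v\<in>?W. \<Sum>x\<in>?W. \<Sum>y\<in>?W.
      cnj (tensor_pow A u x) * cnj (X x y) * tensor_pow A v y * Y u v)"
    by (simp add: hs_inner_def conj_by_def sum_distrib_left sum_distrib_right ac_simps)
  also have "\<dots> = (\<Sum>u\<in>?W. \<Sum>x\<in>?W. \<Sum>v\<in>?W. \<Sum>y\<in>?W.
      cnj (tensor_pow A u x) * cnj (X x y) * tensor_pow A v y * Y u v)"
    by (intro sum.cong refl sum.swap)
  also have "\<dots> = (\<Sum>x\<in>?W. \<Sum>u\<in>?W. \<Sum>y\<in>?W. \<Sum>v\<in>?W.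
      cnj (tensor_pow A u x) * cnj (X x y) * tensor_pow A v y * Y u v)"
    by (subst sum.swap) (intro sum.cong refl sum.swap)
  also have "\<dots> = (\<Sum>x\<in>?W. \<Sum>y\<in>?W. \<Sum>u\<in>?W. \<Sum>v\<in>?W.
      cnj (tensor_pow A u x) * cnj (X x y) * tensor_pow A v y * Y u v)"
    by (intro sum.cong refl sum.swap)
  also have "\<dots> = hs_inner N t X (conj_by N t (adj A) Y)"
    by (simp add: hs_inner_def conj_by_def tensor_pow_adj sum_distrib_left sum_distrib_right ac_simps)
  finally show ?thesis .
qed

lemma hs_inner_cong:
  assumes "\<And>x y. x \<in> words N t \<Longrightarrow> y \<in> words N t \<Longrightarrow> X x y = X' x y"
    "\<And>x y. x \<in> words N t \<Longrightarrow> y \<in> words N t \<Longrightarrow> Y x y = Y' x y"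
  shows "hs_inner N t X Y = hs_inner N t X' Y'"
  using assms by (simp add: hs_inner_def)

lemma hs_inner_unit:
  assumes "unitary_on N A" shows "hs_inner N t (conj_by N t A X) (conj_by N t A Y) = hs_inner N t X Y"
  unfolding hs_inner_conj_by_adj by (rule hs_inner_cong) (use assms in \<open>auto simp: conj_by_adj_conj_by\<close>)

lemma hs_inner_commute: "hs_inner N t Y X = cnj (hs_inner N t X Y)"
  by (simp add: hs_inner_def ac_simps)

text \<open>Tensor powers commute with permutations of the factors. No permutations are handled
  explicitly: two words with the same multiset either share their head, or can be linked through two
  words that differ by a swap of the first two letters.\<close>

lemma tensor_act_perm_invariant:
  assumes "perm_invariant N t G" "u \<in> words N t" "v \<in> words N t" "mset u = mset v"
  shows "tensor_act N t A G u = tensor_act N t A G v"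
  using assms
proof (induction t arbitrary: G u v)
  case (Suc t)
  obtain a u' b v' where [simp]: "u = a # u'" "u' \<in> words N t" "a < N" "v = b # v'" "v' \<in> words N t" "b < N"
    using Suc.prems(2,3) by (elim words_SucE) auto
  have sub: "perm_invariant N t (\<lambda>x. G (c # x))" if "c < N" for c
    unfolding perm_invariant_def using that by (intro ballI impI lsymD[OF Suc.prems(1)]) auto
  have step: "tensor_act N (Suc t) A G (c # x) = tensor_act N (Suc t) A G (c # y)"
    if "x \<in> words N t" "y \<in> words N t" "mset x = mset y" for c x y
    unfolding tensor_act_Cons by (intro sum.cong refl arg_cong2[where f = "(*)"] Suc.IH sub that) auto
  show ?case
  proof (cases "a = b")
    case True
    then show ?thesis using Suc.prems(4) step[of u' v' a] by simp
  next
    case False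
    have eq: "add_mset a (mset u') = add_mset b (mset v')" using Suc.prems(4) by simp
    \<comment> \<open>With different heads, each tail contains the head of the other word. Removing
      it leaves the common rest \<open>M\<close>, so \<open>a # b # z\<close> and
      \<open>b # a # z\<close> serve as intermediate words.\<close>
    then obtain M where M: "mset u' = add_mset b M" "mset v' = add_mset a M"
      using False by (auto simp: add_eq_conv_ex)
    obtain z where z: "mset z = M" using ex_mset by blast
    obtain s where s: "t = Suc s" using M(1) \<open>u' \<in> words N t\<close>
      by (cases t) (auto simp: words_def)
    have "mset u' = mset (b # z)" using M(1) z by simp
    from mset_eq_setD[OF this] mset_eq_length[OF this]
    have sz: "set u' = insert b (set z)" "length u' = Suc (length z)" by simp_all
    have zw: "z \<in> words N s" using sz \<open>u' \<in> words N t\<close> s by (auto simp: words_def)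
    have zt: "a # z \<in> words N t" "b # z \<in> words N t" using zw s by simp_all
    have "tensor_act N (Suc t) A G (a # u') = tensor_act N (Suc t) A G (a # b # z)"
      by (intro step zt) (simp_all add: M z)
    also have "\<dots> = (\<Sum>c<N. \<Sum>d<N. A a c * (A b d * tensor_act N s A (\<lambda>x. G (c # d # x)) z))"
      by (simp add: s tensor_act_Cons sum_distrib_left)
    also have "\<dots> = (\<Sum>d<N. \<Sum>c<N. A a c * (A b d * tensor_act N s A (\<lambda>x. G (c # d # x)) z))"
      by (rule sum.swap)
    \<comment> \<open>Invariance of \<open>G\<close> under the swap puts the letter paired with
      \<open>b\<close> first, after which the scalar factors can be regrouped as the action at
      \<open>b # a # z\<close>.\<close>
    also have "\<dots> = (\<Sum>d<N. \<Sum>c<N. A a c * (A b d * tensor_act N s A (\<lambda>x. G (d # c # x)) z))"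
      by (intro sum.cong refl arg_cong2[where f = "(*)"] tensor_act_cong lsymD[OF Suc.prems(1)]) (simp_all add: s)
    also have "\<dots> = tensor_act N (Suc t) A G (b # a # z)"
      by (simp add: s tensor_act_Cons sum_distrib_left mult.left_commute[of "A a _"])
    also have "\<dots> = tensor_act N (Suc t) A G (b # v')"
      by (intro step zt) (simp_all add: M z)
    finally show ?thesis by simp
  qed
qed (auto simp: words_def)

lemma conj_by_herm_sym:
  assumes X: "herm_sym N t X" shows "herm_sym N t (conj_by N t A X)"
proof (rule herm_symI)
  fix u v assume "u \<in> words N t" "v \<in> words N t"
  have "conj_by N t A X v u = (\<Sum>y\<in>words N t. \<Sum>x\<in>words N t. tensor_pow A v x * X x y * cnj (tensor_pow A u y))"
    unfolding conj_by_def by (rule sum.swap)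
  also have "\<dots> = (\<Sum>y\<in>words N t. \<Sum>x\<in>words N t. tensor_pow A v x * cnj (X y x) * cnj (tensor_pow A u y))"
    by (intro sum.cong refl arg_cong2[where f = "(*)"] herm_symD(1)[OF X])
  also have "\<dots> = cnj (conj_by N t A X u v)" by (simp add: conj_by_def ac_simps)
  finally show "conj_by N t A X v u = cnj (conj_by N t A X u v)" .
next
  fix u u' v assume u: "u \<in> words N t" "u' \<in> words N t" "v \<in> words N t" "mset u = mset u'"
  have "perm_invariant N t (\<lambda>x. cnj (tensor_act N t A (\<lambda>y. cnj (X x y)) v))"
    unfolding perm_invariant_def
    by (intro ballI impI arg_cong[where f = cnj] tensor_act_cong herm_symD(2)[OF X])
  from tensor_act_perm_invariant[OF this u(1,2,4)] show "conj_by N t A X u v = conj_by N t A X u' v"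
    by (simp add: conj_by_eq_tensor_act)
qed

lemma conj_by_Cons:
  "conj_by N (Suc t) A X (a # u) (b # v) =
    (\<Sum>c<N. \<Sum>d<N. A a c * cnj (A b d) * conj_by N t A (\<lambda>x y. X (c # x) (d # y)) u v)"
proof -
  have "conj_by N (Suc t) A X (a # u) (b # v) = (\<Sum>c<N. \<Sum>x\<in>words N t. \<Sum>d<N. \<Sum>y\<in>words N t.
     A a c * tensor_pow A u x * X (c # x) (d # y) * (cnj (A b d) * cnj (tensor_pow A v y)))"
    by (simp add: conj_by_def sum_words_Suc)
  also have "\<dots> = (\<Sum>c<N. \<Sum>d<N. \<Sum>x\<in>words N t. \<Sum>y\<in>words N t.
     A a c * tensor_pow A u x * X (c # x) (d # y) * (cnj (A b d) * cnj (tensor_pow A v y)))"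
    by (intro sum.cong refl sum.swap)
  also have "\<dots> = (\<Sum>c<N. \<Sum>d<N. A a c * cnj (A b d) * conj_by N t A (\<lambda>x y. X (c # x) (d # y)) u v)"
    by (simp add: conj_by_def sum_distrib_left sum_distrib_right ac_simps)
  finally show ?thesis .
qed

text \<open>In the traced slot the matrix meets its own adjoint, so by unitarity it drops out there
  and acts on the remaining slots only.\<close>

lemma partial_tr_conj_by:
  assumes "unitary_on N A"
  shows "partial_tr N (conj_by N (Suc t) A X) u v = conj_by N t A (partial_tr N X) u v"
proof -
  have "partial_tr N (conj_by N (Suc t) A X) u v =
     (\<Sum>a<N. \<Sum>c<N. \<Sum>d<N. A a c * cnj (A a d) * conj_by N t A (\<lambda>x y. X (c # x) (d # y)) u v)"
    by (simp add: partial_tr_def conj_by_Cons)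
  also have "\<dots> = (\<Sum>c<N. \<Sum>d<N. \<Sum>a<N. A a c * cnj (A a d) * conj_by N t A (\<lambda>x y. X (c # x) (d # y)) u v)"
    by (subst sum.swap) (intro sum.cong refl sum.swap)
  also have "\<dots> = (\<Sum>c<N. \<Sum>d<N. (mat_mul N (adj A) A d c) * conj_by N t A (\<lambda>x y. X (c # x) (d # y)) u v)"
    by (simp add: mat_mul_def adj_def sum_distrib_right ac_simps)
  also have "\<dots> = (\<Sum>c<N. \<Sum>d<N. of_bool (d = c) * conj_by N t A (\<lambda>x y. X (c # x) (d # y)) u v)"
    using assms by (intro sum.cong refl) (auto simp: unitary_on_def)
  also have "\<dots> = (\<Sum>c<N. conj_by N t A (\<lambda>x y. X (c # x) (c # y)) u v)"
  proof (intro sum.cong refl)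
    fix c assume "c \<in> {..<N}"
    have "(\<Sum>d<N. of_bool (d = c) * conj_by N t A (\<lambda>x y. X (c # x) (d # y)) u v) =
        (\<Sum>d<N. if d = c then conj_by N t A (\<lambda>x y. X (c # x) (d # y)) u v else 0)"
      by (intro sum.cong) auto
    then show "(\<Sum>d<N. of_bool (d = c) * conj_by N t A (\<lambda>x y. X (c # x) (d # y)) u v) =
        conj_by N t A (\<lambda>x y. X (c # x) (c # y)) u v"
      using \<open>c \<in> {..<N}\<close> by simp
  qed
  also have "\<dots> = conj_by N t A (partial_tr N X) u v"
    by (simp add: partial_tr_def[abs_def] conj_by_sum)
  finally show ?thesis .
qed

lemma full_tr_partial_tr: "full_tr N t (partial_tr N X) = full_tr N (Suc t) X"
  by (simp add: full_tr_def partial_tr_def sum_words_Suc sum.swap[of _ "words N t"])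

lemma herm_sym_partial_tr:
  assumes "herm_sym N (Suc t) X" shows "herm_sym N t (partial_tr N X)"
proof (rule herm_symI)
  show "partial_tr N X v u = cnj (partial_tr N X u v)" if "u \<in> words N t" "v \<in> words N t" for u v
    unfolding partial_tr_def cnj_sum using that by (intro sum.cong refl herm_symD(1)[OF assms]) simp_all
  show "partial_tr N X u v = partial_tr N X u' v"
    if "u \<in> words N t" "u' \<in> words N t" "v \<in> words N t" "mset u = mset u'" for u u' v
    unfolding partial_tr_def using that by (intro sum.cong refl herm_symD(2)[OF assms]) simp_all
qed

section \<open>Moments, inner products and symmetric sums\<close>

text \<open>
  By log-convexity a ratio of consecutive moments exceeding \<open>l\<close> persists, and the resulting growth at a rate larger
  than \<open>l\<close> contradicts the last assumption.
\<close>

lemma moment_decay: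
  fixes m :: "nat \<Rightarrow> real"
  assumes nonneg: "\<And>k. 0 \<le> m k" and logconv: "\<And>k. (m (Suc k))\<^sup>2 \<le> m k * m (Suc (Suc k))"
    and "0 < l" and bound: "\<And>k. m (Suc (2 * k)) \<le> l * m (2 * k) + C * l ^ (2 * k)"
  shows "m k \<le> l ^ k * m 0"
proof -
  have step: "m (Suc j) \<le> l * m j" for j
  proof (rule ccontr)
    assume "\<not> m (Suc j) \<le> l * m j"
    then have gt: "l * m j < m (Suc j)" by simp
    have mj: "0 < m j"
    proof (rule ccontr)
      assume "\<not> 0 < m j"
      with nonneg[of j] have "m j = 0" by simp
      with logconv[of j] gt show False by simp
    qed
    define r where "r = m (Suc j) / m j"
    have r: "l < r" using gt mj by (simp add: r_def pos_less_divide_eq)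
    have r0: "0 < r" using r \<open>0 < l\<close> by simp
    \<comment> \<open>Positivity is carried along because the factor \<open>m (j + i)\<close> has to
      be cancelled from the log-convexity inequality.\<close>
    have ratio: "0 < m (j + i) \<and> r * m (j + i) \<le> m (Suc (j + i))" for i
    proof (induction i)
      case 0 show ?case using mj by (simp add: r_def)
    next
      case (Suc i)
      have pos: "0 < m (Suc (j + i))"
        using Suc mult_pos_pos[OF r0, of "m (j + i)"] by linarith
      have "r * m (j + i) * m (Suc (j + i)) \<le> (m (Suc (j + i)))\<^sup>2"
        using Suc pos by (simp add: power2_eq_square)
      also have "\<dots> \<le> m (j + i) * m (Suc (Suc (j + i)))" by (rule logconv)
      finally have "m (j + i) * (r * m (Suc (j + i))) \<le> m (j + i) * m (Suc (Suc (j + i)))"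
        by (simp add: ac_simps)
      then show ?case using Suc pos by (simp add: mult_le_cancel_left)
    qed
    have grow: "r ^ i * m j \<le> m (j + i)" for i
    proof (induction i)
      case (Suc i)
      have "r ^ Suc i * m j \<le> r * m (j + i)" using Suc r0 by (simp add: mult.assoc)
      then show ?case using ratio[of i] by simp
    qed simp
    \<comment> \<open>The upper bound is available only after an even number of steps, so growth is
      tested at \<open>2 * k\<close>. The right-hand side does not depend on \<open>k\<close>, which
      is what makes the contradiction possible.\<close>
    have bnd: "(r / l) ^ (2 * k) \<le> C * r ^ j / ((r - l) * m j)" if "j \<le> 2 * k" for k
    proof -
      obtain i where i: "2 * k = j + i" using \<open>j \<le> 2 * k\<close> le_Suc_ex by blast
      have rk: "r ^ (2 * k) = r ^ i * r ^ j" by (simp add: i power_add)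
      have "r * m (2 * k) \<le> l * m (2 * k) + C * l ^ (2 * k)"
        using ratio[of i] bound[of k] i by simp
      then have "(r - l) * m (2 * k) \<le> C * l ^ (2 * k)" by (simp add: algebra_simps)
      moreover have "(r - l) * (r ^ i * m j) \<le> (r - l) * m (2 * k)"
        using grow[of i] r i by simp
      ultimately have "(r - l) * (r ^ i * m j) \<le> C * l ^ (2 * k)" by simp
      then have "(r - l) * (r ^ i * m j) * r ^ j \<le> C * l ^ (2 * k) * r ^ j"
        using r0 by (intro mult_right_mono) auto
      then have "((r - l) * m j) * r ^ (2 * k) \<le> C * r ^ j * l ^ (2 * k)"
        unfolding rk by (simp add: ac_simps)
      then show ?thesis using r mj \<open>0 < l\<close> by (simp add: power_divide field_simps)
    qed
    have "1 < r / l" using r \<open>0 < l\<close> by simp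
    then obtain n where n: "C * r ^ j / ((r - l) * m j) < (r / l) ^ n"
      using real_arch_pow by blast
    \<comment> \<open>The exponent \<open>2 * (n + j)\<close> is even, at least \<open>n\<close>,
      and large enough for the side condition \<open>j \<le> 2 * k\<close> of
      \<open>bnd\<close>.\<close>
    have "(r / l) ^ n \<le> (r / l) ^ (2 * (n + j))"
      using \<open>1 < r / l\<close> by (intro power_increasing) auto
    with bnd[of "n + j"] n show False by simp
  qed
  show ?thesis
  proof (induction k)
    case (Suc k)
    have "m (Suc k) \<le> l * m k" by (rule step)
    also have "\<dots> \<le> l * (l ^ k * m 0)" using Suc \<open>0 < l\<close> by simp
    finally show ?case by simp
  qed simp
qed

lemma Cauchy_Schwarz_cnj:
  "(Re (\<Sum>k\<in>K. cnj (f k) * g k))\<^sup>2 \<le> (\<Sum>k\<in>K. (cmod (f k))\<^sup>2) * (\<Sum>k\<in>K. (cmod (g k))\<^sup>2)"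
proof -
  have "\<bar>Re (\<Sum>k\<in>K. cnj (f k) * g k)\<bar> \<le> (\<Sum>k\<in>K. cmod (f k) * cmod (g k))"
    by (rule order_trans[OF abs_Re_le_cmod]) (rule sum_norm_le, simp add: norm_mult)
  then have "(Re (\<Sum>k\<in>K. cnj (f k) * g k))\<^sup>2 \<le> (\<Sum>k\<in>K. cmod (f k) * cmod (g k))\<^sup>2"
    by (rule abs_le_square_iff[THEN iffD1, OF order_trans[OF _ abs_ge_self]])
  also have "\<dots> \<le> (\<Sum>k\<in>K. (cmod (f k))\<^sup>2) * (\<Sum>k\<in>K. (cmod (g k))\<^sup>2)"
    by (rule Cauchy_Schwarz_ineq_sum)
  finally show ?thesis .
qed

definition hs_norm_sq :: "nat \<Rightarrow> nat \<Rightarrow> (nat list \<Rightarrow> nat list \<Rightarrow> complex) \<Rightarrow> real" where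
  "hs_norm_sq N t X = (\<Sum>u\<in>words N t. \<Sum>v\<in>words N t. (cmod (X u v))\<^sup>2)"

lemma cnj_mult_self: "cnj z * z = of_real ((cmod z)\<^sup>2)"
  by (metis complex_norm_square mult.commute of_real_power)

lemma hs_inner_self: "hs_inner N t X X = of_real (hs_norm_sq N t X)"
  by (simp add: hs_inner_def hs_norm_sq_def cnj_mult_self)

lemma hs_norm_sq_nonneg: "0 \<le> hs_norm_sq N t X"
  by (simp add: hs_norm_sq_def sum_nonneg)

lemma hs_norm_sq_cong:
  "(\<And>x y. x \<in> words N t \<Longrightarrow> y \<in> words N t \<Longrightarrow> X x y = Y x y) \<Longrightarrow> hs_norm_sq N t X = hs_norm_sq N t Y"
  by (simp add: hs_norm_sq_def)

lemma hs_inner_Cauchy_Schwarz: "(Re (hs_inner N t X Y))\<^sup>2 \<le> hs_norm_sq N t X * hs_norm_sq N t Y"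
  using Cauchy_Schwarz_cnj[of "\<lambda>(u, v). X u v" "\<lambda>(u, v). Y u v" "words N t \<times> words N t"]
  by (simp add: hs_inner_def hs_norm_sq_def sum.cartesian_product case_prod_unfold)

text \<open>The weight is a sum over the letters. By symmetry of \<open>G\<close> each of the
  \<open>Suc t\<close> positions contributes as much as the head.\<close>

lemma sum_weight_perm_invariant:
  fixes \<delta> :: "nat \<Rightarrow> complex" and G :: "nat list \<Rightarrow> complex"
  assumes "perm_invariant N (Suc t) G"
  shows "(\<Sum>w\<in>words N (Suc t). sum_list (map \<delta> w) * G w) = of_nat (Suc t) * (\<Sum>a<N. \<delta> a * (\<Sum>u\<in>words N t. G (a # u)))"
  using assms
proof (induction t arbitrary: G)
  case 0
  then show ?case by (simp add: sum_words_Suc)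
next
  case (Suc t)
  have sub: "perm_invariant N (Suc t) (\<lambda>x. G (c # x))" if "c < N" for c
    unfolding perm_invariant_def using that by (intro ballI impI lsymD[OF Suc.prems(1)]) auto
  have "(\<Sum>w\<in>words N (Suc (Suc t)). sum_list (map \<delta> w) * G w) =
     (\<Sum>a<N. \<delta> a * (\<Sum>w\<in>words N (Suc t). G (a # w))) + (\<Sum>a<N. \<Sum>w\<in>words N (Suc t). sum_list (map \<delta> w) * G (a # w))"
    by (subst sum_words_Suc) (simp add: algebra_simps sum.distrib sum_distrib_left)
  also have "(\<Sum>a<N. \<Sum>w\<in>words N (Suc t). sum_list (map \<delta> w) * G (a # w)) =
     (\<Sum>a<N. of_nat (Suc t) * (\<Sum>b<N. \<delta> b * (\<Sum>u\<in>words N t. G (a # b # u))))"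
    by (intro sum.cong refl Suc.IH sub) auto
  also have "\<dots> = of_nat (Suc t) * (\<Sum>b<N. \<Sum>a<N. \<delta> b * (\<Sum>u\<in>words N t. G (a # b # u)))"
    by (rule trans[OF sum_distrib_left[symmetric]], rule arg_cong[where f = "(*) _"], rule sum.swap)
  also have "(\<Sum>b<N. \<Sum>a<N. \<delta> b * (\<Sum>u\<in>words N t. G (a # b # u))) =
      (\<Sum>b<N. \<Sum>a<N. \<delta> b * (\<Sum>u\<in>words N t. G (b # a # u)))"
    by (intro sum.cong refl arg_cong2[where f = "(*)"] lsymD[OF Suc.prems(1)]) auto
  also have "\<dots> = (\<Sum>a<N. \<delta> a * (\<Sum>w\<in>words N (Suc t). G (a # w)))"
    by (simp add: sum_words_Suc sum_distrib_left)
  finally show ?case by (simp add: algebra_simps)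
qed

text \<open>Change of basis in one slot: the diagonal form \<open>\<delta>\<close> in the new basis
  is the form with matrix \<open>\<alpha>^* diag(\<delta>) \<alpha>\<close> in the old one. The
  index \<open>k\<close> collects all other slots.\<close>

lemma slot_sum:
  fixes \<delta> :: "nat \<Rightarrow> complex"
  shows "(\<Sum>a<N. \<delta> a * (\<Sum>k\<in>K. cnj (\<Sum>c<N. \<alpha> a c * z c k) * (\<Sum>c<N. \<alpha> a c * z' c k)))
    = (\<Sum>c<N. \<Sum>c'<N. (\<Sum>a<N. \<delta> a * (cnj (\<alpha> a c) * \<alpha> a c')) * (\<Sum>k\<in>K. cnj (z c k) * z' c' k))"
proof -
  have "(\<Sum>a<N. \<delta> a * (\<Sum>k\<in>K. cnj (\<Sum>c<N. \<alpha> a c * z c k) * (\<Sum>c<N. \<alpha> a c * z' c k)))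
    = (\<Sum>a<N. \<Sum>k\<in>K. \<Sum>c<N. \<Sum>c'<N. \<delta> a * (cnj (\<alpha> a c) * \<alpha> a c') * (cnj (z c k) * z' c' k))"
    by (simp add: sum_product sum_distrib_left cnj_sum ac_simps)
  also have "\<dots> = (\<Sum>a<N. \<Sum>c<N. \<Sum>k\<in>K. \<Sum>c'<N. \<delta> a * (cnj (\<alpha> a c) * \<alpha> a c') * (cnj (z c k) * z' c' k))"
    by (intro sum.cong refl sum.swap)
  also have "\<dots> = (\<Sum>c<N. \<Sum>a<N. \<Sum>k\<in>K. \<Sum>c'<N. \<delta> a * (cnj (\<alpha> a c) * \<alpha> a c') * (cnj (z c k) * z' c' k))"
    by (rule sum.swap)
  also have "\<dots> = (\<Sum>c<N. \<Sum>a<N. \<Sum>c'<N. \<Sum>k\<in>K. \<delta> a * (cnj (\<alpha> a c) * \<alpha> a c') * (cnj (z c k) * z' c' k))"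
    by (intro sum.cong refl sum.swap)
  also have "\<dots> = (\<Sum>c<N. \<Sum>c'<N. \<Sum>a<N. \<Sum>k\<in>K. \<delta> a * (cnj (\<alpha> a c) * \<alpha> a c') * (cnj (z c k) * z' c' k))"
    by (intro sum.cong refl sum.swap)
  also have "\<dots> = (\<Sum>c<N. \<Sum>c'<N. (\<Sum>a<N. \<delta> a * (cnj (\<alpha> a c) * \<alpha> a c')) * (\<Sum>k\<in>K. cnj (z c k) * z' c' k))"
    by (simp only: sum_distrib_right) (simp only: sum_distrib_left)
  finally show ?thesis .
qed

text \<open>\<open>slot_sum\<close> applied to the first slot with \<open>w\<close> as the family of
  vectors, then to the second slot inside each inner product. Separate matrices
  \<open>\<alpha>\<close> and \<open>\<beta>\<close> are allowed because a column slot carries the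
  conjugated basis.\<close>

lemma two_slot_sum:
  fixes \<delta> :: "nat \<Rightarrow> complex"
  shows "(\<Sum>a<N. \<Sum>b<N. \<delta> a * \<delta> b * (\<Sum>k\<in>K. cnj (\<Sum>c<N. \<Sum>e<N. \<alpha> a c * \<beta> b e * z c e k) *
        (\<Sum>c<N. \<Sum>e<N. \<alpha> a c * \<beta> b e * z c e k)))
    = (\<Sum>c<N. \<Sum>c'<N. \<Sum>e<N. \<Sum>e'<N. (\<Sum>a<N. \<delta> a * (cnj (\<alpha> a c) * \<alpha> a c')) * (\<Sum>b<N. \<delta> b * (cnj (\<beta> b e) * \<beta> b e'))
         * (\<Sum>k\<in>K. cnj (z c e k) * z c' e' k))"
proof -
  define w where "w b c k = (\<Sum>e<N. \<beta> b e * z c e k)" for b c k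
  define A where "A c c' = (\<Sum>a<N. \<delta> a * (cnj (\<alpha> a c) * \<alpha> a c'))" for c c'
  define C where "C e e' = (\<Sum>b<N. \<delta> b * (cnj (\<beta> b e) * \<beta> b e'))" for e e'
  define D where "D c e c' e' = (\<Sum>k\<in>K. cnj (z c e k) * z c' e' k)" for c e c' e'
  define B where "B b c c' = (\<Sum>k\<in>K. cnj (w b c k) * w b c' k)" for b c c'
  have "(\<Sum>a<N. \<Sum>b<N. \<delta> a * \<delta> b * (\<Sum>k\<in>K. cnj (\<Sum>c<N. \<Sum>e<N. \<alpha> a c * \<beta> b e * z c e k) *
        (\<Sum>c<N. \<Sum>e<N. \<alpha> a c * \<beta> b e * z c e k)))
     = (\<Sum>b<N. \<delta> b * (\<Sum>a<N. \<delta> a * (\<Sum>k\<in>K. cnj (\<Sum>c<N. \<alpha> a c * w b c k) * (\<Sum>c<N. \<alpha> a c * w b c k))))"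
    by (subst sum.swap) (simp add: w_def sum_distrib_left ac_simps)
  also have "\<dots> = (\<Sum>b<N. \<delta> b * (\<Sum>c<N. \<Sum>c'<N. A c c' * B b c c'))"
    unfolding A_def B_def by (intro sum.cong refl arg_cong[where f = "(*) _"] slot_sum)
  also have "\<dots> = (\<Sum>b<N. \<Sum>c<N. \<Sum>c'<N. A c c' * (\<delta> b * B b c c'))"
    by (simp add: sum_distrib_left mult.left_commute)
  also have "\<dots> = (\<Sum>c<N. \<Sum>b<N. \<Sum>c'<N. A c c' * (\<delta> b * B b c c'))"
    by (rule sum.swap)
  also have "\<dots> = (\<Sum>c<N. \<Sum>c'<N. \<Sum>b<N. A c c' * (\<delta> b * B b c c'))"
    by (intro sum.cong refl sum.swap)
  also have "\<dots> = (\<Sum>c<N. \<Sum>c'<N. A c c' * (\<Sum>b<N. \<delta> b * B b c c'))"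
    by (simp only: sum_distrib_left)
  also have "\<dots> = (\<Sum>c<N. \<Sum>c'<N. A c c' * (\<Sum>e<N. \<Sum>e'<N. C e e' * D c e c' e'))"
    unfolding B_def w_def C_def D_def by (intro sum.cong refl arg_cong[where f = "(*) _"] slot_sum)
  also have "\<dots> = (\<Sum>c<N. \<Sum>c'<N. \<Sum>e<N. \<Sum>e'<N. A c c' * C e e' * D c e c' e')"
    by (simp add: sum_distrib_left mult.assoc)
  finally show ?thesis unfolding A_def C_def D_def .
qed

lemma tensor_act_unit:
  assumes "unitary_on N A"
  shows "(\<Sum>u\<in>words N t. cnj (tensor_act N t A G u) * tensor_act N t A H u) = (\<Sum>u\<in>words N t. cnj (G u) * H u)"
proof -
  let ?W = "words N t"
  have "(\<Sum>u\<in>?W. cnj (tensor_act N t A G u) * tensor_act N t A H u) =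
     (\<Sum>u\<in>?W. \<Sum>x\<in>?W. \<Sum>y\<in>?W. cnj (tensor_pow A u x) * tensor_pow A u y * (cnj (G x) * H y))"
    unfolding tensor_act_def cnj_sum sum_product by (simp add: ac_simps)
  also have "\<dots> = (\<Sum>x\<in>?W. \<Sum>y\<in>?W. \<Sum>u\<in>?W. cnj (tensor_pow A u x) * tensor_pow A u y * (cnj (G x) * H y))"
    by (subst sum.swap) (intro sum.cong refl sum.swap)
  also have "\<dots> = (\<Sum>x\<in>?W. \<Sum>y\<in>?W. of_bool (x = y) * (cnj (G x) * H y))"
    by (intro sum.cong refl) (simp add: tensor_pow_unit[OF assms] flip: sum_distrib_right)
  also have "\<dots> = (\<Sum>x\<in>?W. \<Sum>y\<in>?W. if x = y then cnj (G x) * H y else 0)"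
    by (intro sum.cong refl) auto
  finally show ?thesis by simp
qed

section \<open>The pinching channel of a Pauli frame\<close>

lemma cnj_of_bool: "cnj (of_bool b) = of_bool b" by (cases b) auto

text \<open>Collects what the estimate uses of the nontrivial Pauli strings: an eigenbasis in the
  columns of \<open>W i\<close>, eigenvalues \<open>\<delta> i\<close> of modulus one, and
  completeness. The last assumption says that the sum of \<open>P \<otimes> P\<close> is
  \<open>N\<close> times the swap minus the identity; the full set of strings would give
  \<open>N\<close> times the swap.\<close>

locale pauli_frame =
  fixes N :: nat and I :: "'i set" and W :: "'i \<Rightarrow> nat \<Rightarrow> nat \<Rightarrow> complex" and \<delta> :: "'i \<Rightarrow> nat \<Rightarrow> real"
    and P :: "'i \<Rightarrow> nat \<Rightarrow> nat \<Rightarrow> complex"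
  assumes N2: "2 \<le> N" and fin: "finite I" and card_I: "real (card I) = (real N)\<^sup>2 - 1"
    and unit_W: "i \<in> I \<Longrightarrow> unitary_on N (W i)"
    and sign: "i \<in> I \<Longrightarrow> a < N \<Longrightarrow> \<delta> i a = 1 \<or> \<delta> i a = -1"
    and diag: "i \<in> I \<Longrightarrow> a < N \<Longrightarrow> b < N \<Longrightarrow> P i a b = (\<Sum>c<N. W i a c * of_real (\<delta> i c) * cnj (W i b c))"
    and complete: "a < N \<Longrightarrow> b < N \<Longrightarrow> c < N \<Longrightarrow> e < N \<Longrightarrow>
       (\<Sum>i\<in>I. P i a b * P i c e) = of_nat N * of_bool (a = e \<and> b = c) - of_bool (a = b \<and> c = e)"
begin

text \<open>Eigenvalue, at the product eigenvector labelled by \<open>u\<close>, of the sum of the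
  copies of \<open>P i\<close> over the tensor factors.\<close>

definition weight :: "'i \<Rightarrow> nat list \<Rightarrow> real" where
  "weight i u = sum_list (map (\<delta> i) u)"

definition eigenframe :: "'i \<Rightarrow> nat \<Rightarrow> (nat list \<Rightarrow> nat list \<Rightarrow> complex) \<Rightarrow> nat list \<Rightarrow> nat list \<Rightarrow> complex" where
  "eigenframe i t X = conj_by N t (adj (W i)) X"

text \<open>Projection onto the kernel of \<open>ad P\<close>: in the eigenbasis \<open>ad P\<close>
  multiplies the entry at \<open>u\<close>, \<open>v\<close> by the difference of the weights. It
  equals the average over the rotation angle by \<open>pinch_eq_integral\<close>.\<close>

definition pinch :: "'i \<Rightarrow> nat \<Rightarrow> (nat list \<Rightarrow> nat list \<Rightarrow> complex) \<Rightarrow> nat list \<Rightarrow> nat list \<Rightarrow> complex" where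
  "pinch i t X = conj_by N t (W i) (\<lambda>u v. of_bool (weight i u = weight i v) * eigenframe i t X u v)"

definition twirl :: "nat \<Rightarrow> (nat list \<Rightarrow> nat list \<Rightarrow> complex) \<Rightarrow> nat list \<Rightarrow> nat list \<Rightarrow> complex" where
  "twirl t X u v = (\<Sum>i\<in>I. pinch i t X u v) / of_nat (card I)"

text \<open>The base of the power in the theorem, over one denominator. For \<open>t = 0\<close> the
  division by zero makes it \<open>1\<close>, so monotonicity in \<open>t\<close> starts only at
  \<open>t = 1\<close>.\<close>

definition decay_rate :: "nat \<Rightarrow> real" where
  "decay_rate t = 1 - real N * (real N + real t - 1) / (2 * real t * ((real N)\<^sup>2 - 1))"

lemma card_I_pos: "0 < (real N)\<^sup>2 - 1"
proof -
  have "(2::real)\<^sup>2 \<le> (real N)\<^sup>2" using N2 by (intro power_mono) auto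
  then show ?thesis by simp
qed

lemma card_I_neq: "(of_nat (card I) :: complex) \<noteq> 0"
  using card_I card_I_pos by auto

lemma weight_mset: "mset u = mset v \<Longrightarrow> weight i u = weight i v"
  unfolding weight_def by (metis mset_map sum_mset_sum_list)

lemma twirl_cong:
  assumes "\<And>x y. x \<in> words N t \<Longrightarrow> y \<in> words N t \<Longrightarrow> X x y = Y x y"
  shows "twirl t X u v = twirl t Y u v"
  unfolding twirl_def pinch_def eigenframe_def using assms by (simp add: conj_by_cong[of N t X Y])

lemma twirl_pow_cong:
  assumes "\<And>x y. x \<in> words N t \<Longrightarrow> y \<in> words N t \<Longrightarrow> X x y = Y x y" "u \<in> words N t" "v \<in> words N t"
  shows "(twirl t ^^ k) X u v = (twirl t ^^ k) Y u v"
  using assms(2,3)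
proof (induction k arbitrary: u v)
  case (Suc k)
  then show ?case by (simp add: twirl_cong[of t "(twirl t ^^ k) X" "(twirl t ^^ k) Y"])
qed (simp add: assms(1))

lemma twirl_diff: "twirl t (\<lambda>u v. X u v - Y u v) u v = twirl t X u v - twirl t Y u v"
  by (simp add: twirl_def pinch_def eigenframe_def conj_by_diff right_diff_distrib sum_subtractf diff_divide_distrib)

text \<open>The mask that compares weights is symmetric in \<open>u\<close> and \<open>v\<close> and
  depends on them only through their multisets, so it respects both conditions.\<close>

lemma twirl_herm_sym:
  assumes "herm_sym N t X" shows "herm_sym N t (twirl t X)"
proof -
  have *: "herm_sym N t (pinch i t X)" for i
  proof -
    note rX = conj_by_herm_sym[OF assms, of "adj (W i)", folded eigenframe_def]
    show ?thesis unfolding pinch_def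
    proof (intro conj_by_herm_sym herm_symI)
      show "of_bool (weight i v = weight i u) * eigenframe i t X v u = cnj (of_bool (weight i u = weight i v) * eigenframe i t X u v)"
        if "u \<in> words N t" "v \<in> words N t" for u v
        using herm_symD(1)[OF rX that] by auto
      show "of_bool (weight i u = weight i v) * eigenframe i t X u v = of_bool (weight i u' = weight i v) * eigenframe i t X u' v"
        if "u \<in> words N t" "u' \<in> words N t" "v \<in> words N t" "mset u = mset u'" for u u' v
        using herm_symD(2)[OF rX that] weight_mset[OF that(4), of i] by simp
    qed
  qed
  show ?thesis
  proof (rule herm_symI)
    show "twirl t X v u = cnj (twirl t X u v)" if "u \<in> words N t" "v \<in> words N t" for u v
      unfolding twirl_def using herm_symD(1)[OF * that] by (simp add: cnj_sum)
    show "twirl t X u v = twirl t X u' v"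
      if "u \<in> words N t" "u' \<in> words N t" "v \<in> words N t" "mset u = mset u'" for u u' v
      unfolding twirl_def using herm_symD(2)[OF * that] by simp
  qed
qed

lemma twirl_pow_herm_sym: "herm_sym N t X \<Longrightarrow> herm_sym N t ((twirl t ^^ k) X)"
  by (induction k) (auto intro: twirl_herm_sym)

text \<open>Putting the same letter in front of both words shifts both weights by the same amount.
  The mask therefore commutes with the partial trace.\<close>

lemma partial_tr_twirl:
  assumes "u \<in> words N t" "v \<in> words N t"
  shows "partial_tr N (twirl (Suc t) X) u v = twirl t (partial_tr N X) u v"
proof -
  have "partial_tr N (pinch i (Suc t) X) u v = pinch i t (partial_tr N X) u v" if i: "i \<in> I" for i
  proof -
    have "partial_tr N (\<lambda>u v. of_bool (weight i u = weight i v) * eigenframe i (Suc t) X u v) x y =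
        of_bool (weight i x = weight i y) * eigenframe i t (partial_tr N X) x y" for x y
    proof -
      have "partial_tr N (\<lambda>u v. of_bool (weight i u = weight i v) * eigenframe i (Suc t) X u v) x y =
        of_bool (weight i x = weight i y) * partial_tr N (eigenframe i (Suc t) X) x y"
        by (simp add: partial_tr_def weight_def sum_distrib_left)
      then show ?thesis
        unfolding eigenframe_def by (simp add: partial_tr_conj_by[OF unitary_on_adj[OF unit_W[OF i]]])
    qed
    then show ?thesis unfolding pinch_def partial_tr_conj_by[OF unit_W[OF i]] by (intro conj_by_cong)
  qed
  then have "(\<Sum>i\<in>I. partial_tr N (pinch i (Suc t) X) u v) = (\<Sum>i\<in>I. pinch i t (partial_tr N X) u v)" by simp
  then show ?thesis
    unfolding twirl_def partial_tr_def by (subst (asm) sum.swap) (simp flip: sum_divide_distrib)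
qed

lemma partial_tr_twirl_pow:
  assumes "u \<in> words N t" "v \<in> words N t"
  shows "partial_tr N ((twirl (Suc t) ^^ k) X) u v = (twirl t ^^ k) (partial_tr N X) u v"
  using assms
proof (induction k arbitrary: u v)
  case (Suc k)
  have "partial_tr N ((twirl (Suc t) ^^ Suc k) X) u v = twirl t (partial_tr N ((twirl (Suc t) ^^ k) X)) u v"
    using Suc.prems by (simp add: partial_tr_twirl)
  also have "\<dots> = twirl t ((twirl t ^^ k) (partial_tr N X)) u v" by (intro twirl_cong Suc.IH)
  finally show ?case by simp
qed simp

text \<open>In its eigenframe each pinching is a zero-one mask, hence an orthogonal projection. This
  formula makes self-adjointness and positivity of the averaged map visible.\<close>

lemma hs_inner_twirl:
  "hs_inner N t X (twirl t Y) = (\<Sum>i\<in>I. \<Sum>u\<in>words N t. \<Sum>v\<in>words N t.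
      of_bool (weight i u = weight i v) * (cnj (eigenframe i t X u v) * eigenframe i t Y u v)) / of_nat (card I)"
proof -
  have "hs_inner N t X (pinch i t Y) = (\<Sum>u\<in>words N t. \<Sum>v\<in>words N t.
      of_bool (weight i u = weight i v) * (cnj (eigenframe i t X u v) * eigenframe i t Y u v))" for i
  proof -
    have "hs_inner N t X (pinch i t Y) = hs_inner N t (eigenframe i t X) (\<lambda>u v. of_bool (weight i u = weight i v) * eigenframe i t Y u v)"
      unfolding pinch_def eigenframe_def hs_inner_conj_by_adj by simp
    then show ?thesis by (simp add: hs_inner_def ac_simps)
  qed
  moreover have "hs_inner N t X (twirl t Y) = (\<Sum>i\<in>I. hs_inner N t X (pinch i t Y)) / of_nat (card I)"
    by (simp add: hs_inner_def twirl_def sum_distrib_left sum_divide_distrib sum.swap[of _ I])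
  ultimately show ?thesis by simp
qed

lemma hs_inner_twirl_left: "hs_inner N t (twirl t X) Y = hs_inner N t X (twirl t Y)"
proof -
  have "hs_inner N t (twirl t X) Y = cnj (hs_inner N t Y (twirl t X))" by (rule hs_inner_commute)
  also have "\<dots> = hs_inner N t X (twirl t Y)"
    unfolding hs_inner_twirl by (simp add: cnj_sum cnj_of_bool ac_simps)
  finally show ?thesis .
qed

lemma hs_inner_twirl_pow: "hs_inner N t ((twirl t ^^ j) X) ((twirl t ^^ k) Y) = hs_inner N t X ((twirl t ^^ (j + k)) Y)"
proof (induction j arbitrary: k)
  case (Suc j)
  have "hs_inner N t ((twirl t ^^ Suc j) X) ((twirl t ^^ k) Y) = hs_inner N t ((twirl t ^^ j) X) ((twirl t ^^ Suc k) Y)"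
    by (simp add: hs_inner_twirl_left)
  then show ?case by (simp only: Suc.IH add_Suc_right add_Suc)
qed simp

lemma hs_inner_twirl_self:
  "hs_inner N t X (twirl t X) = of_real ((\<Sum>i\<in>I. \<Sum>u\<in>words N t. \<Sum>v\<in>words N t.
      of_bool (weight i u = weight i v) * (cmod (eigenframe i t X u v))\<^sup>2) / card I)"
  unfolding hs_inner_twirl by (auto simp: cnj_mult_self intro!: sum.cong arg_cong2[where f = "(/)"])

lemma hs_inner_twirl_self_nonneg: "0 \<le> Re (hs_inner N t X (twirl t X))"
  unfolding hs_inner_twirl_self by (simp add: sum_nonneg)

text \<open>Cauchy-Schwarz for the positive semidefinite form of the averaged map. The mask is
  idempotent and can be attached to both arguments. This is the version needed for moments of odd
  index.\<close>

lemma hs_inner_twirl_Cauchy_Schwarz: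
  "(Re (hs_inner N t X (twirl t Y)))\<^sup>2 \<le> Re (hs_inner N t X (twirl t X)) * Re (hs_inner N t Y (twirl t Y))"
proof -
  let ?K = "I \<times> words N t \<times> words N t"
  let ?f = "\<lambda>X (i, u, v). of_bool (weight i u = weight i v) * eigenframe i t X u v"
  let ?c = "real (card I)"
  have c: "0 < ?c" using card_I card_I_pos by simp
  have eq: "Re (hs_inner N t X (twirl t Y)) = Re (\<Sum>k\<in>?K. cnj (?f X k) * ?f Y k) / ?c" for X Y
  proof -
    have "(\<Sum>k\<in>?K. cnj (?f X k) * ?f Y k) = (\<Sum>i\<in>I. \<Sum>u\<in>words N t. \<Sum>v\<in>words N t.
      of_bool (weight i u = weight i v) * (cnj (eigenframe i t X u v) * eigenframe i t Y u v))"
      unfolding sum.cartesian_product by (auto intro!: sum.cong)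
    then show ?thesis unfolding hs_inner_twirl by simp
  qed
  have self: "Re (hs_inner N t X (twirl t X)) = (\<Sum>k\<in>?K. (cmod (?f X k))\<^sup>2) / ?c" for X
    unfolding eq cnj_mult_self by simp
  have "(Re (hs_inner N t X (twirl t Y)))\<^sup>2 = (Re (\<Sum>k\<in>?K. cnj (?f X k) * ?f Y k))\<^sup>2 / ?c\<^sup>2"
    unfolding eq by (simp add: power_divide)
  also have "\<dots> \<le> ((\<Sum>k\<in>?K. (cmod (?f X k))\<^sup>2) * (\<Sum>k\<in>?K. (cmod (?f Y k))\<^sup>2)) / ?c\<^sup>2"
    by (intro divide_right_mono Cauchy_Schwarz_cnj) simp
  also have "\<dots> = Re (hs_inner N t X (twirl t X)) * Re (hs_inner N t Y (twirl t Y))"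
    unfolding self by (simp add: power2_eq_square)
  finally show ?thesis .
qed

section \<open>The Casimir form on symmetric kernels\<close>

lemma eigenframe_slot_sum:
  assumes "i \<in> I" "c < N" "e < N"
  shows "(\<Sum>a<N. of_real (\<delta> i a) * (cnj (adj (W i) a c) * adj (W i) a e)) = P i c e"
  using assms by (simp add: diag adj_def ac_simps)

text \<open>Column slots carry the conjugated basis, so \<open>P\<close> comes out transposed. This
  transposition turns the swap of the completeness relation into a contraction of a row with a
  column slot in \<open>eigenframe_left_right\<close>.\<close>

lemma eigenframe_slot_sum_cnj:
  assumes "i \<in> I" "c < N" "e < N"
  shows "(\<Sum>a<N. of_real (\<delta> i a) * (cnj (cnj (adj (W i) a c)) * cnj (adj (W i) a e))) = P i e c"
  using assms by (simp add: diag adj_def ac_simps)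

text \<open>
  In the two sums over \<open>I\<close> below, the completeness relation produces a swap of the two letters when both sit on the same
  side of the kernel, and a partial trace when they sit on opposite sides. The subtracted terms come from the
  identity, which is missing from \<open>I\<close>.
\<close>

lemma eigenframe_left_left:
  "(\<Sum>i\<in>I. \<Sum>a<N. \<Sum>b<N. of_real (\<delta> i a) * of_real (\<delta> i b) *
      (\<Sum>u\<in>words N s. cnj (tensor_act N (Suc (Suc s)) (adj (W i)) G (a # b # u)) * tensor_act N (Suc (Suc s)) (adj (W i)) G (a # b # u)))
   = of_nat N * (\<Sum>c<N. \<Sum>e<N. \<Sum>u\<in>words N s. cnj (G (c # e # u)) * G (e # c # u))
     - (\<Sum>w\<in>words N (Suc (Suc s)). cnj (G w) * G w)"
proof -
  define H where "H c e c' e' = (\<Sum>u\<in>words N s. cnj (G (c # e # u)) * G (c' # e' # u))" for c e c' e'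
  have "(\<Sum>a<N. \<Sum>b<N. of_real (\<delta> i a) * of_real (\<delta> i b) *
      (\<Sum>u\<in>words N s. cnj (tensor_act N (Suc (Suc s)) (adj (W i)) G (a # b # u)) * tensor_act N (Suc (Suc s)) (adj (W i)) G (a # b # u)))
    = (\<Sum>c<N. \<Sum>c'<N. \<Sum>e<N. \<Sum>e'<N. P i c c' * P i e e' * H c e c' e')" if i: "i \<in> I" for i
  proof -
    let ?V = "adj (W i)"
    have r: "tensor_act N (Suc (Suc s)) ?V G (a # b # u) =
        (\<Sum>c<N. \<Sum>e<N. ?V a c * ?V b e * tensor_act N s ?V (\<lambda>x. G (c # e # x)) u)" for a b u
      by (simp add: tensor_act_Cons sum_distrib_left mult.assoc)
    show ?thesis
      unfolding r two_slot_sum H_def tensor_act_unit[OF unitary_on_adj[OF unit_W[OF i]]]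
      by (intro sum.cong refl arg_cong2[where f = "(*)"] eigenframe_slot_sum[OF i]) auto
  qed
  then have "(\<Sum>i\<in>I. \<Sum>a<N. \<Sum>b<N. of_real (\<delta> i a) * of_real (\<delta> i b) *
      (\<Sum>u\<in>words N s. cnj (tensor_act N (Suc (Suc s)) (adj (W i)) G (a # b # u)) * tensor_act N (Suc (Suc s)) (adj (W i)) G (a # b # u)))
    = (\<Sum>i\<in>I. \<Sum>c<N. \<Sum>c'<N. \<Sum>e<N. \<Sum>e'<N. P i c c' * P i e e' * H c e c' e')"
    by (rule sum.cong[OF refl])
  also have "\<dots> = (\<Sum>c<N. \<Sum>c'<N. \<Sum>e<N. \<Sum>e'<N. (\<Sum>i\<in>I. P i c c' * P i e e') * H c e c' e')"
    by (simp add: sum.swap[of _ I] sum_distrib_right)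
  also have "\<dots> = (\<Sum>c<N. \<Sum>c'<N. \<Sum>e<N. \<Sum>e'<N.
     (of_nat N * of_bool (c = e' \<and> c' = e) - of_bool (c = c' \<and> e = e')) * H c e c' e')"
    by (intro sum.cong refl arg_cong2[where f = "(*)"] complete) auto
  also have "\<dots> = (\<Sum>c<N. \<Sum>c'<N. \<Sum>e<N. \<Sum>e'<N.
     (if c = e' then if c' = e then of_nat N * H c e c' e' else 0 else 0) - (if e = e' then if c = c' then H c e c' e' else 0 else 0))"
    by (intro sum.cong refl) (auto simp: algebra_simps)
  also have "\<dots> = (\<Sum>c<N. \<Sum>c'<N. \<Sum>e<N.
     (if c' = e then of_nat N * H c e c' c else 0) - (if c = c' then H c e c' e else 0))"
    by (intro sum.cong refl) (simp add: sum_subtractf)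
  also have "\<dots> = (\<Sum>c<N. \<Sum>c'<N. of_nat N * H c c' c' c) - (\<Sum>c<N. \<Sum>c'<N. \<Sum>e<N. if c = c' then H c e c' e else 0)"
    by (simp add: sum_subtractf)
  also have "(\<Sum>c<N. \<Sum>c'<N. \<Sum>e<N. if c = c' then H c e c' e else 0) = (\<Sum>c<N. \<Sum>e<N. H c e c e)"
    by (rule sum.cong[OF refl], subst sum.swap, simp)
  finally show ?thesis by (simp add: H_def sum_words_Suc sum_distrib_left)
qed

lemma eigenframe_left_right:
  "(\<Sum>i\<in>I. \<Sum>a<N. \<Sum>b<N. of_real (\<delta> i a) * of_real (\<delta> i b) *
      (\<Sum>u\<in>words N s. \<Sum>v\<in>words N s. cnj (eigenframe i (Suc s) X (a # u) (b # v)) * eigenframe i (Suc s) X (a # u) (b # v)))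
   = of_nat N * hs_inner N s (partial_tr N X) (partial_tr N X) - hs_inner N (Suc s) X X"
proof -
  define Z where "Z c e = (\<lambda>x y. X (c # x) (e # y))" for c e
  define H where "H c e c' e' = hs_inner N s (Z c e) (Z c' e')" for c e c' e'
  have "(\<Sum>a<N. \<Sum>b<N. of_real (\<delta> i a) * of_real (\<delta> i b) *
      (\<Sum>u\<in>words N s. \<Sum>v\<in>words N s. cnj (eigenframe i (Suc s) X (a # u) (b # v)) * eigenframe i (Suc s) X (a # u) (b # v)))
    = (\<Sum>c<N. \<Sum>c'<N. \<Sum>e<N. \<Sum>e'<N. P i c c' * P i e' e * H c e c' e')" if i: "i \<in> I" for i
  proof -
    let ?V = "adj (W i)"
    let ?K = "words N s \<times> words N s"
    define z where "z c e k = conj_by N s ?V (Z c e) (fst k) (snd k)" for c e k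
    have r: "eigenframe i (Suc s) X (a # u) (b # v) =
        (\<Sum>c<N. \<Sum>e<N. ?V a c * cnj (?V b e) * z c e (u, v))" for a b u v
      by (simp add: eigenframe_def conj_by_Cons z_def Z_def)
    have zz: "(\<Sum>k\<in>?K. cnj (z c e k) * z c' e' k) = H c e c' e'" for c e c' e'
    proof -
      have "(\<Sum>k\<in>?K. cnj (z c e k) * z c' e' k) = hs_inner N s (conj_by N s ?V (Z c e)) (conj_by N s ?V (Z c' e'))"
        by (simp add: hs_inner_def z_def sum.cartesian_product case_prod_unfold)
      then show ?thesis unfolding H_def hs_inner_unit[OF unitary_on_adj[OF unit_W[OF i]]] .
    qed
    have "(\<Sum>a<N. \<Sum>b<N. of_real (\<delta> i a) * of_real (\<delta> i b) *
      (\<Sum>u\<in>words N s. \<Sum>v\<in>words N s. cnj (eigenframe i (Suc s) X (a # u) (b # v)) * eigenframe i (Suc s) X (a # u) (b # v)))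
      = (\<Sum>a<N. \<Sum>b<N. of_real (\<delta> i a) * of_real (\<delta> i b) *
      (\<Sum>k\<in>?K. cnj (\<Sum>c<N. \<Sum>e<N. ?V a c * cnj (?V b e) * z c e k) *
        (\<Sum>c<N. \<Sum>e<N. ?V a c * cnj (?V b e) * z c e k)))"
      unfolding r sum.cartesian_product by (simp only: case_prod_unfold prod.collapse)
    also have "\<dots> = (\<Sum>c<N. \<Sum>c'<N. \<Sum>e<N. \<Sum>e'<N. P i c c' * P i e' e * H c e c' e')"
      unfolding two_slot_sum zz
      by (intro sum.cong refl arg_cong2[where f = "(*)"] eigenframe_slot_sum[OF i] eigenframe_slot_sum_cnj[OF i]) auto
    finally show ?thesis .
  qed
  then have "(\<Sum>i\<in>I. \<Sum>a<N. \<Sum>b<N. of_real (\<delta> i a) * of_real (\<delta> i b) *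
      (\<Sum>u\<in>words N s. \<Sum>v\<in>words N s. cnj (eigenframe i (Suc s) X (a # u) (b # v)) * eigenframe i (Suc s) X (a # u) (b # v)))
    = (\<Sum>i\<in>I. \<Sum>c<N. \<Sum>c'<N. \<Sum>e<N. \<Sum>e'<N. P i c c' * P i e' e * H c e c' e')"
    by (rule sum.cong[OF refl])
  also have "\<dots> = (\<Sum>c<N. \<Sum>c'<N. \<Sum>e<N. \<Sum>e'<N. (\<Sum>i\<in>I. P i c c' * P i e' e) * H c e c' e')"
    by (simp add: sum.swap[of _ I] sum_distrib_right)
  also have "\<dots> = (\<Sum>c<N. \<Sum>c'<N. \<Sum>e<N. \<Sum>e'<N.
     (of_nat N * of_bool (c = e \<and> c' = e') - of_bool (c = c' \<and> e' = e)) * H c e c' e')"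
    by (intro sum.cong refl arg_cong2[where f = "(*)"] complete) auto
  also have "\<dots> = (\<Sum>c<N. \<Sum>c'<N. \<Sum>e<N. \<Sum>e'<N.
     (if c' = e' then if c = e then of_nat N * H c e c' e' else 0 else 0) - (if e = e' then if c = c' then H c e c' e' else 0 else 0))"
    by (intro sum.cong refl) (auto simp: algebra_simps)
  also have "\<dots> = (\<Sum>c<N. \<Sum>c'<N. \<Sum>e<N.
     (if c = e then of_nat N * H c e c' c' else 0) - (if c = c' then H c e c' e else 0))"
    by (intro sum.cong refl) (simp add: sum_subtractf)
  also have "\<dots> = of_nat N * (\<Sum>c<N. \<Sum>c'<N. H c c c' c') - (\<Sum>c<N. \<Sum>c'<N. \<Sum>e<N. if c = c' then H c e c' e else 0)"
    by (simp add: sum_subtractf sum_distrib_left)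
  also have "(\<Sum>c<N. \<Sum>c'<N. \<Sum>e<N. if c = c' then H c e c' e else 0) = (\<Sum>c<N. \<Sum>e<N. H c e c e)"
    by (rule sum.cong[OF refl], subst sum.swap, simp)
  also have "\<dots> = hs_inner N (Suc s) X X"
    unfolding hs_inner_def sum_words_Suc H_def Z_def by (intro sum.cong refl sum.swap)
  also have "(\<Sum>c<N. \<Sum>c'<N. H c c c' c') = hs_inner N s (partial_tr N X) (partial_tr N X)"
  proof -
    let ?w = "words N s"
    have "hs_inner N s (partial_tr N X) (partial_tr N X) = (\<Sum>u\<in>?w. \<Sum>v\<in>?w. \<Sum>c<N. \<Sum>c'<N. cnj (Z c c u v) * Z c' c' u v)"
      unfolding hs_inner_def partial_tr_def cnj_sum sum_product Z_def by simp
    also have "\<dots> = (\<Sum>c<N. \<Sum>c'<N. \<Sum>u\<in>?w. \<Sum>v\<in>?w. cnj (Z c c u v) * Z c' c' u v)"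
      by (simp add: sum.swap[of _ "{..<N}" ?w])
    finally show ?thesis by (simp add: H_def hs_inner_def)
  qed
  finally show ?thesis .
qed

text \<open>Summation over the column index removes the unitary on the column side. A weight of the
  row alone can then be treated separately for every column \<open>y\<close> of the original
  kernel.\<close>

lemma sum_cmod_conj_by_left:
  assumes "unitary_on N A"
  shows "(\<Sum>v\<in>words N t. cnj (conj_by N t A X u v) * conj_by N t A X u v)
    = (\<Sum>y\<in>words N t. cnj (tensor_act N t A (\<lambda>x. X x y) u) * tensor_act N t A (\<lambda>x. X x y) u)"
proof -
  have "conj_by N t A X u v = cnj (tensor_act N t A (\<lambda>y. cnj (tensor_act N t A (\<lambda>x. X x y) u)) v)" for v
    unfolding conj_by_def tensor_act_def by (subst sum.swap) (simp add: sum_distrib_left ac_simps)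
  then show ?thesis
    using tensor_act_unit[OF assms, of t "\<lambda>y. cnj (tensor_act N t A (\<lambda>x. X x y) u)" "\<lambda>y. cnj (tensor_act N t A (\<lambda>x. X x y) u)"]
    by (simp add: ac_simps)
qed

text \<open>The squared weight is a sum over ordered pairs of row slots. The \<open>Suc t\<close>
  coincident pairs give \<open>card I\<close> each, since signs square to one. Each of the
  \<open>Suc t * t\<close> other pairs gives \<open>N - 1\<close>: the swap acts trivially on a
  symmetric kernel, and the missing identity subtracts one.\<close>

lemma weight_square_left:
  assumes X: "herm_sym N (Suc t) X"
  shows "(\<Sum>i\<in>I. \<Sum>u\<in>words N (Suc t). \<Sum>v\<in>words N (Suc t). (of_real (weight i u))\<^sup>2 *
      (cnj (eigenframe i (Suc t) X u v) * eigenframe i (Suc t) X u v))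
    = of_nat (Suc t) * (of_nat (card I) + of_nat t * (of_nat N - 1)) * hs_inner N (Suc t) X X"
proof -
  let ?d = "\<lambda>i a. complex_of_real (\<delta> i a)" and ?V = "\<lambda>i. adj (W i)"
  let ?weight = "\<lambda>i u. sum_list (map (?d i) u)"
  define G where "G i u = (\<Sum>y\<in>words N (Suc t). cnj (tensor_act N (Suc t) (?V i) (\<lambda>x. X x y) u) * tensor_act N (Suc t) (?V i) (\<lambda>x. X x y) u)" for i u
  have weight: "of_real (weight i u) = ?weight i u" for i u
    unfolding weight_def by (induction u) auto
  have weight_eq: "?weight i u = ?weight i v" if "mset u = mset v" for i u v
    unfolding weight[symmetric] weight_mset[OF that] ..
  have G: "(\<Sum>v\<in>words N (Suc t). cnj (eigenframe i (Suc t) X u v) * eigenframe i (Suc t) X u v) = G i u" if "i \<in> I" for i u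
    unfolding eigenframe_def G_def by (rule sum_cmod_conj_by_left[OF unitary_on_adj[OF unit_W[OF that]]])
  have symG: "G i u = G i v" if "u \<in> words N (Suc t)" "v \<in> words N (Suc t)" "mset u = mset v" for i u v
  proof -
    have "tensor_act N (Suc t) (?V i) (\<lambda>x. X x y) u = tensor_act N (Suc t) (?V i) (\<lambda>x. X x y) v" if y: "y \<in> words N (Suc t)" for y
      by (rule tensor_act_perm_invariant[OF _ \<open>u \<in> _\<close> \<open>v \<in> _\<close> \<open>mset u = _\<close>])
        (auto simp: perm_invariant_def intro: herm_symD(2)[OF X _ _ y])
    then show ?thesis by (simp add: G_def)
  qed
  have totG: "(\<Sum>u\<in>words N (Suc t). G i u) = hs_inner N (Suc t) X X" if "i \<in> I" for i
  proof -
    have "(\<Sum>u\<in>words N (Suc t). G i u) = hs_inner N (Suc t) (eigenframe i (Suc t) X) (eigenframe i (Suc t) X)"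
      by (simp add: hs_inner_def G[OF that])
    then show ?thesis unfolding eigenframe_def hs_inner_unit[OF unitary_on_adj[OF unit_W[OF that]]] .
  qed
  \<comment> \<open>Symmetry moves one factor of the square to the head slot. The other factor
    splits into the head, whose sign squares to one, and the remaining \<open>t\<close>
    slots.\<close>
  have one: "(\<Sum>u\<in>words N (Suc t). (?weight i u)\<^sup>2 * G i u) =
     of_nat (Suc t) * (hs_inner N (Suc t) X X + (\<Sum>a<N. ?d i a * (\<Sum>u\<in>words N t. ?weight i u * G i (a # u))))" if i: "i \<in> I" for i
  proof -
    have "perm_invariant N (Suc t) (\<lambda>u. ?weight i u * G i u)"
      unfolding perm_invariant_def
      by (intro ballI impI arg_cong2[where f = "(*)"] symG weight_eq)
    from sum_weight_perm_invariant[OF this, of "?d i"]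
    have "(\<Sum>u\<in>words N (Suc t). (?weight i u)\<^sup>2 * G i u) =
       of_nat (Suc t) * (\<Sum>a<N. ?d i a * (\<Sum>u\<in>words N t. (?d i a + ?weight i u) * G i (a # u)))"
      by (simp add: power2_eq_square mult.assoc)
    also have "(\<Sum>a<N. ?d i a * (\<Sum>u\<in>words N t. (?d i a + ?weight i u) * G i (a # u)))
       = (\<Sum>a<N. (?d i a * ?d i a) * (\<Sum>u\<in>words N t. G i (a # u))) + (\<Sum>a<N. ?d i a * (\<Sum>u\<in>words N t. ?weight i u * G i (a # u)))"
      by (simp add: algebra_simps sum.distrib sum_distrib_left)
    also have "(\<Sum>a<N. (?d i a * ?d i a) * (\<Sum>u\<in>words N t. G i (a # u))) = (\<Sum>a<N. \<Sum>u\<in>words N t. G i (a # u))"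
    proof (intro sum.cong refl)
      fix a assume "a \<in> {..<N}"
      then have "?d i a * ?d i a = 1" using sign[OF i, of a] by auto
      then show "(?d i a * ?d i a) * (\<Sum>u\<in>words N t. G i (a # u)) = (\<Sum>u\<in>words N t. G i (a # u))" by simp
    qed
    finally show ?thesis using totG[OF i] by (simp add: sum_words_Suc)
  qed
  have two: "(\<Sum>i\<in>I. \<Sum>a<N. ?d i a * (\<Sum>u\<in>words N t. ?weight i u * G i (a # u))) = of_nat t * (of_nat N - 1) * hs_inner N (Suc t) X X"
  proof (cases t)
    case 0 then show ?thesis by simp
  next
    case (Suc s)
    let ?w2 = "words N (Suc (Suc s))"
    let ?A = "\<lambda>i y. tensor_act N (Suc (Suc s)) (?V i) (\<lambda>x. X x y)"
    have "(\<Sum>i\<in>I. \<Sum>a<N. ?d i a * (\<Sum>u\<in>words N t. ?weight i u * G i (a # u))) =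
      (\<Sum>i\<in>I. \<Sum>a<N. ?d i a * (of_nat t * (\<Sum>b<N. ?d i b * (\<Sum>u\<in>words N s. G i (a # b # u)))))"
    proof (intro sum.cong refl arg_cong2[where f = "(*)"])
      fix i a assume "a \<in> {..<N}"
      then have "perm_invariant N (Suc s) (\<lambda>u. G i (a # u))"
        unfolding perm_invariant_def by (intro ballI impI symG) (auto simp: Suc)
      from sum_weight_perm_invariant[OF this]
      show "(\<Sum>u\<in>words N t. ?weight i u * G i (a # u)) = of_nat t * (\<Sum>b<N. ?d i b * (\<Sum>u\<in>words N s. G i (a # b # u)))"
        unfolding Suc .
    qed
    also have "\<dots> = of_nat t * (\<Sum>i\<in>I. \<Sum>a<N. \<Sum>b<N. ?d i a * ?d i b * (\<Sum>u\<in>words N s. G i (a # b # u)))"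
      by (simp add: sum_distrib_left ac_simps)
    also have "(\<Sum>i\<in>I. \<Sum>a<N. \<Sum>b<N. ?d i a * ?d i b * (\<Sum>u\<in>words N s. G i (a # b # u))) =
       (\<Sum>i\<in>I. \<Sum>a<N. \<Sum>b<N. \<Sum>y\<in>?w2. ?d i a * ?d i b * (\<Sum>u\<in>words N s. cnj (?A i y (a # b # u)) * ?A i y (a # b # u)))"
      unfolding G_def Suc by (subst sum.swap) (simp only: sum_distrib_left)
    also have "\<dots> = (\<Sum>y\<in>?w2. \<Sum>i\<in>I. \<Sum>a<N. \<Sum>b<N. ?d i a * ?d i b * (\<Sum>u\<in>words N s. cnj (?A i y (a # b # u)) * ?A i y (a # b # u)))"
      by (simp only: sum.swap[of _ ?w2])
    also have "\<dots> = (\<Sum>y\<in>?w2. of_nat N * (\<Sum>c<N. \<Sum>e<N. \<Sum>u\<in>words N s. cnj (X (c # e # u) y) * X (e # c # u) y)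
     - (\<Sum>w\<in>?w2. cnj (X w y) * X w y))"
      by (simp only: eigenframe_left_left)
    also have "\<dots> = (\<Sum>y\<in>?w2. of_nat N * (\<Sum>c<N. \<Sum>e<N. \<Sum>u\<in>words N s. cnj (X (c # e # u) y) * X (c # e # u) y)
     - (\<Sum>w\<in>?w2. cnj (X w y) * X w y))"
      by (intro sum.cong refl arg_cong2[where f = "(*)"] arg_cong2[where f = "(-)"] herm_symD(2)[OF X]) (auto simp: Suc)
    also have "\<dots> = (\<Sum>y\<in>?w2. \<Sum>w\<in>?w2. (of_nat N - 1) * (cnj (X w y) * X w y))"
      by (simp add: sum_words_Suc[of _ N "Suc s"] sum_words_Suc[of _ N s] left_diff_distrib sum_distrib_left sum_subtractf)
    also have "\<dots> = (of_nat N - 1) * hs_inner N (Suc t) X X"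
      unfolding hs_inner_def Suc by (subst sum.swap) (simp only: sum_distrib_left)
    finally show ?thesis by (simp add: mult.assoc)
  qed
  have "(\<Sum>i\<in>I. \<Sum>u\<in>words N (Suc t). \<Sum>v\<in>words N (Suc t). (of_real (weight i u))\<^sup>2 *
      (cnj (eigenframe i (Suc t) X u v) * eigenframe i (Suc t) X u v))
    = (\<Sum>i\<in>I. \<Sum>u\<in>words N (Suc t). (?weight i u)\<^sup>2 * G i u)"
    unfolding weight sum_distrib_left[symmetric] by (simp add: G)
  also have "\<dots> = of_nat (Suc t) * (of_nat (card I) * hs_inner N (Suc t) X X + of_nat t * (of_nat N - 1) * hs_inner N (Suc t) X X)"
    by (simp add: one sum.distrib two flip: sum_distrib_left)
  finally show ?thesis by (simp only: distrib_right mult.assoc)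
qed

text \<open>A row slot and a column slot can be paired in \<open>(Suc t)^2\<close> ways. By symmetry
  every pair contributes as the two heads do, and those are evaluated by
  \<open>eigenframe_left_right\<close>.\<close>

lemma weight_product:
  assumes X: "herm_sym N (Suc t) X"
  shows "(\<Sum>i\<in>I. \<Sum>u\<in>words N (Suc t). \<Sum>v\<in>words N (Suc t). of_real (weight i u) * of_real (weight i v) *
      (cnj (eigenframe i (Suc t) X u v) * eigenframe i (Suc t) X u v))
    = (of_nat (Suc t))\<^sup>2 * (of_nat N * hs_inner N t (partial_tr N X) (partial_tr N X) - hs_inner N (Suc t) X X)"
proof -
  let ?d = "\<lambda>i a. complex_of_real (\<delta> i a)"
  let ?weight = "\<lambda>i u. sum_list (map (?d i) u)"
  let ?w = "words N (Suc t)"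
  define F where "F i u v = cnj (eigenframe i (Suc t) X u v) * eigenframe i (Suc t) X u v" for i u v
  note R = conj_by_herm_sym[OF X, of "adj (W _)", folded eigenframe_def]
  have weight: "of_real (weight i u) = ?weight i u" for i u
    unfolding weight_def by (induction u) auto
  have Fl: "F i u v = F i u' v" if "u \<in> ?w" "u' \<in> ?w" "v \<in> ?w" "mset u = mset u'" for i u u' v
    unfolding F_def herm_symD(2)[OF R that] ..
  \<comment> \<open>Hermiticity transfers the symmetry in the rows to the columns, so both weights
    can be reduced to the head slot.\<close>
  have Fr: "F i v u = F i u v" if "u \<in> ?w" "v \<in> ?w" for i u v
    unfolding F_def herm_symD(1)[OF R that] by simp
  have "(\<Sum>u\<in>?w. \<Sum>v\<in>?w. ?weight i u * ?weight i v * F i u v) =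
     (of_nat (Suc t))\<^sup>2 * (\<Sum>a<N. \<Sum>b<N. ?d i a * ?d i b * (\<Sum>u\<in>words N t. \<Sum>v\<in>words N t. F i (a # u) (b # v)))" for i
  proof -
    have "perm_invariant N (Suc t) (\<lambda>u. \<Sum>v\<in>?w. ?weight i v * F i u v)"
      unfolding perm_invariant_def by (intro ballI impI sum.cong refl arg_cong2[where f = "(*)"] Fl)
    from sum_weight_perm_invariant[OF this, of "?d i"]
    have "(\<Sum>u\<in>?w. \<Sum>v\<in>?w. ?weight i u * ?weight i v * F i u v) =
       of_nat (Suc t) * (\<Sum>a<N. ?d i a * (\<Sum>u\<in>words N t. \<Sum>v\<in>?w. ?weight i v * F i (a # u) v))"
      by (simp only: sum_distrib_left mult.assoc)
    also have "\<dots> = of_nat (Suc t) * (\<Sum>a<N. ?d i a * (\<Sum>u\<in>words N t. of_nat (Suc t) * (\<Sum>b<N. ?d i b * (\<Sum>v\<in>words N t. F i (a # u) (b # v)))))"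
    proof (intro arg_cong2[where f = "(*)"] sum.cong refl sum_weight_perm_invariant)
      fix a u assume au: "a \<in> {..<N}" "u \<in> words N t"
      then have au: "a # u \<in> ?w" by simp
      show "perm_invariant N (Suc t) (F i (a # u))"
        unfolding perm_invariant_def
      proof (intro ballI impI)
        fix v v' assume v: "v \<in> ?w" "v' \<in> ?w" "mset v = mset v'"
        show "F i (a # u) v = F i (a # u) v'"
          using Fl[OF v(1,2) au v(3)] by (simp add: Fr[OF au] v)
      qed
    qed
    also have "\<dots> = (of_nat (Suc t))\<^sup>2 * (\<Sum>a<N. ?d i a * (\<Sum>u\<in>words N t. \<Sum>b<N. ?d i b * (\<Sum>v\<in>words N t. F i (a # u) (b # v))))"
      by (simp add: power2_eq_square sum_distrib_left ac_simps)
    also have "(\<Sum>a<N. ?d i a * (\<Sum>u\<in>words N t. \<Sum>b<N. ?d i b * (\<Sum>v\<in>words N t. F i (a # u) (b # v))))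
        = (\<Sum>a<N. \<Sum>b<N. ?d i a * ?d i b * (\<Sum>u\<in>words N t. \<Sum>v\<in>words N t. F i (a # u) (b # v)))"
      by (subst sum.swap) (simp only: sum_distrib_left mult.assoc)
    finally show ?thesis .
  qed
  then have "(\<Sum>i\<in>I. \<Sum>u\<in>?w. \<Sum>v\<in>?w. ?weight i u * ?weight i v * F i u v) = (of_nat (Suc t))\<^sup>2 *
     (\<Sum>i\<in>I. \<Sum>a<N. \<Sum>b<N. ?d i a * ?d i b * (\<Sum>u\<in>words N t. \<Sum>v\<in>words N t. F i (a # u) (b # v)))"
    by (simp only: sum_distrib_left)
  then show ?thesis unfolding F_def weight eigenframe_left_right .
qed

text \<open>The quadratic form of the sum of \<open>(ad P)^2\<close>. Twice the row term minus twice
  the mixed term has, apart from the factor \<open>2 * Suc t\<close>, the coefficient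
  \<open>N^2 - 1 + t (N - 1) + t + 1 = N (N + t)\<close> of the squared norm.\<close>

lemma weight_difference:
  assumes X: "herm_sym N (Suc t) X"
  shows "(\<Sum>i\<in>I. \<Sum>u\<in>words N (Suc t). \<Sum>v\<in>words N (Suc t). (weight i u - weight i v)\<^sup>2 * (cmod (eigenframe i (Suc t) X u v))\<^sup>2)
    = 2 * real (Suc t) * real N * (real N + real t) * hs_norm_sq N (Suc t) X - 2 * real N * (real (Suc t))\<^sup>2 * hs_norm_sq N t (partial_tr N X)"
proof -
  let ?w = "words N (Suc t)"
  define f where "f i u v = (cmod (eigenframe i (Suc t) X u v))\<^sup>2" for i u v
  note R = conj_by_herm_sym[OF X, of "adj (W _)", folded eigenframe_def]
  have f_swap: "f i v u = f i u v" if "u \<in> ?w" "v \<in> ?w" for i u v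
    unfolding f_def herm_symD(1)[OF R that] by simp
  have left: "(\<Sum>i\<in>I. \<Sum>u\<in>?w. \<Sum>v\<in>?w. (weight i u)\<^sup>2 * f i u v) = real (Suc t) * (real (card I) + real t * (real N - 1)) * hs_norm_sq N (Suc t) X"
  proof -
    have "complex_of_real (\<Sum>i\<in>I. \<Sum>u\<in>?w. \<Sum>v\<in>?w. (weight i u)\<^sup>2 * f i u v) =
      of_real (real (Suc t) * (real (card I) + real t * (real N - 1)) * hs_norm_sq N (Suc t) X)"
      using weight_square_left[OF X] unfolding cnj_mult_self hs_inner_self f_def by simp
    then show ?thesis by (simp only: of_real_eq_iff)
  qed
  have right: "(\<Sum>i\<in>I. \<Sum>u\<in>?w. \<Sum>v\<in>?w. (weight i v)\<^sup>2 * f i u v) = (\<Sum>i\<in>I. \<Sum>u\<in>?w. \<Sum>v\<in>?w. (weight i u)\<^sup>2 * f i u v)"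
  proof (rule sum.cong[OF refl])
    fix i
    have "(\<Sum>u\<in>?w. \<Sum>v\<in>?w. (weight i v)\<^sup>2 * f i u v) = (\<Sum>v\<in>?w. \<Sum>u\<in>?w. (weight i v)\<^sup>2 * f i u v)"
      by (rule sum.swap)
    also have "\<dots> = (\<Sum>u\<in>?w. \<Sum>v\<in>?w. (weight i u)\<^sup>2 * f i u v)"
      by (intro sum.cong refl arg_cong2[where f = "(*)"] f_swap)
    finally show "(\<Sum>u\<in>?w. \<Sum>v\<in>?w. (weight i v)\<^sup>2 * f i u v) = (\<Sum>u\<in>?w. \<Sum>v\<in>?w. (weight i u)\<^sup>2 * f i u v)" .
  qed
  have mixed: "(\<Sum>i\<in>I. \<Sum>u\<in>?w. \<Sum>v\<in>?w. weight i u * weight i v * f i u v) =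
      (real (Suc t))\<^sup>2 * (real N * hs_norm_sq N t (partial_tr N X) - hs_norm_sq N (Suc t) X)"
  proof -
    have "complex_of_real (\<Sum>i\<in>I. \<Sum>u\<in>?w. \<Sum>v\<in>?w. weight i u * weight i v * f i u v) =
      of_real ((real (Suc t))\<^sup>2 * (real N * hs_norm_sq N t (partial_tr N X) - hs_norm_sq N (Suc t) X))"
      using weight_product[OF X] unfolding cnj_mult_self hs_inner_self f_def by simp
    then show ?thesis by (simp only: of_real_eq_iff)
  qed
  have "(\<Sum>i\<in>I. \<Sum>u\<in>?w. \<Sum>v\<in>?w. (weight i u - weight i v)\<^sup>2 * f i u v) =
     (\<Sum>i\<in>I. \<Sum>u\<in>?w. \<Sum>v\<in>?w. (weight i u)\<^sup>2 * f i u v) + (\<Sum>i\<in>I. \<Sum>u\<in>?w. \<Sum>v\<in>?w. (weight i v)\<^sup>2 * f i u v)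
     - 2 * (\<Sum>i\<in>I. \<Sum>u\<in>?w. \<Sum>v\<in>?w. weight i u * weight i v * f i u v)"
    by (simp add: power2_diff algebra_simps sum.distrib sum_subtractf sum_distrib_left)
  also have "\<dots> = 2 * real (Suc t) * real N * (real N + real t) * hs_norm_sq N (Suc t) X - 2 * real N * (real (Suc t))\<^sup>2 * hs_norm_sq N t (partial_tr N X)"
    unfolding left right mixed card_I by (simp add: algebra_simps power2_eq_square)
  finally show ?thesis unfolding f_def .
qed

lemma abs_weight_le: "i \<in> I \<Longrightarrow> u \<in> words N t \<Longrightarrow> \<bar>weight i u\<bar> \<le> real t"
proof (induction t arbitrary: u)
  case (Suc t)
  then obtain a u' where u: "u = a # u'" "a < N" "u' \<in> words N t" by (elim words_SucE)
  have "\<bar>\<delta> i a\<bar> = 1" using sign[OF Suc.prems(1) u(2)] by auto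
  then show ?case using Suc.IH[OF Suc.prems(1) u(3)] by (simp add: u(1) weight_def)
qed (simp add: weight_def)

text \<open>With \<open>T = Suc t\<close>, dividing \<open>weight_difference\<close> by
  \<open>4 T^2 (N^2 - 1)\<close> turns its first coefficient into \<open>1 - decay_rate T\<close>.
  In the second one \<open>T^2\<close> cancels, so the constant in front of the partial trace does
  not depend on \<open>t\<close>.\<close>

lemma hs_inner_twirl_le:
  assumes X: "herm_sym N (Suc t) X"
  shows "Re (hs_inner N (Suc t) X (twirl (Suc t) X)) \<le> decay_rate (Suc t) * hs_norm_sq N (Suc t) X
    + real N / (2 * ((real N)\<^sup>2 - 1)) * hs_norm_sq N t (partial_tr N X)"
proof -
  let ?w = "words N (Suc t)" and ?T = "real (Suc t)" and ?c = "(real N)\<^sup>2 - 1"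
  define f where "f i u v = (cmod (eigenframe i (Suc t) X u v))\<^sup>2" for i u v
  have tot: "(\<Sum>u\<in>?w. \<Sum>v\<in>?w. f i u v) = hs_norm_sq N (Suc t) X" if "i \<in> I" for i
  proof -
    have "complex_of_real (hs_norm_sq N (Suc t) (eigenframe i (Suc t) X)) = of_real (hs_norm_sq N (Suc t) X)"
      unfolding hs_inner_self[symmetric] eigenframe_def hs_inner_unit[OF unitary_on_adj[OF unit_W[OF that]]] ..
    then have "hs_norm_sq N (Suc t) (eigenframe i (Suc t) X) = hs_norm_sq N (Suc t) X" by (simp only: of_real_eq_iff)
    then show ?thesis by (simp only: hs_norm_sq_def f_def)
  qed
  \<comment> \<open>Off the mask the squared difference is at most \<open>(2 T)^2\<close>, because
    weights are bounded by the number of letters. On the mask both sides vanish.\<close>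
  have pt: "(weight i u - weight i v)\<^sup>2 / (4 * ?T\<^sup>2) * f i u v \<le> f i u v - of_bool (weight i u = weight i v) * f i u v"
    if "i \<in> I" "u \<in> ?w" "v \<in> ?w" for i u v
  proof (cases "weight i u = weight i v")
    case False
    have "\<bar>weight i u - weight i v\<bar> \<le> 2 * ?T"
      unfolding mult_2 by (intro order_trans[OF abs_triangle_ineq4] add_mono abs_weight_le that)
    then have "(weight i u - weight i v)\<^sup>2 \<le> (2 * ?T)\<^sup>2"
      by (intro abs_le_square_iff[THEN iffD1]) simp
    then have "(weight i u - weight i v)\<^sup>2 / (4 * ?T\<^sup>2) \<le> 1" by (simp add: power_mult_distrib del: of_nat_Suc)
    from mult_right_mono[OF this, of "f i u v"] False show ?thesis by (simp add: f_def)
  qed simp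
  have "(\<Sum>i\<in>I. \<Sum>u\<in>?w. \<Sum>v\<in>?w. (weight i u - weight i v)\<^sup>2 / (4 * ?T\<^sup>2) * f i u v)
      \<le> (\<Sum>i\<in>I. \<Sum>u\<in>?w. \<Sum>v\<in>?w. f i u v - of_bool (weight i u = weight i v) * f i u v)"
    by (intro sum_mono pt)
  also have "\<dots> = ?c * hs_norm_sq N (Suc t) X - (\<Sum>i\<in>I. \<Sum>u\<in>?w. \<Sum>v\<in>?w. of_bool (weight i u = weight i v) * f i u v)"
    unfolding sum_subtractf by (simp add: tot card_I)
  also have "(\<Sum>i\<in>I. \<Sum>u\<in>?w. \<Sum>v\<in>?w. of_bool (weight i u = weight i v) * f i u v) = ?c * Re (hs_inner N (Suc t) X (twirl (Suc t) X))"
    unfolding hs_inner_twirl_self f_def card_I using card_I_pos by simp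
  also have "(\<Sum>i\<in>I. \<Sum>u\<in>?w. \<Sum>v\<in>?w. (weight i u - weight i v)\<^sup>2 / (4 * ?T\<^sup>2) * f i u v) =
     (\<Sum>i\<in>I. \<Sum>u\<in>?w. \<Sum>v\<in>?w. (weight i u - weight i v)\<^sup>2 * f i u v) / (4 * ?T\<^sup>2)"
    by (simp add: sum_divide_distrib)
  also have "\<dots> = (2 * ?T * real N * (real N + real t) * hs_norm_sq N (Suc t) X - 2 * real N * ?T\<^sup>2 * hs_norm_sq N t (partial_tr N X)) / (4 * ?T\<^sup>2)"
    unfolding f_def weight_difference[OF X] ..
  finally have le: "(2 * ?T * real N * (real N + real t) * hs_norm_sq N (Suc t) X - 2 * real N * ?T\<^sup>2 * hs_norm_sq N t (partial_tr N X)) / (4 * ?T\<^sup>2)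
      \<le> ?c * (hs_norm_sq N (Suc t) X - Re (hs_inner N (Suc t) X (twirl (Suc t) X)))"
    by (simp only: right_diff_distrib)
  have c: "0 < ?c" by (rule card_I_pos)
  have "Re (hs_inner N (Suc t) X (twirl (Suc t) X)) \<le> hs_norm_sq N (Suc t) X -
      (2 * ?T * real N * (real N + real t) * hs_norm_sq N (Suc t) X - 2 * real N * ?T\<^sup>2 * hs_norm_sq N t (partial_tr N X)) / (4 * ?T\<^sup>2) / ?c"
    using divide_right_mono[OF le less_imp_le[OF c]] c by simp
  also have "\<dots> = decay_rate (Suc t) * hs_norm_sq N (Suc t) X + real N / (2 * ?c) * hs_norm_sq N t (partial_tr N X)"
  proof -
    have T: "?T \<noteq> 0" by simp
    have Nt: "real N + ?T - 1 = real N + real t" by simp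
    show ?thesis unfolding decay_rate_def Nt using T c by (simp add: divide_simps del: of_nat_Suc) (simp add: algebra_simps power2_eq_square)
  qed
  finally show ?thesis .
qed

text \<open>The gap is a positive multiple of \<open>1 + (N - 1) / r\<close>, which shrinks as
  \<open>r\<close> grows. Fewer factors thus decay at least as fast, and the error from the partial
  trace fits into the rate for more factors.\<close>

lemma decay_rate_mono:
  assumes "0 < s" "s \<le> t" shows "decay_rate s \<le> decay_rate t"
proof -
  have eq: "decay_rate r = 1 - real N / (2 * ((real N)\<^sup>2 - 1)) * (1 + (real N - 1) / real r)" if "0 < r" for r
    using that card_I_pos unfolding decay_rate_def by (simp add: divide_simps) (simp add: algebra_simps)
  have "(real N - 1) / real t \<le> (real N - 1) / real s"
    using assms N2 by (intro divide_left_mono) auto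
  then have "real N / (2 * ((real N)\<^sup>2 - 1)) * (1 + (real N - 1) / real t) \<le> real N / (2 * ((real N)\<^sup>2 - 1)) * (1 + (real N - 1) / real s)"
    using card_I_pos by (intro mult_left_mono) auto
  then show ?thesis using assms by (simp add: eq)
qed

text \<open>By monotonicity \<open>t = 1\<close> is the critical case, where
  \<open>N^2 / (2 (N^2 - 1)) < 1\<close> holds because \<open>N^2 > 2\<close>. Positivity is a
  hypothesis of \<open>moment_decay\<close>.\<close>

lemma decay_rate_pos: assumes "0 < t" shows "0 < decay_rate t"
proof -
  have "(2::real)\<^sup>2 \<le> (real N)\<^sup>2" using N2 by (intro power_mono) auto
  then have "0 < decay_rate 1" using card_I_pos by (simp add: decay_rate_def divide_simps power2_eq_square)
  also have "decay_rate 1 \<le> decay_rate t" using assms by (intro decay_rate_mono) auto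
  finally show ?thesis .
qed

text \<open>By self-adjointness the squared norm of the iterate is the moment of index
  \<open>2 * k\<close>, which explains the exponent. Tracelessness passes to the partial trace and
  feeds the induction.\<close>

theorem twirl_pow_contract:
  assumes "herm_sym N t X" "full_tr N t X = 0"
  shows "hs_norm_sq N t ((twirl t ^^ k) X) \<le> decay_rate t ^ (2 * k) * hs_norm_sq N t X"
  using assms
proof (induction t arbitrary: X k)
  case 0
  \<comment> \<open>With no factors a kernel is the single number \<open>X [] []\<close>, which is
    its own trace.\<close>
  have tr: "full_tr N 0 ((twirl 0 ^^ k) X) = 0"
  proof -
    have "X [] [] = 0" using 0(2) by (simp add: full_tr_def)
    then have "(twirl 0 ^^ k) X [] [] = (twirl 0 ^^ k) (\<lambda>u v. X u v - X u v) [] []"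
      by (intro twirl_pow_cong) auto
    also have "\<dots> = 0"
      by (induction k) (auto simp: twirl_def pinch_def eigenframe_def conj_by_def)
    finally show ?thesis by (simp add: full_tr_def)
  qed
  then have "hs_norm_sq N 0 ((twirl 0 ^^ k) X) = 0" by (simp add: full_tr_def hs_norm_sq_def)
  then show ?case by (simp add: hs_norm_sq_nonneg)
next
  case (Suc t)
  let ?Y = "partial_tr N X" and ?l = "decay_rate (Suc t)" and ?K = "real N / (2 * ((real N)\<^sup>2 - 1))"
  define m where "m k = Re (hs_inner N (Suc t) X ((twirl (Suc t) ^^ k) X))" for k
  have even: "m (2 * k) = hs_norm_sq N (Suc t) ((twirl (Suc t) ^^ k) X)" for k
  proof -
    have "complex_of_real (hs_norm_sq N (Suc t) ((twirl (Suc t) ^^ k) X)) = hs_inner N (Suc t) X ((twirl (Suc t) ^^ (2 * k)) X)"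
      unfolding hs_inner_self[symmetric] hs_inner_twirl_pow by (simp add: mult_2)
    then show ?thesis unfolding m_def by (metis Re_complex_of_real)
  qed
  have m_add: "m (j + k) = Re (hs_inner N (Suc t) ((twirl (Suc t) ^^ j) X) ((twirl (Suc t) ^^ k) X))" for j k
    unfolding m_def hs_inner_twirl_pow ..
  have m_add1: "m (Suc (j + k)) = Re (hs_inner N (Suc t) ((twirl (Suc t) ^^ j) X) (twirl (Suc t) ((twirl (Suc t) ^^ k) X)))" for j k
    using m_add[of j "Suc k"] by simp
  have nonneg: "0 \<le> m k" for k
  proof (cases "even k")
    case True
    then obtain j where "k = 2 * j" by (elim evenE)
    then show ?thesis by (simp add: even hs_norm_sq_nonneg)
  next
    case False
    then obtain j where "k = Suc (j + j)" by (metis oddE mult_2 Suc_eq_plus1)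
    then show ?thesis by (simp only: m_add1 hs_inner_twirl_self_nonneg)
  qed
  \<comment> \<open>For even \<open>k\<close> the middle moment is the Hilbert-Schmidt product of
    two consecutive iterates. For odd \<open>k\<close> one application of the channel is left over,
    and the same argument is run in its positive form.\<close>
  have logconv: "(m (Suc k))\<^sup>2 \<le> m k * m (Suc (Suc k))" for k
  proof (cases "even k")
    case True
    then obtain j where k: "k = j + j" by (metis evenE mult_2)
    have "(m (j + Suc j))\<^sup>2 \<le> hs_norm_sq N (Suc t) ((twirl (Suc t) ^^ j) X) * hs_norm_sq N (Suc t) ((twirl (Suc t) ^^ Suc j) X)"
      unfolding m_add by (rule hs_inner_Cauchy_Schwarz)
    then show ?thesis unfolding even[symmetric] by (simp add: k mult_2)
  next
    case False
    then obtain j where k: "k = Suc (j + j)" by (metis oddE mult_2 Suc_eq_plus1)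
    have "(m (Suc (j + Suc j)))\<^sup>2 \<le> m (Suc (j + j)) * m (Suc (Suc j + Suc j))"
      unfolding m_add1 by (rule hs_inner_twirl_Cauchy_Schwarz)
    then show ?thesis by (simp add: k)
  qed
  have Y: "herm_sym N t ?Y" "full_tr N t ?Y = 0"
    using Suc.prems by (auto simp: herm_sym_partial_tr full_tr_partial_tr)
  have l: "0 < ?l" by (rule decay_rate_pos) simp
  have decay: "hs_norm_sq N t (partial_tr N ((twirl (Suc t) ^^ k) X)) \<le> ?l ^ (2 * k) * hs_norm_sq N t ?Y" for k
  proof -
    have "hs_norm_sq N t (partial_tr N ((twirl (Suc t) ^^ k) X)) = hs_norm_sq N t ((twirl t ^^ k) ?Y)"
      by (intro hs_norm_sq_cong partial_tr_twirl_pow)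
    also have "\<dots> \<le> decay_rate t ^ (2 * k) * hs_norm_sq N t ?Y" by (rule Suc.IH[OF Y])
    also have "\<dots> \<le> ?l ^ (2 * k) * hs_norm_sq N t ?Y"
    proof (cases t)
      case 0
      then have "hs_norm_sq N t ?Y = 0" using Y(2) by (simp add: full_tr_def hs_norm_sq_def)
      then show ?thesis by simp
    next
      case (Suc s)
      then have "0 < decay_rate t" "decay_rate t \<le> ?l" by (auto intro: decay_rate_pos decay_rate_mono)
      then show ?thesis by (intro mult_right_mono power_mono) (auto simp: hs_norm_sq_nonneg)
    qed
    finally show ?thesis .
  qed
  have "m (Suc (2 * k)) \<le> ?l * m (2 * k) + (?K * hs_norm_sq N t ?Y) * ?l ^ (2 * k)" for k
  proof -
    have "m (Suc (2 * k)) = Re (hs_inner N (Suc t) ((twirl (Suc t) ^^ k) X) (twirl (Suc t) ((twirl (Suc t) ^^ k) X)))"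
      using m_add1[of k k] by (simp add: mult_2)
    also have "\<dots> \<le> ?l * m (2 * k) + ?K * hs_norm_sq N t (partial_tr N ((twirl (Suc t) ^^ k) X))"
      unfolding even by (rule hs_inner_twirl_le[OF twirl_pow_herm_sym[OF Suc.prems(1)]])
    also have "?K * hs_norm_sq N t (partial_tr N ((twirl (Suc t) ^^ k) X)) \<le> ?K * (?l ^ (2 * k) * hs_norm_sq N t ?Y)"
      using card_I_pos by (intro mult_left_mono decay) auto
    finally show ?thesis by (simp add: ac_simps)
  qed
  from moment_decay[OF nonneg logconv l this, of "2 * k"]
  show ?case unfolding even using even[of 0] by simp
qed

end

section \<open>The trace norm and the rank\<close>

text \<open>Sylvester's identity. The block matrix \<open>M\<close> with rows \<open>x 1, A\<close>
  and \<open>B, 1\<close> is multiplied by \<open>L\<close>, of determinant one, to give the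
  characteristic polynomial of \<open>A * B\<close>, and by \<open>R\<close>, of determinant
  \<open>x^d\<close>, to give that of \<open>B * A\<close> times \<open>x^D\<close>. The form
  without division covers both orders of \<open>d\<close> and \<open>D\<close>.\<close>

lemma char_poly_mult_commute:
  fixes A B :: "complex mat"
  assumes A: "A \<in> carrier_mat D d" and B: "B \<in> carrier_mat d D"
  shows "char_poly (A * B) * [:0, 1:] ^ d = [:0, 1:] ^ D * char_poly (B * A)"
proof -
  let ?x = "[:0, 1:] :: complex poly"
  let ?p = "map_mat (\<lambda>a. [:a:] :: complex poly)"
  interpret p: semiring_hom "\<lambda>a::complex. [:a:]"
    by unfold_locales auto
  define M where "M = four_block_mat (?x \<cdot>\<^sub>m 1\<^sub>m D) (?p A) (?p B) (1\<^sub>m d)"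
  define L where "L = four_block_mat (1\<^sub>m D) (0\<^sub>m D d) (- ?p B) (1\<^sub>m d)"
  define R where "R = four_block_mat (1\<^sub>m D) (- ?p A) (0\<^sub>m d D) (?x \<cdot>\<^sub>m 1\<^sub>m d)"
  have pA: "?p A \<in> carrier_mat D d" and pB: "?p B \<in> carrier_mat d D" using A B by auto
  have AB: "?p A * ?p B = ?p (A * B)" "?p B * ?p A = ?p (B * A)"
    using p.mat_hom_mult[OF A B] p.mat_hom_mult[OF B A] by auto
  have cAB: "A * B \<in> carrier_mat D D" "B * A \<in> carrier_mat d d" using A B by auto
  have M: "M \<in> carrier_mat (D + d) (D + d)" and L: "L \<in> carrier_mat (D + d) (D + d)"
    and R: "R \<in> carrier_mat (D + d) (D + d)"
    unfolding M_def L_def R_def by (intro four_block_carrier_mat; simp)+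
  have cp: "char_poly X = det (?x \<cdot>\<^sub>m 1\<^sub>m n - ?p X)" if "X \<in> carrier_mat n n" for X n
    unfolding char_poly_def char_poly_matrix_def using that
    by (intro arg_cong[where f = det] eq_matI) auto
  have "M * L = four_block_mat (?x \<cdot>\<^sub>m 1\<^sub>m D - ?p (A * B)) (?p A) (0\<^sub>m d D) (1\<^sub>m d)"
    unfolding M_def L_def
    by (subst mult_four_block_mat[of _ D D _ d _ d _ _ D _ d])
      (use A B in \<open>auto simp flip: AB intro!: arg_cong2[where f = "\<lambda>x y. four_block_mat x _ y _"]\<close>)
  then have "det (M * L) = det (?x \<cdot>\<^sub>m 1\<^sub>m D - ?p (A * B)) * det (1\<^sub>m d)"
    using A B cAB pA by (subst det_four_block_mat_lower_left_zero[where n = D and m = d, symmetric]) auto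
  moreover have "det L = 1" unfolding L_def
    using B by (subst det_four_block_mat_upper_right_zero[where n = D and m = d]) auto
  ultimately have 1: "det M = char_poly (A * B)"
    using det_mult[OF M L] A B cAB by (simp add: cp[of _ D])
  have "M * R = four_block_mat (?x \<cdot>\<^sub>m 1\<^sub>m D) (0\<^sub>m D d) (?p B) (?x \<cdot>\<^sub>m 1\<^sub>m d - ?p (B * A))"
  proof -
    have "(?x \<cdot>\<^sub>m 1\<^sub>m D) * (- ?p A) + ?p A * (?x \<cdot>\<^sub>m 1\<^sub>m d) = - (?x \<cdot>\<^sub>m ?p A) + ?x \<cdot>\<^sub>m ?p A"
      using pA by (simp add: mult_smult_assoc_mat[of _ D D _ d] mult_smult_distrib[of _ D d _ d])
    also have "\<dots> = 0\<^sub>m D d" using pA by (intro eq_matI) auto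
    finally have tr: "(?x \<cdot>\<^sub>m 1\<^sub>m D) * (- ?p A) + ?p A * (?x \<cdot>\<^sub>m 1\<^sub>m d) = 0\<^sub>m D d" .
    have br: "?p B * (- ?p A) + 1\<^sub>m d * (?x \<cdot>\<^sub>m 1\<^sub>m d) = ?x \<cdot>\<^sub>m 1\<^sub>m d - ?p (B * A)"
      using pA pB unfolding AB[symmetric] by (intro eq_matI) auto
    have "M * R = four_block_mat ((?x \<cdot>\<^sub>m 1\<^sub>m D) * 1\<^sub>m D + ?p A * 0\<^sub>m d D) ((?x \<cdot>\<^sub>m 1\<^sub>m D) * (- ?p A) + ?p A * (?x \<cdot>\<^sub>m 1\<^sub>m d))
       (?p B * 1\<^sub>m D + 1\<^sub>m d * 0\<^sub>m d D) (?p B * (- ?p A) + 1\<^sub>m d * (?x \<cdot>\<^sub>m 1\<^sub>m d))"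
      unfolding M_def R_def using pA pB by (intro mult_four_block_mat[of _ D D _ d _ d _ _ D _ d]) auto
    then show ?thesis unfolding tr br using pA pB by simp
  qed
  then have "det (M * R) = det (?x \<cdot>\<^sub>m 1\<^sub>m D) * det (?x \<cdot>\<^sub>m 1\<^sub>m d - ?p (B * A))"
    using A B cAB pB by (subst det_four_block_mat_upper_right_zero[where n = D and m = d, symmetric]) auto
  moreover have "det R = det (?x \<cdot>\<^sub>m 1\<^sub>m d)" unfolding R_def
    using A by (subst det_four_block_mat_lower_left_zero[where n = D and m = d]) auto
  moreover have "det (?x \<cdot>\<^sub>m 1\<^sub>m n) = ?x ^ n" for n by simp
  ultimately show ?thesis
    using det_mult[OF M R] 1 A B cAB by (simp add: cp[of _ d])
qed

lemma dag_carrier [simp]: "A \<in> carrier_mat n m \<Longrightarrow> dag A \<in> carrier_mat m n"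
  by (auto simp: dag_def)

lemma order_char_poly_factored:
  assumes "p = (\<Prod>a\<leftarrow>as. [:- a, 1:])"
  shows "Polynomial.order z p = count_list as (z::complex)" and "poly p z = 0 \<longleftrightarrow> z \<in> set as"
proof -
  have ne: "(\<Prod>a\<leftarrow>as. [:- a, 1:]) \<noteq> 0" for as :: "complex list" by (auto simp: prod_list_zero_iff)
  have "Polynomial.order z (\<Prod>a\<leftarrow>as. [:- a, 1:]) = count_list as z"
  proof (induction as)
    case (Cons a as)
    have "Polynomial.order z (\<Prod>a\<leftarrow>a # as. [:- a, 1:]) = Polynomial.order z [:- a, 1:] + Polynomial.order z (\<Prod>a\<leftarrow>as. [:- a, 1:])"
      unfolding list.map prod_list.Cons by (rule Polynomial.order_mult) (use ne[of "a # as"] in simp)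
    moreover have "Polynomial.order z [:- a, 1:] = (if a = z then 1 else 0)"
      using order_power_n_n[of z 1] by (auto intro: order_0I)
    ultimately show ?case using Cons by simp
  qed (simp add: order_1_eq_0)
  then show "Polynomial.order z p = count_list as z" using assms by simp
  show "poly p z = 0 \<longleftrightarrow> z \<in> set as"
    unfolding assms by (induction as) (auto simp: algebra_simps)
qed

lemma sum_count_list:
  fixes f :: "'a \<Rightarrow> real"
  assumes "finite S" "set xs \<subseteq> S"
  shows "(\<Sum>z\<in>S. real (count_list xs z) * f z) = (\<Sum>x\<leftarrow>xs. f x)"
  using assms(2)
proof (induction xs)
  case (Cons x xs)
  have "(\<Sum>z\<in>S. real (count_list (x # xs) z) * f z) = (\<Sum>z\<in>S. (if z = x then f z else 0) + real (count_list xs z) * f z)"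
    by (intro sum.cong refl) (auto simp: algebra_simps)
  also have "\<dots> = f x + (\<Sum>z\<in>S. real (count_list xs z) * f z)"
    using Cons.prems assms(1) by (simp add: sum.distrib)
  finally show ?case using Cons by simp
qed simp

lemma trace_norm_eq:
  assumes "char_poly (dag A * A) = (\<Prod>a\<leftarrow>as. [:- a, 1:])"
  shows "trace_norm A = (\<Sum>a\<leftarrow>as. sqrt (Re a))"
proof -
  have "trace_norm A = (\<Sum>z\<in>set as. real (count_list as z) * sqrt (Re z))"
    unfolding trace_norm_def Let_def using order_char_poly_factored[OF assms] by (intro sum.cong) auto
  also have "\<dots> = (\<Sum>a\<leftarrow>as. sqrt (Re a))"
    by (rule sum_count_list) auto
  finally show ?thesis .
qed

definition mat_tr :: "complex mat \<Rightarrow> complex" where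
  "mat_tr A = (\<Sum>i<dim_row A. A $$ (i, i))"

lemma mat_tr_mult_commute:
  assumes "A \<in> carrier_mat n m" "B \<in> carrier_mat m n"
  shows "mat_tr (A * B) = mat_tr (B * A)"
proof -
  have "mat_tr (A * B) = (\<Sum>i<n. \<Sum>j<m. A $$ (i, j) * B $$ (j, i))"
    using assms by (simp add: mat_tr_def scalar_prod_def atLeast0LessThan)
  also have "\<dots> = (\<Sum>j<m. \<Sum>i<n. B $$ (j, i) * A $$ (i, j))"
    by (subst sum.swap) (simp add: ac_simps)
  also have "\<dots> = mat_tr (B * A)"
    using assms by (simp add: mat_tr_def scalar_prod_def atLeast0LessThan)
  finally show ?thesis .
qed

text \<open>A Schur decomposition puts the roots on the diagonal of a similar matrix, and the trace
  is invariant under similarity.\<close>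

lemma mat_tr_eq_sum_roots:
  assumes A: "A \<in> carrier_mat n n" and as: "char_poly A = (\<Prod>a\<leftarrow>as. [:- a, 1:])"
  shows "mat_tr A = sum_list as"
proof -
  obtain B P Q where B: "schur_decomposition A as = (B, P, Q)" by (metis prod_cases3)
  from schur_decomposition[OF A as B] have sim: "similar_mat_wit A B P Q" and d: "diag_mat B = as" by auto
  note w = similar_mat_witD2[OF A sim]
  have "mat_tr A = mat_tr (P * B * Q)" using w by simp
  also have "\<dots> = mat_tr (Q * (P * B))" using w by (intro mat_tr_mult_commute[of _ n n]) auto
  also have "Q * (P * B) = Q * P * B" using w by (intro assoc_mult_mat[symmetric]) auto
  also have "\<dots> = B" using w by simp
  also have "mat_tr B = sum_list (diag_mat B)"
    by (simp add: mat_tr_def diag_mat_def sum_list_sum_nth atLeast0LessThan)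
  finally show ?thesis by (simp add: d)
qed

lemma mat_tr_dag_mult:
  assumes "A \<in> carrier_mat n n"
  shows "mat_tr (dag A * A) = of_real (\<Sum>i<n. \<Sum>j<n. (cmod (A $$ (i, j)))\<^sup>2)"
proof -
  have "mat_tr (dag A * A) = (\<Sum>j<n. \<Sum>i<n. of_real ((cmod (A $$ (i, j)))\<^sup>2))"
    using assms by (simp add: mat_tr_def dag_def scalar_prod_def atLeast0LessThan mult.commute[of "cnj _"]
        flip: complex_norm_square)
  also have "\<dots> = of_real (\<Sum>i<n. \<Sum>j<n. (cmod (A $$ (i, j)))\<^sup>2)"
    by (subst sum.swap) simp
  finally show ?thesis .
qed

text \<open>For an eigenvector \<open>v\<close> the eigenvalue is the quotient of the squared norms
  of \<open>A v\<close> and \<open>v\<close>.\<close>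

lemma eigenvalue_dag_mult_nonneg:
  assumes A: "A \<in> carrier_mat n n" and "eigenvalue (dag A * A) z"
  shows "0 \<le> Re z \<and> Im z = 0"
proof -
  obtain v where v: "v \<in> carrier_vec n" "v \<noteq> 0\<^sub>v n" "(dag A * A) *\<^sub>v v = z \<cdot>\<^sub>v v"
    using assms unfolding eigenvalue_def eigenvector_def by (auto simp: dag_def)
  define w where "w = A *\<^sub>v v"
  have w: "w \<in> carrier_vec n" using A v by (auto simp: w_def)
  have eq: "dag A *\<^sub>v w = z \<cdot>\<^sub>v v"
    unfolding w_def v(3)[symmetric] using A v by (intro assoc_mult_mat_vec[of _ n n _ n, symmetric]) auto
  have dw: "(dag A *\<^sub>v w) $ i = (\<Sum>j<n. cnj (A $$ (j, i)) * w $ j)" if "i < n" for i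
    using that A w by (simp add: dag_def scalar_prod_def atLeast0LessThan)
  have wj: "w $ j = (\<Sum>i<n. A $$ (j, i) * v $ i)" if "j < n" for j
    using that A v by (simp add: w_def scalar_prod_def atLeast0LessThan)
  have "(\<Sum>j<n. of_real ((cmod (w $ j))\<^sup>2)) = (\<Sum>j<n. cnj (w $ j) * w $ j)"
    by (simp only: complex_norm_square mult.commute)
  also have "\<dots> = (\<Sum>j<n. \<Sum>i<n. cnj (A $$ (j, i)) * cnj (v $ i) * w $ j)"
    by (intro sum.cong refl) (simp add: wj[of _] cnj_sum sum_distrib_right)
  also have "\<dots> = (\<Sum>i<n. cnj (v $ i) * (\<Sum>j<n. cnj (A $$ (j, i)) * w $ j))"
    by (subst sum.swap) (simp add: sum_distrib_left ac_simps)
  also have "\<dots> = (\<Sum>i<n. cnj (v $ i) * (z * v $ i))"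
    using dw eq v(1) by (intro sum.cong refl) auto
  also have "\<dots> = z * (\<Sum>i<n. of_real ((cmod (v $ i))\<^sup>2))"
    by (simp only: sum_distrib_left complex_norm_square ac_simps)
  finally have main: "of_real (\<Sum>j<n. (cmod (w $ j))\<^sup>2) = z * of_real (\<Sum>i<n. (cmod (v $ i))\<^sup>2)" by simp
  have pos: "0 < (\<Sum>i<n. (cmod (v $ i))\<^sup>2)"
  proof -
    obtain i where i: "i < n" "v $ i \<noteq> 0" using v(1,2) by (auto simp: vec_eq_iff)
    then show ?thesis by (intro sum_pos2[of _ i]) auto
  qed
  from main pos have "z = of_real ((\<Sum>j<n. (cmod (w $ j))\<^sup>2) / (\<Sum>i<n. (cmod (v $ i))\<^sup>2))"
    by (metis nonzero_eq_divide_eq of_real_divide of_real_eq_0_iff less_irrefl)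
  then show ?thesis by (simp add: sum_nonneg)
qed

text \<open>Cauchy-Schwarz against the all-ones vector, after dropping the vanishing terms so that
  only the nonzero ones are counted.\<close>

lemma sum_sqrt_le:
  fixes f :: "'a \<Rightarrow> real"
  assumes "\<And>x. x \<in> set xs \<Longrightarrow> 0 \<le> f x"
  shows "(\<Sum>x\<leftarrow>xs. sqrt (f x)) \<le> sqrt (real (length (filter (\<lambda>x. f x \<noteq> 0) xs))) * sqrt (\<Sum>x\<leftarrow>xs. f x)"
proof -
  define ys where "ys = filter (\<lambda>x. f x \<noteq> 0) xs"
  have eq: "(\<Sum>x\<leftarrow>xs. g (f x)) = (\<Sum>x\<leftarrow>ys. g (f x))" if "g 0 = 0" for g :: "real \<Rightarrow> real"
    unfolding ys_def using that by (induction xs) auto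
  have ys: "0 \<le> f x" if "x \<in> set ys" for x using that assms by (auto simp: ys_def)
  have "(\<Sum>x\<leftarrow>ys. sqrt (f x))\<^sup>2 = (\<Sum>i<length ys. 1 * sqrt (f (ys ! i)))\<^sup>2"
    by (simp add: sum_list_sum_nth atLeast0LessThan)
  also have "\<dots> \<le> (\<Sum>i<length ys. 1\<^sup>2) * (\<Sum>i<length ys. (sqrt (f (ys ! i)))\<^sup>2)"
    by (rule Cauchy_Schwarz_ineq_sum)
  also have "\<dots> = real (length ys) * (\<Sum>x\<leftarrow>ys. f x)"
    using ys by (simp add: sum_list_sum_nth atLeast0LessThan)
  finally have "(\<Sum>x\<leftarrow>ys. sqrt (f x)) \<le> sqrt (real (length ys) * (\<Sum>x\<leftarrow>ys. f x))"
    by (rule real_le_rsqrt)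
  then show ?thesis using eq[of sqrt] eq[of "\<lambda>x. x"] by (simp add: real_sqrt_mult ys_def)
qed

text \<open>Because \<open>trace_norm\<close> counts algebraic multiplicities, the rank enters
  through the multiplicity of the root zero. Writing \<open>dag A * A\<close> as
  \<open>(dag A * E) * G\<close> and comparing orders of vanishing at zero in
  \<open>char_poly_mult_commute\<close> shows that zero has multiplicity at least
  \<open>D - d\<close>. So at most \<open>d\<close> singular values are nonzero, and
  \<open>sum_sqrt_le\<close> applies.\<close>

lemma trace_norm_le_rank:
  assumes A: "A \<in> carrier_mat D D" and F: "A = E * G" "E \<in> carrier_mat D d" "G \<in> carrier_mat d D"
  shows "trace_norm A \<le> sqrt (real d) * sqrt (\<Sum>i<D. \<Sum>j<D. (cmod (A $$ (i, j)))\<^sup>2)"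
proof -
  let ?M = "dag A * A"
  have M: "?M \<in> carrier_mat D D" using A by (auto simp: dag_def)
  obtain as where as: "char_poly ?M = (\<Prod>a\<leftarrow>as. [:- a, 1:])" "length as = D"
    using char_poly_factorized[OF M] by blast
  have nn: "0 \<le> Re a \<and> Im a = 0" if "a \<in> set as" for a
    using that order_char_poly_factored(2)[OF as(1)] eigenvalue_root_char_poly[OF M]
    by (intro eigenvalue_dag_mult_nonneg[OF A]) auto
  have "?M = (dag A * E) * G"
    unfolding F(1)[symmetric] using A F by (subst assoc_mult_mat[of _ D D _ d]) (auto simp: dag_def)
  moreover have dE: "dag A * E \<in> carrier_mat D d" using A F by (auto simp: dag_def)
  ultimately have cc: "char_poly ?M * [:0, 1:] ^ d = [:0, 1:] ^ D * char_poly (G * (dag A * E))"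
    using char_poly_mult_commute[OF dE F(3)] by simp
  have GE: "G * (dag A * E) \<in> carrier_mat d d" using dE F(3) by simp
  have n0: "char_poly ?M \<noteq> 0" "char_poly (G * (dag A * E)) \<noteq> 0"
    using degree_monic_char_poly[OF M] degree_monic_char_poly[OF GE] by auto
  have "Polynomial.order 0 (char_poly ?M * [:0, 1:] ^ d) = Polynomial.order 0 ([:0, 1:] ^ D * char_poly (G * (dag A * E)))"
    using cc by simp
  then have "D \<le> Polynomial.order 0 (char_poly ?M) + d"
    using n0 order_power_n_n[of "0::complex"] by (simp add: Polynomial.order_mult)
  then have D: "D \<le> count_list as 0 + d" using order_char_poly_factored(1)[OF as(1)] by simp
  have "length (filter (\<lambda>a. Re a \<noteq> 0) as) + count_list as 0 \<le> length as"
    by (induction as) auto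
  then have len: "length (filter (\<lambda>a. Re a \<noteq> 0) as) \<le> d" using D as(2) by simp
  have tr: "(\<Sum>a\<leftarrow>as. Re a) = (\<Sum>i<D. \<Sum>j<D. (cmod (A $$ (i, j)))\<^sup>2)"
  proof -
    have "sum_list as = of_real (\<Sum>i<D. \<Sum>j<D. (cmod (A $$ (i, j)))\<^sup>2)"
      using mat_tr_dag_mult[OF A] mat_tr_eq_sum_roots[OF M as(1)] by simp
    moreover have "Re (sum_list as) = (\<Sum>a\<leftarrow>as. Re a)" for as by (induction as) auto
    ultimately show ?thesis by (metis Re_complex_of_real)
  qed
  have "trace_norm A = (\<Sum>a\<leftarrow>as. sqrt (Re a))" by (rule trace_norm_eq[OF as(1)])
  also have "\<dots> \<le> sqrt (real (length (filter (\<lambda>a. Re a \<noteq> 0) as))) * sqrt (\<Sum>a\<leftarrow>as. Re a)"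
    by (rule sum_sqrt_le) (use nn in auto)
  also have "\<dots> \<le> sqrt (real d) * sqrt (\<Sum>a\<leftarrow>as. Re a)"
    using len tr by (intro mult_right_mono) (auto intro!: sum_nonneg)
  finally show ?thesis by (simp only: tr)
qed

section \<open>Diagonalizing Pauli strings\<close>

definition entry :: "complex mat \<Rightarrow> nat \<Rightarrow> nat \<Rightarrow> complex" where
  "entry A a b = A $$ (a, b)"

text \<open>The most recent factor of \<open>kron_pow\<close> is the least significant digit, so it is the head of a word.\<close>

fun encode :: "nat \<Rightarrow> nat list \<Rightarrow> nat" where
  "encode N [] = 0"
| "encode N (a # u) = encode N u * N + a"

fun decode :: "nat \<Rightarrow> nat \<Rightarrow> nat \<Rightarrow> nat list" where
  "decode N 0 i = []"
| "decode N (Suc t) i = (i mod N) # decode N t (i div N)"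

definition kernel_of :: "nat \<Rightarrow> complex mat \<Rightarrow> nat list \<Rightarrow> nat list \<Rightarrow> complex" where
  "kernel_of N M u v = M $$ (encode N u, encode N v)"

lemma decode_in_words: "0 < N \<Longrightarrow> decode N t i \<in> words N t"
  by (induction t arbitrary: i) auto

lemma encode_less: "u \<in> words N t \<Longrightarrow> encode N u < N ^ t"
proof (induction t arbitrary: u)
  case (Suc t)
  then obtain a u' where u: "u = a # u'" "a < N" "u' \<in> words N t" by (elim words_SucE)
  have "encode N u' * N + a < Suc (encode N u') * N" using u(2) by simp
  also have "\<dots> \<le> N ^ t * N" using Suc.IH[OF u(3)] by (intro mult_right_mono) auto
  finally show ?case by (simp add: u ac_simps)
qed simp

lemma decode_encode: "u \<in> words N t \<Longrightarrow> decode N t (encode N u) = u"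
proof (induction t arbitrary: u)
  case (Suc t)
  then obtain a u' where "u = a # u'" "a < N" "u' \<in> words N t" by (elim words_SucE)
  then show ?case using Suc.IH by simp
qed simp

lemma encode_decode: "i < N ^ t \<Longrightarrow> encode N (decode N t i) = i"
proof (induction t arbitrary: i)
  case (Suc t)
  have "i div N < N ^ t" using Suc.prems by (simp add: less_mult_imp_div_less mult.commute)
  then show ?case using Suc.IH by simp
qed simp

lemma bij_encode: assumes "0 < N" shows "bij_betw (encode N) (words N t) {..<N ^ t}"
  by (rule bij_betw_byWitness[of _ "decode N t"])
    (use assms in \<open>auto simp: decode_encode encode_decode encode_less decode_in_words\<close>)

lemma sum_encode: "0 < N \<Longrightarrow> (\<Sum>i<N ^ t. f i) = (\<Sum>u\<in>words N t. f (encode N u))"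
  by (rule sum.reindex_bij_betw[OF bij_encode, symmetric])

lemma kernel_of_mult:
  assumes "0 < N" "A \<in> carrier_mat (N ^ t) (N ^ t)" "B \<in> carrier_mat (N ^ t) (N ^ t)"
    and "u \<in> words N t" "v \<in> words N t"
  shows "kernel_of N (A * B) u v = (\<Sum>w\<in>words N t. kernel_of N A u w * kernel_of N B w v)"
  using assms encode_less[OF assms(4)] encode_less[OF assms(5)]
  by (simp add: kernel_of_def scalar_prod_def atLeast0LessThan sum_encode encode_less)

lemma kron_pow_carrier: "A \<in> carrier_mat N N \<Longrightarrow> kron_pow t A \<in> carrier_mat (N ^ t) (N ^ t)"
  by (induction t) (auto simp: kron_def)

lemma kernel_of_kron_pow:
  assumes A: "A \<in> carrier_mat N N" and "u \<in> words N t" "v \<in> words N t"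
  shows "kernel_of N (kron_pow t A) u v = tensor_pow (entry A) u v"
  using assms(2,3)
proof (induction t arbitrary: u v)
  case (Suc t)
  obtain a u' where u: "u = a # u'" "a < N" "u' \<in> words N t" using Suc.prems(1) by (elim words_SucE)
  obtain b v' where v: "v = b # v'" "b < N" "v' \<in> words N t" using Suc.prems(2) by (elim words_SucE)
  have K: "dim_row (kron_pow t A) = N ^ t" "dim_col (kron_pow t A) = N ^ t"
    using kron_pow_carrier[OF A, of t] by auto
  have "encode N u < N ^ t * N" "encode N v < N ^ t * N"
    using encode_less[OF Suc.prems(1)] encode_less[OF Suc.prems(2)] by (simp_all add: mult.commute)
  then show ?case
    using Suc.IH[OF u(3) v(3)] A u v K by (simp add: kernel_of_def kron_def entry_def)
qed (simp add: kernel_of_def)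

text \<open>\<open>B\<close> is tied to \<open>A\<close> by entries only, because the right factor
  in the channel is the exponential of the negated generator and its being the adjoint is proved
  separately, in \<open>rotation_adjoint\<close>.\<close>

lemma conj_by_eq_kernel_of:
  assumes N: "0 < N" and "A \<in> carrier_mat N N" "B \<in> carrier_mat N N" "M \<in> carrier_mat (N ^ t) (N ^ t)"
    and B: "\<And>a b. a < N \<Longrightarrow> b < N \<Longrightarrow> B $$ (a, b) = cnj (A $$ (b, a))"
    and uv: "u \<in> words N t" "v \<in> words N t"
  shows "kernel_of N (kron_pow t A * M * kron_pow t B) u v = conj_by N t (entry A) (kernel_of N M) u v"
proof -
  have tpB: "tensor_pow (entry B) y v = cnj (tensor_pow (entry A) v y)" if "y \<in> words N t" for y
    using that uv(2)
  proof (induction t arbitrary: y v)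
    case (Suc t)
    obtain a u' where u: "y = a # u'" "a < N" "u' \<in> words N t" using Suc.prems(1) by (elim words_SucE)
    obtain b v' where v: "v = b # v'" "b < N" "v' \<in> words N t" using Suc.prems(2) by (elim words_SucE)
    show ?case using Suc.IH[OF u(3) v(3)] u v B by (simp add: entry_def)
  qed simp
  have "kernel_of N (kron_pow t A * M * kron_pow t B) u v =
     (\<Sum>x\<in>words N t. tensor_pow (entry A) u x * (\<Sum>y\<in>words N t. kernel_of N M x y * tensor_pow (entry B) y v))"
    using assms kron_pow_carrier[of A N t] kron_pow_carrier[of B N t]
    by (simp add: kernel_of_mult[of N _ t] kernel_of_kron_pow)
  then show ?thesis by (simp add: conj_by_def sum_distrib_left tpB mult.assoc)
qed

section \<open>Eigenbases of Pauli strings\<close>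

definition diagonalized :: "nat \<Rightarrow> complex mat \<Rightarrow> (nat \<Rightarrow> nat \<Rightarrow> complex) \<Rightarrow> (nat \<Rightarrow> real) \<Rightarrow> bool" where
  "diagonalized N A W d \<longleftrightarrow> A \<in> carrier_mat N N \<and> unitary_on N W \<and> (\<forall>c<N. d c = 1 \<or> d c = -1)
     \<and> (\<forall>a<N. \<forall>b<N. A $$ (a, b) = (\<Sum>c<N. W a c * of_real (d c) * cnj (W b c)))"

lemma sum_lessThan_mult:
  fixes f :: "nat \<Rightarrow> 'a::comm_monoid_add"
  shows "(\<Sum>i<m * k. f i) = (\<Sum>p<m. \<Sum>q<k. f (p * k + q))"
proof (induction m)
  case (Suc m)
  have "{..<Suc m * k} = {..<m * k} \<union> {m * k..<m * k + k}" by auto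
  then have "(\<Sum>i<Suc m * k. f i) = (\<Sum>i<m * k. f i) + (\<Sum>i\<in>{m * k..<m * k + k}. f i)"
    by (simp add: sum.union_disjoint ivl_disj_int)
  also have "(\<Sum>i\<in>{m * k..<m * k + k}. f i) = (\<Sum>q<k. f (m * k + q))"
    using sum.shift_bounds_nat_ivl[of f 0 "m * k" k] by (simp add: atLeast0LessThan add.commute)
  finally show ?case using Suc by simp
qed simp

lemma div_mod_mult_add: "q < K \<Longrightarrow> (p * K + q) div K = p" "q < K \<Longrightarrow> (p * K + q) mod K = (q::nat)"
  by auto

lemma unitary_on_kron:
  assumes "unitary_on M V" "unitary_on K W" "0 < K"
  shows "unitary_on (M * K) (\<lambda>a b. V (a div K) (b div K) * W (a mod K) (b mod K))" (is "unitary_on _ ?Z")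
  unfolding unitary_on_def
proof (intro allI impI)
  fix a b assume "a < M * K" "b < M * K"
  then have lt: "a div K < M" "a mod K < K" "b div K < M" "b mod K < K"
    using assms(3) by (auto simp: less_mult_imp_div_less)
  have "mat_mul (M * K) (adj ?Z) ?Z a b = mat_mul M (adj V) V (a div K) (b div K) * mat_mul K (adj W) W (a mod K) (b mod K)"
    unfolding mat_mul_def adj_def sum_lessThan_mult sum_product
    by (intro sum.cong refl) (simp only: div_mod_mult_add lessThan_iff, simp only: complex_cnj_mult ac_simps)
  moreover have "mat_mul (M * K) ?Z (adj ?Z) a b = mat_mul M V (adj V) (a div K) (b div K) * mat_mul K W (adj W) (a mod K) (b mod K)"
    unfolding mat_mul_def adj_def sum_lessThan_mult sum_product
    by (intro sum.cong refl) (simp only: div_mod_mult_add lessThan_iff, simp only: complex_cnj_mult ac_simps)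
  moreover have "(a = b) = (a div K = b div K \<and> a mod K = b mod K)"
    by (metis div_mult_mod_eq)
  ultimately show "mat_mul (M * K) (adj ?Z) ?Z a b = of_bool (a = b) \<and> mat_mul (M * K) ?Z (adj ?Z) a b = of_bool (a = b)"
    using assms(1,2) lt by (simp add: unitary_on_def of_bool_conj)
qed

lemma diagonalized_kron:
  assumes "diagonalized M A V c" "diagonalized K B W d" "0 < K"
  shows "diagonalized (M * K) (kron A B) (\<lambda>a b. V (a div K) (b div K) * W (a mod K) (b mod K)) (\<lambda>a. c (a div K) * d (a mod K))"
proof -
  have lt: "a div K < M" "a mod K < K" if "a < M * K" for a
    using that assms(3) by (auto simp: less_mult_imp_div_less)
  have "c (a div K) * d (a mod K) = 1 \<or> c (a div K) * d (a mod K) = - 1" if "a < M * K" for a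
    using assms lt[OF that] unfolding diagonalized_def by fastforce
  moreover have "kron A B $$ (a, b) = (\<Sum>e<M * K. V (a div K) (e div K) * W (a mod K) (e mod K) * of_real (c (e div K) * d (e mod K)) *
      cnj (V (b div K) (e div K) * W (b mod K) (e mod K)))" if "a < M * K" "b < M * K" for a b
  proof -
    have "kron A B $$ (a, b) = A $$ (a div K, b div K) * B $$ (a mod K, b mod K)"
      using assms that unfolding diagonalized_def kron_def by auto
    also have "\<dots> = (\<Sum>e<M. V (a div K) e * of_real (c e) * cnj (V (b div K) e)) * (\<Sum>e<K. W (a mod K) e * of_real (d e) * cnj (W (b mod K) e))"
      using assms lt that unfolding diagonalized_def by auto
    finally show ?thesis
      unfolding sum_lessThan_mult sum_product
      by (simp only:) (intro sum.cong refl, simp only: div_mod_mult_add lessThan_iff,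
          simp only: complex_cnj_mult of_real_mult ac_simps)
  qed
  moreover have "kron A B \<in> carrier_mat (M * K) (M * K)"
    using assms unfolding diagonalized_def kron_def by auto
  ultimately show ?thesis
    using assms unitary_on_kron unfolding diagonalized_def by auto
qed

lemma less_2_cases': "a < 2 \<longleftrightarrow> a = 0 \<or> a = (1::nat)" by auto

lemma lessThan_two: "{..<2::nat} = {0, 1}" by auto

lemma diagonalized_pauli: "\<exists>W d. diagonalized 2 (pauli a) W d"
proof -
  \<comment> \<open>Normalization of the eigenvectors \<open>(1, 1)\<close>, \<open>(1, -1)\<close>
    of the first Pauli matrix and \<open>(1, \<i>)\<close>, \<open>(1, -\<i>)\<close> of the
    second.\<close>
  define r where "r = complex_of_real (1 / sqrt 2)"
  have r: "r * r = 1 / 2" "cnj r = r" "r * (r * x) = x / 2" "\<i> * r * (\<i> * r) = - (1 / 2)" for x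
    unfolding r_def by (auto simp flip: of_real_mult mult.assoc)
  consider "a = 0" | "a = 1" | "a = 2" | "a \<ge> 3" by linarith
  then show ?thesis
  proof cases
    case 1
    have "diagonalized 2 (pauli a) (\<lambda>a b. of_bool (a = b)) (\<lambda>_. 1)"
      using 1 by (auto simp: diagonalized_def unitary_on_def mat_mul_def adj_def pauli_def lessThan_two less_2_cases')
    then show ?thesis by blast
  next
    case 2
    have "diagonalized 2 (pauli a) (\<lambda>a b. if a = 1 \<and> b = 1 then - r else r) (\<lambda>c. if c = 0 then 1 else -1)"
      using 2 by (auto simp: diagonalized_def unitary_on_def mat_mul_def adj_def pauli_def lessThan_two less_2_cases' r)
    then show ?thesis by blast
  next
    case 3
    have "diagonalized 2 (pauli a) (\<lambda>a b. if a = 0 then r else if b = 0 then \<i> * r else - \<i> * r) (\<lambda>c. if c = 0 then 1 else -1)"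
      using 3 by (auto simp: diagonalized_def unitary_on_def mat_mul_def adj_def pauli_def lessThan_two less_2_cases' r)
    then show ?thesis by blast
  next
    case 4
    have "diagonalized 2 (pauli a) (\<lambda>a b. of_bool (a = b)) (\<lambda>c. if c = 0 then 1 else -1)"
      using 4 by (auto simp: diagonalized_def unitary_on_def mat_mul_def adj_def pauli_def lessThan_two less_2_cases')
    then show ?thesis by blast
  qed
qed

lemma diagonalized_pauli_string: "\<exists>W d. diagonalized (2 ^ n) (pauli_string n s) W d"
proof (induction n)
  case 0
  have "diagonalized 1 (1\<^sub>m 1) (\<lambda>_ _. 1) (\<lambda>_. 1)"
    by (auto simp: diagonalized_def unitary_on_def mat_mul_def adj_def)
  then show ?case by auto
next
  case (Suc n)
  then obtain V c where "diagonalized (2 ^ n) (pauli_string n s) V c" by blast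
  moreover obtain W d where "diagonalized 2 (pauli (s n)) W d" using diagonalized_pauli by blast
  ultimately show ?case using diagonalized_kron[of "2 ^ n" _ V c 2 _ W d] by (auto simp: mult.commute)
qed

lemma pauli_string_carrier: "pauli_string n s \<in> carrier_mat (2 ^ n) (2 ^ n)"
  using diagonalized_pauli_string[of n s] by (auto simp: diagonalized_def)

section \<open>Completeness and orthogonality of Pauli strings\<close>

lemma pauli_complete:
  assumes "a < 2" "b < 2" "c < 2" "e < 2"
  shows "(\<Sum>x<4. pauli x $$ (a, b) * pauli x $$ (c, e)) = 2 * of_bool (a = e \<and> b = c)"
proof -
  have "{..<4::nat} = {0, 1, 2, 3}" by auto
  then show ?thesis using assms by (auto simp: pauli_def less_2_cases')
qed

lemma pauli_orth:
  assumes "x < 4" "y < 4"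
  shows "(\<Sum>a<2. \<Sum>b<2. pauli x $$ (a, b) * pauli y $$ (b, a)) = 2 * of_bool (x = y)"
proof -
  have "x = 0 \<or> x = 1 \<or> x = 2 \<or> x = 3" "y = 0 \<or> y = 1 \<or> y = 2 \<or> y = 3" using assms by auto
  then show ?thesis by (auto simp: pauli_def lessThan_two)
qed

lemma pauli_string_Suc_entry:
  assumes "a < 2 ^ Suc n" "b < 2 ^ Suc n"
  shows "pauli_string (Suc n) s $$ (a, b) = pauli_string n s $$ (a div 2, b div 2) * pauli (s n) $$ (a mod 2, b mod 2)"
proof -
  have "dim_row (pauli_string n s) = 2 ^ n" "dim_col (pauli_string n s) = 2 ^ n"
    using pauli_string_carrier[of n s] by auto
  moreover have "dim_row (pauli (s n)) = 2" "dim_col (pauli (s n)) = 2" by (auto simp: pauli_def)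
  ultimately show ?thesis using assms by (simp add: kron_def mult.commute)
qed

lemma pauli_string_cong: "(\<And>i. i < n \<Longrightarrow> s i = s' i) \<Longrightarrow> pauli_string n s = pauli_string n s'"
  by (induction n) auto

lemma sum_PiE_Suc:
  "(\<Sum>s\<in>({..<Suc n} \<rightarrow>\<^sub>E {..<k::nat}). f s) = (\<Sum>x<k. \<Sum>s\<in>({..<n} \<rightarrow>\<^sub>E {..<k}). f (s(n := x)))"
proof -
  have "{..<Suc n} \<rightarrow>\<^sub>E {..<k} = (\<lambda>(x, s). s(n := x)) ` ({..<k} \<times> ({..<n} \<rightarrow>\<^sub>E {..<k}))"
    by (simp add: lessThan_Suc PiE_insert_eq)
  moreover have "inj_on (\<lambda>(x, s). s(n := x)) ({..<k} \<times> ({..<n} \<rightarrow>\<^sub>E {..<k}))"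
    by (rule inj_combinator) simp
  ultimately show ?thesis
    by (simp add: sum.reindex sum.cartesian_product case_prod_unfold)
qed

lemma pauli_string_complete:
  assumes "a < 2 ^ n" "b < 2 ^ n" "c < 2 ^ n" "e < 2 ^ n"
  shows "(\<Sum>s\<in>({..<n} \<rightarrow>\<^sub>E {..<4}). pauli_string n s $$ (a, b) * pauli_string n s $$ (c, e)) = 2 ^ n * of_bool (a = e \<and> b = c)"
  using assms
proof (induction n arbitrary: a b c e)
  case 0
  then show ?case by simp
next
  case (Suc n)
  let ?S = "{..<n} \<rightarrow>\<^sub>E {..<4::nat}"
  have h: "x div 2 < 2 ^ n" "x mod 2 < 2" if "x < 2 ^ Suc n" for x :: nat using that by auto
  have upd: "pauli_string n (s(n := x)) = pauli_string n s" for s x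
    by (rule pauli_string_cong) auto
  have "(\<Sum>s\<in>({..<Suc n} \<rightarrow>\<^sub>E {..<4}). pauli_string (Suc n) s $$ (a, b) * pauli_string (Suc n) s $$ (c, e)) =
    (\<Sum>x<4. \<Sum>s\<in>?S. (pauli x $$ (a mod 2, b mod 2) * pauli x $$ (c mod 2, e mod 2)) *
       (pauli_string n s $$ (a div 2, b div 2) * pauli_string n s $$ (c div 2, e div 2)))"
    unfolding sum_PiE_Suc using Suc.prems
    by (simp only: pauli_string_Suc_entry upd fun_upd_same) (simp only: ac_simps)
  also have "\<dots> = (\<Sum>x<4. pauli x $$ (a mod 2, b mod 2) * pauli x $$ (c mod 2, e mod 2)) *
      (\<Sum>s\<in>?S. pauli_string n s $$ (a div 2, b div 2) * pauli_string n s $$ (c div 2, e div 2))"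
    by (simp only: sum_product)
  also have "\<dots> = (2 * of_bool (a mod 2 = e mod 2 \<and> b mod 2 = c mod 2)) * (2 ^ n * of_bool (a div 2 = e div 2 \<and> b div 2 = c div 2))"
    using Suc.prems h by (simp only: pauli_complete Suc.IH)
  also have "\<dots> = 2 ^ Suc n * of_bool (a = e \<and> b = c)"
  proof -
    have "(x div 2 = y div 2 \<and> x mod 2 = y mod 2) = (x = y)" for x y :: nat by (metis div_mult_mod_eq)
    then have "(a mod 2 = e mod 2 \<and> b mod 2 = c mod 2 \<and> a div 2 = e div 2 \<and> b div 2 = c div 2) = (a = e \<and> b = c)" by metis
    then show ?thesis by (auto simp: of_bool_def)
  qed
  finally show ?case .
qed

text \<open>Used twice: between two strings it shows that different labels give different matrices,
  and against the identity it shows tracelessness.\<close>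

lemma pauli_string_orth:
  assumes "s \<in> {..<n} \<rightarrow>\<^sub>E {..<4}" "s' \<in> {..<n} \<rightarrow>\<^sub>E {..<4}"
  shows "(\<Sum>a<2 ^ n. \<Sum>b<2 ^ n. pauli_string n s $$ (a, b) * pauli_string n s' $$ (b, a)) = 2 ^ n * of_bool (\<forall>i<n. s i = s' i)"
proof -
  have lt: "\<And>i. i < n \<Longrightarrow> s i < 4" "\<And>i. i < n \<Longrightarrow> s' i < 4" using assms by auto
  show ?thesis using lt
  proof (induction n)
    case (Suc n)
    have "(\<Sum>a<2 ^ Suc n. \<Sum>b<2 ^ Suc n. pauli_string (Suc n) s $$ (a, b) * pauli_string (Suc n) s' $$ (b, a))
      = (\<Sum>a<2 ^ Suc n. \<Sum>b<2 ^ Suc n. (pauli_string n s $$ (a div 2, b div 2) * pauli (s n) $$ (a mod 2, b mod 2)) *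
          (pauli_string n s' $$ (b div 2, a div 2) * pauli (s' n) $$ (b mod 2, a mod 2)))"
      by (intro sum.cong refl) (simp only: pauli_string_Suc_entry lessThan_iff)
    also have "\<dots> = (\<Sum>a<2 ^ n * 2. \<Sum>b<2 ^ n * 2. (pauli_string n s $$ (a div 2, b div 2) * pauli (s n) $$ (a mod 2, b mod 2)) *
          (pauli_string n s' $$ (b div 2, a div 2) * pauli (s' n) $$ (b mod 2, a mod 2)))"
      by (simp only: power_Suc mult.commute)
    also have "\<dots> = (\<Sum>a<2 ^ n. \<Sum>p<2. \<Sum>b<2 ^ n. \<Sum>q<2. (pauli_string n s $$ (a, b) * pauli_string n s' $$ (b, a)) *
          (pauli (s n) $$ (p, q) * pauli (s' n) $$ (q, p)))"
      unfolding sum_lessThan_mult by (intro sum.cong refl) simp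
    also have "\<dots> = (\<Sum>a<2 ^ n. \<Sum>b<2 ^ n. \<Sum>p<2. \<Sum>q<2. (pauli_string n s $$ (a, b) * pauli_string n s' $$ (b, a)) *
          (pauli (s n) $$ (p, q) * pauli (s' n) $$ (q, p)))"
      by (intro sum.cong refl sum.swap)
    also have "\<dots> = (\<Sum>a<2 ^ n. \<Sum>b<2 ^ n. pauli_string n s $$ (a, b) * pauli_string n s' $$ (b, a)) *
        (\<Sum>p<2. \<Sum>q<2. pauli (s n) $$ (p, q) * pauli (s' n) $$ (q, p))"
      by (simp only: sum_distrib_right) (simp only: sum_distrib_left)
    also have "\<dots> = (2 ^ n * of_bool (\<forall>i<n. s i = s' i)) * (2 * of_bool (s n = s' n))"
      using Suc by (simp add: pauli_orth)
    also have "\<dots> = 2 ^ Suc n * of_bool (\<forall>i<Suc n. s i = s' i)"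
      by (auto simp: less_Suc_eq)
    finally show ?case .
  qed simp
qed

lemma pauli_string_identity: "(\<And>i. i < n \<Longrightarrow> s i = 0) \<Longrightarrow> pauli_string n s = 1\<^sub>m (2 ^ n)"
proof (induction n)
  case (Suc n)
  have "kron (1\<^sub>m (2 ^ n)) (1\<^sub>m 2) = 1\<^sub>m (2 ^ Suc n)"
  proof (intro eq_matI)
    fix i j assume "i < dim_row (1\<^sub>m (2 ^ Suc n))" "j < dim_col (1\<^sub>m (2 ^ Suc n))"
    then have ij: "i < 2 ^ n * 2" "j < 2 ^ n * 2" by auto
    then have "i div 2 < 2 ^ n" "j div 2 < 2 ^ n" "i < 2 * 2 ^ n" "j < 2 * 2 ^ n" by auto
    moreover have "(i = j) = (i div 2 = j div 2 \<and> i mod 2 = j mod 2)" by (metis div_mult_mod_eq)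
    ultimately show "kron (1\<^sub>m (2 ^ n)) (1\<^sub>m 2) $$ (i, j) = 1\<^sub>m (2 ^ Suc n) $$ (i, j)"
      using ij by (simp add: kron_def)
  qed (auto simp: kron_def)
  then show ?case using Suc by (simp add: pauli_def)
qed simp

abbreviation pauli_index :: "nat \<Rightarrow> (nat \<Rightarrow> nat) set" where
  "pauli_index n \<equiv> {..<n} \<rightarrow>\<^sub>E {..<4}"

lemma inj_pauli_string: "inj_on (pauli_string n) (pauli_index n)"
proof (rule inj_onI)
  fix s s' assume s: "s \<in> pauli_index n" "s' \<in> pauli_index n" and eq: "pauli_string n s = pauli_string n s'"
  from pauli_string_orth[OF s(1) s(1)] pauli_string_orth[OF s, folded eq]
  have "(2 ^ n * of_bool (\<forall>i<n. s i = s' i) :: complex) = 2 ^ n" by simp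
  then have "\<forall>i<n. s i = s' i" by (auto simp: of_bool_def split: if_splits)
  then show "s = s'" using s by (intro PiE_ext) auto
qed

lemma zero_pauli_index: "restrict (\<lambda>_. 0) {..<n} \<in> pauli_index n" by auto

text \<open>The labelling is injective and the identity is one of the strings, so passing to
  \<open>Paulis n\<close> removes exactly one term.\<close>

lemma sum_Paulis:
  "(\<Sum>A\<in>Paulis n. f A) = (\<Sum>s\<in>pauli_index n. f (pauli_string n s)) - (f (1\<^sub>m (2 ^ n)) :: complex)"
proof -
  have fin: "finite (pauli_string n ` pauli_index n)" by (simp add: finite_PiE)
  have "1\<^sub>m (2 ^ n) = pauli_string n (restrict (\<lambda>_. 0) {..<n})"
    by (rule pauli_string_identity[symmetric]) auto
  then have "1\<^sub>m (2 ^ n) \<in> pauli_string n ` pauli_index n" using zero_pauli_index by blast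
  then show ?thesis
    unfolding Paulis_def using fin by (simp add: sum_diff1 sum.reindex[OF inj_pauli_string])
qed

lemma finite_Paulis: "finite (Paulis n)"
  by (simp add: Paulis_def finite_PiE)

lemma card_Paulis: "real (card (Paulis n)) = (2 ^ n)\<^sup>2 - 1"
proof -
  have "complex_of_real (real (card (Paulis n))) = of_nat (card (pauli_index n)) - 1"
    using sum_Paulis[where n = n and f = "\<lambda>_. 1"] by simp
  also have "card (pauli_index n) = 4 ^ n" by (simp add: card_PiE)
  also have "of_nat (4 ^ n) - 1 = complex_of_real ((2 ^ n)\<^sup>2 - 1)"
    by (simp add: power2_eq_square flip: power_mult_distrib)
  finally show ?thesis by (simp only: of_real_eq_iff)
qed

lemma Paulis_diagonalized: "A \<in> Paulis n \<Longrightarrow> \<exists>W d. diagonalized (2 ^ n) A W d"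
  unfolding Paulis_def using diagonalized_pauli_string by blast

lemma Paulis_traceless:
  assumes "A \<in> Paulis n" shows "(\<Sum>a<2 ^ n. A $$ (a, a)) = 0"
proof -
  let ?z = "restrict (\<lambda>_. 0) {..<n} :: nat \<Rightarrow> nat"
  obtain s where s: "s \<in> pauli_index n" "A = pauli_string n s" "A \<noteq> 1\<^sub>m (2 ^ n)"
    using assms by (auto simp: Paulis_def)
  have z: "pauli_string n ?z = 1\<^sub>m (2 ^ n)" by (rule pauli_string_identity) auto
  have ne: "\<not> (\<forall>i<n. s i = ?z i)" using s(3) pauli_string_identity[of n s] s(2) by auto
  have "(\<Sum>a<2 ^ n. A $$ (a, a)) = (\<Sum>a<2 ^ n. \<Sum>b<2 ^ n. if a = b then A $$ (a, b) else 0)"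
    by simp
  also have "\<dots> = (\<Sum>a<2 ^ n. \<Sum>b<2 ^ n. A $$ (a, b) * (1\<^sub>m (2 ^ n)) $$ (b, a))"
    by (intro sum.cong refl) auto
  also have "\<dots> = 0"
    using pauli_string_orth[OF s(1) zero_pauli_index] ne unfolding z s(2) by simp
  finally show ?thesis .
qed

section \<open>Functional calculus and the average over the angle\<close>

definition spectral_fun :: "nat \<Rightarrow> (nat \<Rightarrow> nat \<Rightarrow> complex) \<Rightarrow> (nat \<Rightarrow> complex) \<Rightarrow> nat \<Rightarrow> nat \<Rightarrow> complex" where
  "spectral_fun N W f a b = (\<Sum>c<N. W a c * f c * cnj (W b c))"

lemma mat_mul_spectral_fun:
  assumes "unitary_on N W"
  shows "mat_mul N (spectral_fun N W f) (spectral_fun N W g) a b = spectral_fun N W (\<lambda>c. f c * g c) a b"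
proof -
  have "mat_mul N (spectral_fun N W f) (spectral_fun N W g) a b = (\<Sum>e<N. \<Sum>c<N. \<Sum>c'<N. W a c * f c * (g c' * cnj (W b c')) * (cnj (W e c) * W e c'))"
    unfolding mat_mul_def spectral_fun_def sum_product by (intro sum.cong refl) (simp only: ac_simps)
  also have "\<dots> = (\<Sum>c<N. \<Sum>c'<N. \<Sum>e<N. W a c * f c * (g c' * cnj (W b c')) * (cnj (W e c) * W e c'))"
    by (subst sum.swap) (intro sum.cong refl sum.swap)
  also have "\<dots> = (\<Sum>c<N. \<Sum>c'<N. W a c * f c * (g c' * cnj (W b c')) * mat_mul N (adj W) W c c')"
    by (simp add: mat_mul_def adj_def sum_distrib_left)
  also have "\<dots> = (\<Sum>c<N. \<Sum>c'<N. if c = c' then W a c * f c * (g c' * cnj (W b c')) else 0)"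
    using assms by (intro sum.cong refl) (simp add: unitary_on_def)
  also have "\<dots> = spectral_fun N W (\<lambda>c. f c * g c) a b" by (simp add: spectral_fun_def mult.assoc)
  finally show ?thesis .
qed

text \<open>Powers are spectral functions as well, so every entry of the exponential series is a
  finite combination of scalar exponential series.\<close>

lemma mexp_diagonalized:
  assumes A: "diagonalized N A W d" and ab: "a < N" "b < N"
  shows "mexp (x \<cdot>\<^sub>m A) $$ (a, b) = spectral_fun N W (\<lambda>c. exp (x * of_real (d c))) a b"
proof -
  have car: "A \<in> carrier_mat N N" and U: "unitary_on N W" using A by (auto simp: diagonalized_def)
  have pow: "((x \<cdot>\<^sub>m A) ^\<^sub>m m) $$ (a, b) = spectral_fun N W (\<lambda>c. (x * of_real (d c)) ^ m) a b" if "a < N" "b < N" for a b m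
    using that
  proof (induction m arbitrary: a b)
    case 0
    have "mat_mul N W (adj W) a b = of_bool (a = b)" using 0 U by (simp add: unitary_on_def)
    then show ?case using 0 car by (simp add: spectral_fun_def mat_mul_def adj_def)
  next
    case (Suc m)
    have pc: "(x \<cdot>\<^sub>m A) ^\<^sub>m m \<in> carrier_mat N N" using car by (intro pow_carrier_mat) auto
    have xA: "(x \<cdot>\<^sub>m A) $$ (e, b) = spectral_fun N W (\<lambda>c. x * of_real (d c)) e b" if "e < N" for e
      using A car that Suc.prems by (simp add: diagonalized_def spectral_fun_def sum_distrib_left ac_simps)
    have "((x \<cdot>\<^sub>m A) ^\<^sub>m Suc m) $$ (a, b) = (\<Sum>e<N. ((x \<cdot>\<^sub>m A) ^\<^sub>m m) $$ (a, e) * (x \<cdot>\<^sub>m A) $$ (e, b))"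
      using car pc Suc.prems by (simp add: scalar_prod_def atLeast0LessThan)
    also have "\<dots> = mat_mul N (spectral_fun N W (\<lambda>c. (x * of_real (d c)) ^ m)) (spectral_fun N W (\<lambda>c. x * of_real (d c))) a b"
      unfolding mat_mul_def using Suc.prems by (intro sum.cong refl) (simp only: Suc.IH xA lessThan_iff)
    also have "\<dots> = spectral_fun N W (\<lambda>c. (x * of_real (d c)) ^ Suc m) a b"
      unfolding mat_mul_spectral_fun[OF U] by (simp add: mult.commute)
    finally show ?case .
  qed
  have "(\<lambda>m. spectral_fun N W (\<lambda>c. (x * of_real (d c)) ^ m) a b / of_nat (fact m)) sums spectral_fun N W (\<lambda>c. exp (x * of_real (d c))) a b"
  proof -
    have "(\<lambda>m. \<Sum>c<N. W a c * ((x * of_real (d c)) ^ m /\<^sub>R fact m) * cnj (W b c)) sums spectral_fun N W (\<lambda>c. exp (x * of_real (d c))) a b"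
      unfolding spectral_fun_def by (intro sums_sum sums_mult sums_mult2 exp_converges)
    then show ?thesis
      by (simp add: spectral_fun_def sum_divide_distrib scaleR_conv_of_real field_simps)
  qed
  from sums_unique[OF this] show ?thesis
    using ab car by (simp add: mexp_def pow)
qed

text \<open>Adding the two endpoints, a null set, gives the closed interval on which the fundamental
  theorem of calculus applies.\<close>

lemma integral_uniform_pi:
  fixes f :: "real \<Rightarrow> complex"
  assumes "continuous_on UNIV f"
  shows "integral\<^sup>L (uniform_measure lborel {-pi<..<pi}) f = integral\<^sup>L lborel (\<lambda>x. indicator {-pi..pi} x *\<^sub>R f x) / of_real (2 * pi)"
proof -
  have [measurable]: "f \<in> borel_measurable borel" using assms by (rule borel_measurable_continuous_onI)
  have "uniform_measure lborel {-pi<..<pi} = density lborel (\<lambda>x. ennreal (indicator {-pi<..<pi} x / (2 * pi)))"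
    unfolding uniform_measure_def
    by (intro density_cong) (auto simp: divide_ennreal ennreal_1[symmetric] simp del: ennreal_1 split: split_indicator)
  then have "integral\<^sup>L (uniform_measure lborel {-pi<..<pi}) f = integral\<^sup>L lborel (\<lambda>x. (indicator {-pi<..<pi} x / (2 * pi)) *\<^sub>R f x)"
    by (simp add: integral_density)
  also have "\<dots> = integral\<^sup>L lborel (\<lambda>x. (indicator {-pi..pi} x *\<^sub>R f x) / of_real (2 * pi))"
  proof (intro integral_cong_AE)
    have "AE x in lborel. x \<noteq> pi" "AE x in lborel. x \<noteq> - pi"
      by (rule AE_lborel_singleton)+
    then show "AE x in lborel. (indicator {-pi<..<pi} x / (2 * pi)) *\<^sub>R f x = (indicator {-pi..pi} x *\<^sub>R f x) / of_real (2 * pi)"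
      by eventually_elim (auto split: split_indicator simp: scaleR_conv_of_real)
  qed auto
  finally show ?thesis by simp
qed

lemma prob_space_uniform_pi: "prob_space (uniform_measure lborel {-pi<..<pi})"
  by (rule prob_space_uniform_measure) auto

text \<open>The angle runs through a full period, so a nonzero integer frequency has a primitive
  with equal values at both ends.\<close>

lemma integral_uniform_exp:
  assumes "m \<in> \<int>"
  shows "integral\<^sup>L (uniform_measure lborel {-pi<..<pi}) (\<lambda>\<theta>. exp (\<i> * of_real (\<theta> * m))) = of_bool (m = 0)"
proof (cases "m = 0")
  case True
  interpret prob_space "uniform_measure lborel {-pi<..<pi}" by (rule prob_space_uniform_pi)
  show ?thesis using True prob_space by simp
next
  case False
  obtain k where k: "m = of_int k" using assms by (elim Ints_cases)
  let ?F = "\<lambda>\<theta>::real. exp (\<i> * of_real (\<theta> * m)) / (\<i> * of_real m)"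
  have "integral\<^sup>L lborel (\<lambda>\<theta>. indicator {-pi..pi} \<theta> *\<^sub>R exp (\<i> * of_real (\<theta> * m))) = ?F pi - ?F (- pi)"
  proof (rule integral_FTC_atLeastAtMost)
    show "(?F has_vector_derivative exp (\<i> * of_real (\<theta> * m))) (at \<theta> within {-pi..pi})" for \<theta>
      using False by (auto intro!: derivative_eq_intros has_vector_derivative_real_field simp: mult.commute[of _ \<i>])
  qed (auto intro!: continuous_intros)
  also have "\<dots> = (exp (\<i> * of_real (pi * m)) - exp (\<i> * of_real (- pi * m))) / (\<i> * of_real m)"
    by (simp add: diff_divide_distrib)
  also have "exp (\<i> * of_real (pi * m)) = exp (\<i> * of_real (- pi * m))"
    by (subst exp_eq) (auto intro!: exI[of _ k] simp: k)
  finally show ?thesis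
    using False by (subst integral_uniform_pi) (auto intro!: continuous_intros)
qed

section \<open>Identification of the channel with the averaged pinching\<close>

locale pauli_channel =
  fixes n :: nat and W :: "complex mat \<Rightarrow> nat \<Rightarrow> nat \<Rightarrow> complex" and d :: "complex mat \<Rightarrow> nat \<Rightarrow> real"
  assumes n_pos: "1 \<le> n" and diagonalized: "A \<in> Paulis n \<Longrightarrow> diagonalized (2 ^ n) A (W A) (d A)"

sublocale pauli_channel \<subseteq> pauli_frame "2 ^ n" "Paulis n" W d entry
proof
  show "2 \<le> (2::nat) ^ n" using n_pos self_le_power[of 2 n] by auto
  show "real (card (Paulis n)) = (real (2 ^ n))\<^sup>2 - 1" by (simp add: card_Paulis)
  show "(\<Sum>A\<in>Paulis n. entry A a b * entry A c e) = of_nat (2 ^ n) * of_bool (a = e \<and> b = c) - of_bool (a = b \<and> c = e)"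
    if "a < 2 ^ n" "b < 2 ^ n" "c < 2 ^ n" "e < 2 ^ n" for a b c e
    unfolding sum_Paulis using that by (simp add: entry_def pauli_string_complete)
qed (use diagonalized in \<open>auto simp: diagonalized_def entry_def finite_Paulis\<close>)

lemma conj_by_diag:
  assumes D: "\<And>a b. a < N \<Longrightarrow> b < N \<Longrightarrow> D a b = (if a = b then f a else 0)"
    and uv: "u \<in> words N t" "v \<in> words N t"
  shows "conj_by N t D X u v = prod_list (map f u) * X u v * cnj (prod_list (map f v))"
proof -
  have tensor_pow: "tensor_pow D x y = (if x = y then prod_list (map f x) else 0)" if "x \<in> words N t" "y \<in> words N t" for x y
    using that
  proof (induction t arbitrary: x y)
    case (Suc t)
    then obtain a u' b v' where "x = a # u'" "u' \<in> words N t" "a < N" "y = b # v'" "v' \<in> words N t" "b < N"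
      by (elim words_SucE) auto
    then show ?case using Suc.IH D by simp
  qed simp
  have "conj_by N t D X u v = (\<Sum>x\<in>words N t. if u = x then \<Sum>y\<in>words N t. if v = y then
      prod_list (map f u) * X x y * cnj (prod_list (map f v)) else 0 else 0)"
    unfolding conj_by_def using uv
    by (intro sum.cong refl) (auto simp: tensor_pow if_distrib[where f = cnj] if_distrib[where f = "(*) _"] cong: if_cong)
  also have "\<dots> = prod_list (map f u) * X u v * cnj (prod_list (map f v))" using uv by simp
  finally show ?thesis .
qed

lemma conj_by_spectral_fun:
  assumes uv: "u \<in> words N t" "v \<in> words N t"
  shows "conj_by N t (spectral_fun N W f) X u v =
    conj_by N t W (\<lambda>x y. prod_list (map f x) * conj_by N t (adj W) X x y * cnj (prod_list (map f y))) u v"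
proof -
  define D where "D a b = (if a = b then f a else 0)" for a b :: nat
  have "conj_by N t (spectral_fun N W f) X u v = conj_by N t (mat_mul N W (mat_mul N D (adj W))) X u v"
  proof (rule conj_by_mat_cong[OF _ uv])
    fix a b assume "a < N" "b < N"
    have "mat_mul N D (adj W) c b = f c * cnj (W b c)" if "c < N" for c
    proof -
      have "mat_mul N D (adj W) c b = (\<Sum>e<N. if c = e then f c * cnj (W b e) else 0)"
        unfolding mat_mul_def D_def adj_def by (intro sum.cong) auto
      then show ?thesis using that by simp
    qed
    then show "spectral_fun N W f a b = mat_mul N W (mat_mul N D (adj W)) a b"
      by (simp add: mat_mul_def[of N W] spectral_fun_def mult.assoc)
  qed
  also have "\<dots> = conj_by N t W (conj_by N t (mat_mul N D (adj W)) X) u v"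
    by (rule conj_by_mat_mul[OF uv, symmetric])
  also have "\<dots> = conj_by N t W (\<lambda>x y. prod_list (map f x) * conj_by N t (adj W) X x y * cnj (prod_list (map f y))) u v"
  proof (rule conj_by_cong)
    fix x y assume xy: "x \<in> words N t" "y \<in> words N t"
    have "conj_by N t (mat_mul N D (adj W)) X x y = conj_by N t D (conj_by N t (adj W) X) x y"
      by (rule conj_by_mat_mul[OF xy, symmetric])
    also have "\<dots> = prod_list (map f x) * conj_by N t (adj W) X x y * cnj (prod_list (map f y))"
      by (rule conj_by_diag[OF _ xy]) (simp add: D_def)
    finally show "conj_by N t (mat_mul N D (adj W)) X x y = prod_list (map f x) * conj_by N t (adj W) X x y * cnj (prod_list (map f y))" .
  qed
  finally show ?thesis .
qed

context pauli_channel begin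

abbreviation N where "N \<equiv> (2::nat) ^ n"

definition rotation :: "complex mat \<Rightarrow> real \<Rightarrow> complex mat" where
  "rotation A \<theta> = mexp ((\<i> * complex_of_real (\<theta> / 2)) \<cdot>\<^sub>m A)"

lemma Paulis_carrier: "A \<in> Paulis n \<Longrightarrow> A \<in> carrier_mat N N"
  using diagonalized by (auto simp: diagonalized_def)

lemma mexp_smult_carrier: "A \<in> Paulis n \<Longrightarrow> mexp (x \<cdot>\<^sub>m A) \<in> carrier_mat N N"
  unfolding mexp_def by (rule carrier_matI) (auto dest: Paulis_carrier)

lemma rotation_carrier: "A \<in> Paulis n \<Longrightarrow> rotation A \<theta> \<in> carrier_mat N N"
  unfolding rotation_def by (rule mexp_smult_carrier)

lemma rotation_entry:
  assumes "A \<in> Paulis n" "a < N" "b < N"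
  shows "entry (rotation A \<theta>) a b = spectral_fun N (W A) (\<lambda>c. exp (\<i> * of_real (\<theta> / 2) * of_real (d A c))) a b"
  unfolding entry_def rotation_def by (rule mexp_diagonalized[OF diagonalized]) fact+

lemma rotation_adjoint:
  assumes "A \<in> Paulis n" "a < N" "b < N"
  shows "mexp ((- \<i> * complex_of_real (\<theta> / 2)) \<cdot>\<^sub>m A) $$ (a, b) = cnj (rotation A \<theta> $$ (b, a))"
proof -
  have "cnj (rotation A \<theta> $$ (b, a)) = cnj (spectral_fun N (W A) (\<lambda>c. exp (\<i> * of_real (\<theta> / 2) * of_real (d A c))) b a)"
    using rotation_entry[OF assms(1,3,2)] by (simp add: entry_def)
  also have "\<dots> = spectral_fun N (W A) (\<lambda>c. exp (- \<i> * of_real (\<theta> / 2) * of_real (d A c))) a b"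
    by (simp add: spectral_fun_def cnj_sum exp_cnj ac_simps)
  also have "\<dots> = mexp ((- \<i> * complex_of_real (\<theta> / 2)) \<cdot>\<^sub>m A) $$ (a, b)"
    by (rule mexp_diagonalized[OF diagonalized, symmetric]) fact+
  finally show ?thesis by simp
qed

text \<open>A word of length \<open>t\<close> with \<open>r\<close> negative signs has weight
  \<open>t - 2 r\<close>. Weights of words of equal length therefore differ by even integers, which
  makes up for the half angle in the rotation.\<close>

lemma half_weight_diff_Ints:
  assumes "A \<in> Paulis n" "u \<in> words N t" "v \<in> words N t"
  shows "(weight A u - weight A v) / 2 \<in> \<int>"
proof -
  have *: "(real t - weight A u) / 2 \<in> \<int>" if "u \<in> words N t" for u t
    using that
  proof (induction t arbitrary: u)
    case (Suc t)
    then obtain a u' where u: "u = a # u'" "a < N" "u' \<in> words N t" by (elim words_SucE)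
    have "(1 - d A a) / 2 \<in> \<int>" using sign[OF assms(1) u(2)] by auto
    then have "(1 - d A a) / 2 + (real t - weight A u') / 2 \<in> \<int>" using Suc.IH[OF u(3)] by (rule Ints_add)
    moreover have "(real (Suc t) - weight A u) / 2 = (1 - d A a) / 2 + (real t - weight A u') / 2"
      by (simp add: u(1) weight_def diff_divide_distrib add_divide_distrib)
    ultimately show ?case by (simp only:)
  qed (simp add: weight_def)
  have "(real t - weight A v) / 2 - (real t - weight A u) / 2 \<in> \<int>"
    by (intro Ints_diff * assms)
  moreover have "(weight A u - weight A v) / 2 = (real t - weight A v) / 2 - (real t - weight A u) / 2"
    by (simp add: diff_divide_distrib)
  ultimately show ?thesis by (simp only:)
qed

lemma conj_by_rotation:
  assumes A: "A \<in> Paulis n" and uv: "u \<in> words N t" "v \<in> words N t"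
  shows "conj_by N t (entry (rotation A \<theta>)) X u v =
    conj_by N t (W A) (\<lambda>x y. exp (\<i> * of_real (\<theta> * ((weight A x - weight A y) / 2))) * eigenframe A t X x y) u v"
proof -
  let ?f = "\<lambda>c. exp (\<i> * of_real (\<theta> / 2) * of_real (d A c))"
  have p: "prod_list (map ?f x) = exp (\<i> * of_real (\<theta> / 2 * weight A x))" for x
    by (induction x) (auto simp: weight_def algebra_simps simp flip: exp_add)
  have "conj_by N t (entry (rotation A \<theta>)) X u v = conj_by N t (spectral_fun N (W A) ?f) X u v"
    by (rule conj_by_mat_cong[OF rotation_entry[OF A] uv])
  also have "\<dots> = conj_by N t (W A) (\<lambda>x y. prod_list (map ?f x) * conj_by N t (adj (W A)) X x y * cnj (prod_list (map ?f y))) u v"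
    by (rule conj_by_spectral_fun[OF uv])
  also have "\<dots> = conj_by N t (W A) (\<lambda>x y. exp (\<i> * of_real (\<theta> * ((weight A x - weight A y) / 2))) * eigenframe A t X x y) u v"
  proof (rule conj_by_cong)
    fix x y
    have ac: "a * z * b = (a * b) * z" for a b z :: complex by simp
    have phase: "prod_list (map ?f x) * cnj (prod_list (map ?f y)) = exp (\<i> * of_real (\<theta> * ((weight A x - weight A y) / 2)))"
      unfolding p exp_cnj by (simp add: exp_add[symmetric] field_simps)
    show "prod_list (map ?f x) * conj_by N t (adj (W A)) X x y * cnj (prod_list (map ?f y)) =
        exp (\<i> * of_real (\<theta> * ((weight A x - weight A y) / 2))) * eigenframe A t X x y"
      unfolding eigenframe_def by (rule trans[OF ac arg_cong[where f = "\<lambda>z. z * conj_by N t (adj (W A)) X x y", OF phase]])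
  qed
  finally show ?thesis .
qed

lemma pinch_eq_integral:
  assumes A: "A \<in> Paulis n" and uv: "u \<in> words N t" "v \<in> words N t"
  shows "integral\<^sup>L (uniform_measure lborel {-pi<..<pi}) (\<lambda>\<theta>. conj_by N t (entry (rotation A \<theta>)) X u v) = pinch A t X u v"
proof -
  let ?M = "uniform_measure lborel {-pi<..<pi}"
  let ?w = "words N t"
  interpret U: prob_space ?M by (rule prob_space_uniform_pi)
  let ?e = "\<lambda>x y \<theta>. exp (\<i> * of_real (\<theta> * ((weight A x - weight A y) / 2)))"
  have int: "integrable ?M (?e x y)" for x y
    by (rule U.integrable_const_bound[of _ 1]) (auto intro!: AE_I2 borel_measurable_continuous_onI continuous_intros)
  have "integral\<^sup>L ?M (\<lambda>\<theta>. conj_by N t (entry (rotation A \<theta>)) X u v)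
    = integral\<^sup>L ?M (\<lambda>\<theta>. \<Sum>x\<in>?w. \<Sum>y\<in>?w. ?e x y \<theta> * (tensor_pow (W A) u x * eigenframe A t X x y * cnj (tensor_pow (W A) v y)))"
    unfolding conj_by_rotation[OF A uv] unfolding conj_by_def by (simp only: ac_simps)
  also have "\<dots> = (\<Sum>x\<in>?w. \<Sum>y\<in>?w. integral\<^sup>L ?M (?e x y) * (tensor_pow (W A) u x * eigenframe A t X x y * cnj (tensor_pow (W A) v y)))"
    using int by (subst Bochner_Integration.integral_sum | simp)+
  also have "\<dots> = (\<Sum>x\<in>?w. \<Sum>y\<in>?w. of_bool (weight A x = weight A y) * (tensor_pow (W A) u x * eigenframe A t X x y * cnj (tensor_pow (W A) v y)))"
  proof (intro sum.cong refl arg_cong2[where f = "(*)"])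
    fix x y assume "x \<in> ?w" "y \<in> ?w"
    from integral_uniform_exp[OF half_weight_diff_Ints[OF A this]]
    show "integral\<^sup>L ?M (?e x y) = of_bool (weight A x = weight A y)" by simp
  qed
  also have "\<dots> = pinch A t X u v"
    unfolding pinch_def conj_by_def by (simp add: ac_simps)
  finally show ?thesis .
qed

lemma chan_carrier: "chan n t \<eta> \<in> carrier_mat (N ^ t) (N ^ t)"
  by (simp add: chan_def)

lemma kernel_of_chan:
  assumes \<eta>: "\<eta> \<in> carrier_mat (N ^ t) (N ^ t)" and uv: "u \<in> words N t" "v \<in> words N t"
  shows "kernel_of N (chan n t \<eta>) u v = twirl t (kernel_of N \<eta>) u v"
proof -
  have "kernel_of N (chan n t \<eta>) u v = (1 / of_nat (card (Paulis n))) * (\<Sum>A\<in>Paulis n.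
      integral\<^sup>L (uniform_measure lborel {-pi<..<pi}) (\<lambda>\<theta>.
        kernel_of N (kron_pow t (rotation A \<theta>) * \<eta> * kron_pow t (mexp ((- \<i> * complex_of_real (\<theta> / 2)) \<cdot>\<^sub>m A))) u v))"
    using encode_less[OF uv(1)] encode_less[OF uv(2)] by (simp add: kernel_of_def chan_def rotation_def)
  also have "\<dots> = (1 / of_nat (card (Paulis n))) * (\<Sum>A\<in>Paulis n.
      integral\<^sup>L (uniform_measure lborel {-pi<..<pi}) (\<lambda>\<theta>. conj_by N t (entry (rotation A \<theta>)) (kernel_of N \<eta>) u v))"
  proof (intro arg_cong2[where f = "(*)"] sum.cong refl Bochner_Integration.integral_cong)
    fix A \<theta> assume A: "A \<in> Paulis n"
    have "mexp ((- \<i> * complex_of_real (\<theta> / 2)) \<cdot>\<^sub>m A) \<in> carrier_mat N N"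
      by (rule mexp_smult_carrier[OF A])
    then show "kernel_of N (kron_pow t (rotation A \<theta>) * \<eta> * kron_pow t (mexp ((- \<i> * complex_of_real (\<theta> / 2)) \<cdot>\<^sub>m A))) u v =
        conj_by N t (entry (rotation A \<theta>)) (kernel_of N \<eta>) u v"
      using rotation_adjoint[OF A] by (intro conj_by_eq_kernel_of rotation_carrier A \<eta> uv) auto
  qed
  also have "\<dots> = twirl t (kernel_of N \<eta>) u v"
    by (simp add: twirl_def pinch_eq_integral uv)
  finally show ?thesis .
qed

lemma chan_pow_carrier: "\<eta> \<in> carrier_mat (N ^ t) (N ^ t) \<Longrightarrow> (chan n t ^^ k) \<eta> \<in> carrier_mat (N ^ t) (N ^ t)"
  by (cases k) (auto intro: chan_carrier)

lemma kernel_of_chan_pow: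
  assumes \<eta>: "\<eta> \<in> carrier_mat (N ^ t) (N ^ t)" and uv: "u \<in> words N t" "v \<in> words N t"
  shows "kernel_of N ((chan n t ^^ k) \<eta>) u v = (twirl t ^^ k) (kernel_of N \<eta>) u v"
  using uv
proof (induction k arbitrary: u v)
  case (Suc k)
  have "kernel_of N ((chan n t ^^ Suc k) \<eta>) u v = twirl t (kernel_of N ((chan n t ^^ k) \<eta>)) u v"
    using Suc.prems by (simp add: kernel_of_chan chan_pow_carrier[OF \<eta>])
  also have "\<dots> = twirl t ((twirl t ^^ k) (kernel_of N \<eta>)) u v" by (intro twirl_cong Suc.IH)
  finally show ?case by simp
qed simp

text \<open>The determinant is the exponential of a multiple of the sum of the eigenvalues. That sum
  is the trace of a nontrivial Pauli string and vanishes. This matters because the Haar measure is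
  invariant under matrices of determinant one only by assumption.\<close>

lemma rotation_SU:
  assumes A: "A \<in> Paulis n" shows "rotation A \<theta> \<in> SU N"
proof -
  define f where "f = (\<lambda>c. exp (\<i> * of_real (\<theta> / 2) * of_real (d A c)))"
  let ?R = "rotation A \<theta>" and ?W = "mat N N (\<lambda>(a, b). W A a b)" and ?D = "mat N N (\<lambda>(a, b). if a = b then f a else 0)"
  have U: "unitary_on N (W A)" by (rule unit_W[OF A])
  have R: "?R \<in> carrier_mat N N" by (rule rotation_carrier[OF A])
  have entry: "entry ?R a b = spectral_fun N (W A) f a b" if "a < N" "b < N" for a b
    using rotation_entry[OF A that] by (simp only: f_def)
  have ff: "f c * cnj (f c) = 1" for c
    unfolding f_def by (simp add: exp_cnj flip: exp_add)
  have WW: "(\<Sum>c<N. W A a c * cnj (W A b c)) = of_bool (a = b)" if "a < N" "b < N" for a b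
    using U that by (simp add: unitary_on_def mat_mul_def adj_def)
  have WW': "(\<Sum>a<N. cnj (W A a c) * W A a e) = of_bool (c = e)" if "c < N" "e < N" for c e
    using U that by (simp add: unitary_on_def mat_mul_def adj_def)
  have "?R * dag ?R = 1\<^sub>m N"
  proof (intro eq_matI)
    fix a b assume "a < dim_row (1\<^sub>m N)" "b < dim_col (1\<^sub>m N)"
    then have ab: "a < N" "b < N" by auto
    have "(?R * dag ?R) $$ (a, b) = (\<Sum>e<N. entry ?R a e * cnj (entry ?R b e))"
      using R ab by (simp add: dag_def scalar_prod_def atLeast0LessThan entry_def)
    also have "\<dots> = (\<Sum>e<N. spectral_fun N (W A) f a e * spectral_fun N (W A) (\<lambda>c. cnj (f c)) e b)"
      using ab by (intro sum.cong refl) (simp add: entry spectral_fun_def cnj_sum ac_simps)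
    also have "\<dots> = spectral_fun N (W A) (\<lambda>c. f c * cnj (f c)) a b"
      using mat_mul_spectral_fun[OF U] by (simp add: mat_mul_def)
    also have "\<dots> = 1\<^sub>m N $$ (a, b)" unfolding ff using ab by (simp add: spectral_fun_def WW)
    finally show "(?R * dag ?R) $$ (a, b) = 1\<^sub>m N $$ (a, b)" .
  qed (use R in \<open>auto simp: dag_def\<close>)
  moreover have "det ?R = 1"
  proof -
    have W: "?W \<in> carrier_mat N N" "?D \<in> carrier_mat N N" "dag ?W \<in> carrier_mat N N" by (auto simp: dag_def)
    have "?R = ?W * (?D * dag ?W)"
    proof (intro eq_matI)
      fix a b assume "a < dim_row (?W * (?D * dag ?W))" "b < dim_col (?W * (?D * dag ?W))"
      then have ab: "a < N" "b < N" by (auto simp: dag_def)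
      have "(?D * dag ?W) $$ (c, b) = f c * cnj (W A b c)" if "c < N" for c
      proof -
        have "(?D * dag ?W) $$ (c, b) = (\<Sum>e<N. (if c = e then f c else 0) * cnj (W A b e))"
          using that ab by (simp add: dag_def scalar_prod_def atLeast0LessThan)
        also have "\<dots> = (\<Sum>e<N. if c = e then f c * cnj (W A b e) else 0)"
          by (intro sum.cong refl) auto
        finally show ?thesis using that by simp
      qed
      then have "(?W * (?D * dag ?W)) $$ (a, b) = spectral_fun N (W A) f a b"
        using ab by (simp add: scalar_prod_def atLeast0LessThan spectral_fun_def mult.assoc dag_def[of ?W])
      then show "?R $$ (a, b) = (?W * (?D * dag ?W)) $$ (a, b)"
        using entry[OF ab] by (simp add: entry_def)
    qed (use R in \<open>auto simp: dag_def\<close>)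
    then have "det ?R = det ?W * (det ?D * det (dag ?W))"
      by (simp only: det_mult[OF W(1) mult_carrier_mat[OF W(2,3)]] det_mult[OF W(2,3)])
    also have "\<dots> = det ?D * (det ?W * det (dag ?W))" by (simp only: ac_simps)
    also have "det ?W * det (dag ?W) = det (?W * dag ?W)" by (rule det_mult[OF W(1,3), symmetric])
    also have "?W * dag ?W = 1\<^sub>m N"
      by (intro eq_matI) (auto simp: dag_def scalar_prod_def atLeast0LessThan WW)
    also have "det ?D = prod_list (diag_mat ?D)"
      by (rule det_upper_triangular[of _ N]) auto
    also have "diag_mat ?D = map f [0..<N]"
      by (auto simp: diag_mat_def)
    also have "prod_list (map f [0..<N]) = (\<Prod>c<N. f c)"
      by (simp add: prod.list_conv_set_nth atLeast0LessThan)
    also have "\<dots> = exp (\<i> * of_real (\<theta> / 2) * of_real (\<Sum>c<N. d A c))"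
      by (simp add: f_def exp_sum sum_distrib_left)
    also have "(\<Sum>c<N. d A c) = 0"
    proof -
      have "0 = (\<Sum>a<N. A $$ (a, a))" using Paulis_traceless[OF A] by simp
      also have "\<dots> = (\<Sum>a<N. \<Sum>c<N. W A a c * of_real (d A c) * cnj (W A a c))"
        using diagonalized[OF A] by (simp add: diagonalized_def)
      also have "\<dots> = (\<Sum>c<N. of_real (d A c) * (\<Sum>a<N. cnj (W A a c) * W A a c))"
        by (subst sum.swap) (simp add: sum_distrib_left ac_simps)
      also have "\<dots> = of_real (\<Sum>c<N. d A c)" by (simp add: WW')
      finally show ?thesis by (metis of_real_eq_0_iff)
    qed
    finally show ?thesis by simp
  qed
  ultimately show ?thesis using R by (simp add: SU_def)
qed

end

section \<open>The Haar average\<close>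

definition amplitude :: "(nat \<Rightarrow> complex) \<Rightarrow> nat list \<Rightarrow> complex" where
  "amplitude p u = prod_list (map p u)"

text \<open>Kernel of the \<open>t\<close>-fold tensor power of the rank-one matrix with vector
  \<open>p\<close>.\<close>

definition pure_kernel :: "(nat \<Rightarrow> complex) \<Rightarrow> nat list \<Rightarrow> nat list \<Rightarrow> complex" where
  "pure_kernel p u v = amplitude p u * cnj (amplitude p v)"

lemma amplitude_simps [simp]: "amplitude p [] = 1" "amplitude p (a # u) = p a * amplitude p u"
  by (simp_all add: amplitude_def)

lemma amplitude_tensor_act: "u \<in> words N t \<Longrightarrow> amplitude (\<lambda>a. \<Sum>b<N. A a b * p b) u = tensor_act N t A (amplitude p) u"
proof (induction t arbitrary: u)
  case (Suc t)
  then obtain a u' where u: "u = a # u'" "a < N" "u' \<in> words N t" by (elim words_SucE)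
  have "tensor_act N (Suc t) A (amplitude p) u = (\<Sum>b<N. A a b * (p b * tensor_act N t A (amplitude p) u'))"
    by (simp add: u(1) tensor_act_Cons tensor_act_scale)
  then show ?case
    using Suc.IH[OF u(3)] by (simp add: u(1) sum_distrib_right mult.assoc)
qed simp

lemma conj_by_pure_kernel:
  assumes "u \<in> words N t" "v \<in> words N t"
  shows "conj_by N t A (pure_kernel p) u v = pure_kernel (\<lambda>a. \<Sum>b<N. A a b * p b) u v"
  unfolding pure_kernel_def conj_by_def amplitude_tensor_act[OF assms(1)] amplitude_tensor_act[OF assms(2)]
  by (simp add: tensor_act_def sum_product ac_simps)

lemma amplitude_mset: "mset u = mset v \<Longrightarrow> amplitude p u = amplitude p v"
  unfolding amplitude_def by (metis mset_map prod_mset_prod_list)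

lemma sum_amplitude: "(\<Sum>u\<in>words N t. (cmod (amplitude p u))\<^sup>2) = (\<Sum>a<N. (cmod (p a))\<^sup>2) ^ t"
proof (induction t)
  case (Suc t)
  have "(\<Sum>u\<in>words N (Suc t). (cmod (amplitude p u))\<^sup>2) = (\<Sum>a<N. \<Sum>u\<in>words N t. (cmod (p a))\<^sup>2 * (cmod (amplitude p u))\<^sup>2)"
    by (simp add: sum_words_Suc norm_mult power_mult_distrib)
  then show ?case by (simp add: sum_product[symmetric] Suc)
qed simp

lemma hs_norm_sq_pure_kernel: "hs_norm_sq N t (pure_kernel p) = ((\<Sum>a<N. (cmod (p a))\<^sup>2) ^ t)\<^sup>2"
proof -
  have "hs_norm_sq N t (pure_kernel p) = (\<Sum>u\<in>words N t. (cmod (amplitude p u))\<^sup>2) * (\<Sum>u\<in>words N t. (cmod (amplitude p u))\<^sup>2)"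
    unfolding sum_product by (simp add: hs_norm_sq_def pure_kernel_def norm_mult power_mult_distrib)
  then show ?thesis by (simp only: sum_amplitude power2_eq_square[of "_ ^ t"])
qed

lemma integral_double_sum:
  fixes f :: "'a \<Rightarrow> 'b \<Rightarrow> 'c \<Rightarrow> complex"
  assumes "\<And>x y. x \<in> A \<Longrightarrow> y \<in> B \<Longrightarrow> integrable M (f x y)"
  shows "integral\<^sup>L M (\<lambda>w. \<Sum>x\<in>A. \<Sum>y\<in>B. c x y * f x y w) = (\<Sum>x\<in>A. \<Sum>y\<in>B. c x y * integral\<^sup>L M (f x y))"
proof -
  have "integral\<^sup>L M (\<lambda>w. \<Sum>x\<in>A. \<Sum>y\<in>B. c x y * f x y w) = (\<Sum>x\<in>A. integral\<^sup>L M (\<lambda>w. \<Sum>y\<in>B. c x y * f x y w))"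
    using assms by (intro Bochner_Integration.integral_sum Bochner_Integration.integrable_sum integrable_mult_right) auto
  also have "\<dots> = (\<Sum>x\<in>A. \<Sum>y\<in>B. integral\<^sup>L M (\<lambda>w. c x y * f x y w))"
    using assms by (intro sum.cong refl Bochner_Integration.integral_sum integrable_mult_right) auto
  finally show ?thesis by simp
qed

lemma full_tr_pure_kernel: "full_tr N t (pure_kernel p) = of_real ((\<Sum>a<N. (cmod (p a))\<^sup>2) ^ t)"
  by (simp add: full_tr_def pure_kernel_def complex_norm_square flip: sum_amplitude of_real_power)

lemma full_tr_conj_by: "unitary_on N A \<Longrightarrow> full_tr N t (conj_by N t A X) = full_tr N t X"
proof (induction t arbitrary: X)
  case (Suc t)
  have "full_tr N (Suc t) (conj_by N (Suc t) A X) = full_tr N t (partial_tr N (conj_by N (Suc t) A X))" by (rule full_tr_partial_tr[symmetric])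
  also have "\<dots> = full_tr N t (conj_by N t A (partial_tr N X))" by (simp add: full_tr_def partial_tr_conj_by[OF Suc.prems])
  finally show ?case using Suc by (simp add: full_tr_partial_tr)
qed (simp add: full_tr_def conj_by_def)

lemma SU_unitary_on:
  assumes "U \<in> SU N" shows "unitary_on N (entry U)"
proof -
  have U: "U \<in> carrier_mat N N" "U * dag U = 1\<^sub>m N" using assms by (auto simp: SU_def)
  have dU: "dag U \<in> carrier_mat N N" using U by (auto simp: dag_def)
  have l: "dag U * U = 1\<^sub>m N" using mat_mult_left_right_inverse[OF U(1) dU U(2)] .
  have "mat_mul N (adj (entry U)) (entry U) a b = (dag U * U) $$ (a, b)" "mat_mul N (entry U) (adj (entry U)) a b = (U * dag U) $$ (a, b)"
    if "a < N" "b < N" for a b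
    using U(1) that by (auto simp: mat_mul_def adj_def entry_def dag_def scalar_prod_def atLeast0LessThan)
  then show ?thesis unfolding unitary_on_def l U(2) by auto
qed

locale haar_state_frame =
  fixes N t :: nat and \<mu> :: "(nat \<times> nat \<Rightarrow> complex) measure" and \<alpha> :: "complex vec"
  assumes haar: "is_haar_SU N \<mu>" and \<alpha>: "\<alpha> \<in> carrier_vec N" and unit: "(\<Sum>i<N. (cmod (\<alpha> $ i))\<^sup>2) = 1"
begin

definition state_amp :: "(nat \<times> nat \<Rightarrow> complex) \<Rightarrow> nat \<Rightarrow> complex" where
  "state_amp f a = (\<Sum>b<N. f (a, b) * \<alpha> $ b)"

definition S :: "nat list \<Rightarrow> nat list \<Rightarrow> complex" where
  "S u v = integral\<^sup>L \<mu> (\<lambda>f. pure_kernel (state_amp f) u v)"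

abbreviation initial_kernel :: "nat list \<Rightarrow> nat list \<Rightarrow> complex" where
  "initial_kernel \<equiv> pure_kernel (\<lambda>a. \<alpha> $ a)"

sublocale prob_space \<mu> using haar by (simp add: is_haar_SU_def)

lemma sets_mu: "sets \<mu> = sets (matspace N)"
  using haar by (simp add: is_haar_SU_def)

lemma measurable_entry: "a < N \<Longrightarrow> b < N \<Longrightarrow> (\<lambda>f. f (a, b)) \<in> borel_measurable \<mu>"
  unfolding measurable_cong_sets[OF sets_mu refl] matspace_def
  by (rule measurable_component_singleton) auto

lemma measurable_state_amp: "a < N \<Longrightarrow> (\<lambda>f. state_amp f a) \<in> borel_measurable \<mu>"
  unfolding state_amp_def by (intro borel_measurable_sum borel_measurable_times measurable_entry) auto

lemma measurable_amplitude: "u \<in> words N t' \<Longrightarrow> (\<lambda>f. amplitude (state_amp f) u) \<in> borel_measurable \<mu>"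
proof (induction t' arbitrary: u)
  case (Suc t')
  then obtain a u' where "u = a # u'" "a < N" "u' \<in> words N t'" by (elim words_SucE)
  then show ?case using Suc.IH measurable_state_amp by simp
qed simp

lemma measurable_pure_kernel: "u \<in> words N t \<Longrightarrow> v \<in> words N t \<Longrightarrow> (\<lambda>f. pure_kernel (state_amp f) u v) \<in> borel_measurable \<mu>"
  unfolding pure_kernel_def by (intro borel_measurable_times measurable_amplitude borel_measurable_continuous_on[of cnj]) (auto intro: continuous_intros)

lemma AE_SU: "AE f in \<mu>. mat N N f \<in> SU N"
proof -
  have "prob {f \<in> space \<mu>. mat N N f \<in> SU N} = 1"
    using haar by (simp add: is_haar_SU_def measure_def)
  from AE_prob_1[OF this] show ?thesis by eventually_elim auto
qed

lemma state_amp_mat: "a < N \<Longrightarrow> state_amp f a = (\<Sum>b<N. entry (mat N N f) a b * \<alpha> $ b)"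
  by (simp add: state_amp_def entry_def)

lemma amplitude_cong: "(\<And>a. a < N \<Longrightarrow> p a = q a) \<Longrightarrow> u \<in> words N t' \<Longrightarrow> amplitude p u = amplitude q u"
  unfolding amplitude_def by (rule arg_cong[where f = prod_list], rule map_cong[OF refl]) (auto simp: words_def subset_iff)

lemma pure_kernel_state_amp:
  assumes "u \<in> words N t" "v \<in> words N t"
  shows "pure_kernel (state_amp f) u v = conj_by N t (entry (mat N N f)) initial_kernel u v"
  unfolding conj_by_pure_kernel[OF assms] pure_kernel_def
  using amplitude_cong[OF state_amp_mat assms(1)] amplitude_cong[OF state_amp_mat assms(2)] by simp

lemma hs_norm_sq_initial_kernel: "hs_norm_sq N t initial_kernel = 1" and full_tr_initial_kernel: "full_tr N t initial_kernel = 1"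
  by (simp_all add: hs_norm_sq_pure_kernel full_tr_pure_kernel unit)

lemma hs_norm_sq_unit: "unitary_on N A \<Longrightarrow> hs_norm_sq N t (conj_by N t A X) = hs_norm_sq N t X"
  using hs_inner_unit[of N A t X X] unfolding hs_inner_self by (simp only: of_real_eq_iff)

lemma cmod_le_hs_norm_sq: "u \<in> words N t \<Longrightarrow> v \<in> words N t \<Longrightarrow> (cmod (X u v))\<^sup>2 \<le> hs_norm_sq N t X"
proof -
  assume uv: "u \<in> words N t" "v \<in> words N t"
  have "(cmod (X u v))\<^sup>2 \<le> (\<Sum>v\<in>words N t. (cmod (X u v))\<^sup>2)"
    using uv by (intro member_le_sum) auto
  also have "\<dots> \<le> hs_norm_sq N t X" unfolding hs_norm_sq_def
    using uv by (intro member_le_sum[where f = "\<lambda>u. \<Sum>v\<in>words N t. (cmod (X u v))\<^sup>2"]) (auto intro: sum_nonneg)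
  finally show ?thesis .
qed

text \<open>Entries are bounded by the Hilbert-Schmidt norm, which is one for a rotated pure state.
  As the samples lie in \<open>SU N\<close> only almost everywhere, so does the bound.\<close>

lemma integrable_pure_kernel:
  assumes "u \<in> words N t" "v \<in> words N t"
  shows "integrable \<mu> (\<lambda>f. pure_kernel (state_amp f) u v)"
proof (rule integrable_const_bound[of _ 1])
  show "AE f in \<mu>. norm (pure_kernel (state_amp f) u v) \<le> 1"
    using AE_SU
  proof eventually_elim
    case (elim f)
    have "(cmod (pure_kernel (state_amp f) u v))\<^sup>2 \<le> hs_norm_sq N t (conj_by N t (entry (mat N N f)) initial_kernel)"
      unfolding pure_kernel_state_amp[OF assms] by (rule cmod_le_hs_norm_sq[OF assms])
    then have "(cmod (pure_kernel (state_amp f) u v))\<^sup>2 \<le> 1\<^sup>2"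
      unfolding hs_norm_sq_unit[OF SU_unitary_on[OF elim]] hs_norm_sq_initial_kernel by simp
    then show ?case by (rule power2_le_imp_le) simp
  qed
qed (rule measurable_pure_kernel[OF assms])

lemma S_herm_sym: "herm_sym N t S"
proof (rule herm_symI)
  fix u v assume uv: "u \<in> words N t" "v \<in> words N t"
  have "S v u = integral\<^sup>L \<mu> (\<lambda>f. cnj (pure_kernel (state_amp f) u v))"
    unfolding S_def pure_kernel_def by (simp add: mult.commute)
  then show "S v u = cnj (S u v)" unfolding S_def by simp
next
  fix u u' v assume "u \<in> words N t" "u' \<in> words N t" "v \<in> words N t" "mset u = mset u'"
  from amplitude_mset[OF this(4)] show "S u v = S u' v" unfolding S_def pure_kernel_def by simp
qed

lemma initial_kernel_herm_sym: "herm_sym N t initial_kernel"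
  by (rule herm_symI) (auto simp: pure_kernel_def dest: amplitude_mset)

lemma conj_by_S:
  assumes uv: "u \<in> words N t" "v \<in> words N t"
  shows "conj_by N t A S u v = integral\<^sup>L \<mu> (\<lambda>f. conj_by N t A (pure_kernel (state_amp f)) u v)"
proof -
  have "conj_by N t A X u v = (\<Sum>x\<in>words N t. \<Sum>y\<in>words N t. (tensor_pow A u x * cnj (tensor_pow A v y)) * X x y)" for X
    by (simp add: conj_by_def ac_simps)
  then show ?thesis unfolding S_def by (simp only: integral_double_sum[OF integrable_pure_kernel])
qed

text \<open>Left invariance of the Haar measure: replacing the sample by its product with
  \<open>V\<close> rotates the sampled state by \<open>V\<close> and leaves the integral
  unchanged.\<close>

lemma S_invariant:
  assumes V: "V \<in> SU N" and uv: "u \<in> words N t" "v \<in> words N t"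
  shows "conj_by N t (entry V) S u v = S u v"
proof -
  let ?T = "\<lambda>f. restrict (\<lambda>(i, j). (V * mat N N f) $$ (i, j)) ({..<N} \<times> {..<N})"
  have Vc: "V \<in> carrier_mat N N" using V by (simp add: SU_def)
  have distr: "distr \<mu> (matspace N) ?T = \<mu>" using haar V by (simp add: is_haar_SU_def)
  have entry: "(V * mat N N f) $$ (i, j) = (\<Sum>c<N. V $$ (i, c) * f (c, j))" if "i < N" "j < N" for i j f
    using Vc that by (simp add: scalar_prod_def atLeast0LessThan)
  have T: "?T \<in> measurable \<mu> (matspace N)"
    unfolding matspace_def
  proof (rule measurable_restrict)
    fix x assume "x \<in> {..<N} \<times> {..<N}"
    then obtain i j where x: "x = (i, j)" and ij: "i < N" "j < N" by auto
    show "(\<lambda>f. case x of (i, j) \<Rightarrow> (V * mat N N f) $$ (i, j)) \<in> borel_measurable \<mu>"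
      unfolding x prod.case entry[OF ij]
      using ij by (intro borel_measurable_sum borel_measurable_times measurable_entry) auto
  qed
  have psiT: "state_amp (?T f) a = (\<Sum>c<N. entry V a c * state_amp f c)" if a: "a < N" for f a
  proof -
    have "state_amp (?T f) a = (\<Sum>b<N. \<Sum>c<N. V $$ (a, c) * f (c, b) * \<alpha> $ b)"
      using a by (simp add: state_amp_def entry sum_distrib_right)
    also have "\<dots> = (\<Sum>c<N. entry V a c * state_amp f c)"
      by (subst sum.swap) (simp add: state_amp_def entry_def sum_distrib_left mult.assoc)
    finally show ?thesis .
  qed
  have ampT: "amplitude (state_amp (?T f)) w = amplitude (\<lambda>a. \<Sum>c<N. entry V a c * state_amp f c) w" if "w \<in> words N t" for f w
    by (rule amplitude_cong[OF psiT that])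
  have "S u v = integral\<^sup>L (distr \<mu> (matspace N) ?T) (\<lambda>f. pure_kernel (state_amp f) u v)"
    unfolding distr S_def ..
  also have "\<dots> = integral\<^sup>L \<mu> (\<lambda>f. pure_kernel (state_amp (?T f)) u v)"
    using measurable_pure_kernel[OF uv] by (intro integral_distr T) (simp add: measurable_cong_sets[OF sets_mu refl])
  also have "\<dots> = integral\<^sup>L \<mu> (\<lambda>f. conj_by N t (entry V) (pure_kernel (state_amp f)) u v)"
  proof (rule Bochner_Integration.integral_cong[OF refl])
    fix f
    show "pure_kernel (state_amp (?T f)) u v = conj_by N t (entry V) (pure_kernel (state_amp f)) u v"
      unfolding conj_by_pure_kernel[OF uv] pure_kernel_def by (simp only: ampT uv)
  qed
  also have "\<dots> = conj_by N t (entry V) S u v" by (rule conj_by_S[OF uv, symmetric])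
  finally show ?thesis ..
qed

lemma full_tr_S: "full_tr N t S = 1"
proof -
  have "full_tr N t S = integral\<^sup>L \<mu> (\<lambda>f. full_tr N t (pure_kernel (state_amp f)))"
    unfolding full_tr_def S_def using integrable_pure_kernel by simp
  also have "\<dots> = integral\<^sup>L \<mu> (\<lambda>f. 1)"
  proof (rule integral_cong_AE)
    show "(\<lambda>f. full_tr N t (pure_kernel (state_amp f))) \<in> borel_measurable \<mu>"
      unfolding full_tr_def by (intro borel_measurable_sum measurable_pure_kernel)
    show "AE f in \<mu>. full_tr N t (pure_kernel (state_amp f)) = 1"
      using AE_SU
    proof eventually_elim
      case (elim f)
      have "full_tr N t (pure_kernel (state_amp f)) = full_tr N t (conj_by N t (entry (mat N N f)) initial_kernel)"
        unfolding full_tr_def by (intro sum.cong refl pure_kernel_state_amp)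
      then show ?case unfolding full_tr_conj_by[OF SU_unitary_on[OF elim]] full_tr_initial_kernel .
    qed
  qed auto
  finally show ?thesis using prob_space by simp
qed

text \<open>Since \<open>S\<close> is invariant, its inner product with the rotated initial state
  does not depend on the rotation. Averaging the second argument thus replaces the initial state by
  \<open>S\<close>.\<close>

lemma hs_inner_S_S: "hs_inner N t S S = hs_inner N t S initial_kernel"
proof -
  have "hs_inner N t S S = integral\<^sup>L \<mu> (\<lambda>f. hs_inner N t S (pure_kernel (state_amp f)))"
    unfolding hs_inner_def by (subst integral_double_sum[OF integrable_pure_kernel]) (auto simp: S_def)
  also have "\<dots> = integral\<^sup>L \<mu> (\<lambda>f. hs_inner N t S initial_kernel)"
  proof (rule integral_cong_AE)
    show "(\<lambda>f. hs_inner N t S (pure_kernel (state_amp f))) \<in> borel_measurable \<mu>"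
      unfolding hs_inner_def by (intro borel_measurable_sum borel_measurable_times measurable_pure_kernel) auto
    show "AE f in \<mu>. hs_inner N t S (pure_kernel (state_amp f)) = hs_inner N t S initial_kernel"
      using AE_SU
    proof eventually_elim
      case (elim f)
      have "hs_inner N t S (pure_kernel (state_amp f)) = hs_inner N t (conj_by N t (entry (mat N N f)) S) (conj_by N t (entry (mat N N f)) initial_kernel)"
        by (rule hs_inner_cong) (auto simp: S_invariant[OF elim] pure_kernel_state_amp)
      then show ?case unfolding hs_inner_unit[OF SU_unitary_on[OF elim]] .
    qed
  qed auto
  finally show ?thesis using prob_space by simp
qed

text \<open>By \<open>hs_inner_S_S\<close> the difference is orthogonal to \<open>S\<close>, so its
  squared norm is that of the initial state, which is one, minus that of \<open>S\<close>.\<close>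

lemma hs_norm_sq_diff_le: "hs_norm_sq N t (\<lambda>u v. initial_kernel u v - S u v) \<le> 1"
proof -
  have "complex_of_real (hs_norm_sq N t (\<lambda>u v. initial_kernel u v - S u v)) = hs_inner N t initial_kernel initial_kernel - hs_inner N t initial_kernel S - hs_inner N t S initial_kernel + hs_inner N t S S"
    unfolding hs_inner_self[symmetric] by (simp add: hs_inner_def algebra_simps sum.distrib sum_subtractf)
  also have "hs_inner N t initial_kernel S = cnj (hs_inner N t S initial_kernel)" by (rule hs_inner_commute)
  also have "hs_inner N t S initial_kernel = of_real (hs_norm_sq N t S)" unfolding hs_inner_S_S[symmetric] by (rule hs_inner_self)
  also have "hs_inner N t S S = of_real (hs_norm_sq N t S)" by (rule hs_inner_self)
  also have "hs_inner N t initial_kernel initial_kernel = 1" unfolding hs_inner_self hs_norm_sq_initial_kernel by simp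
  finally have "complex_of_real (hs_norm_sq N t (\<lambda>u v. initial_kernel u v - S u v)) = of_real (1 - hs_norm_sq N t S)" by simp
  then have "hs_norm_sq N t (\<lambda>u v. initial_kernel u v - S u v) = 1 - hs_norm_sq N t S" by (simp only: of_real_eq_iff)
  then show ?thesis using hs_norm_sq_nonneg[of N t S] by simp
qed

lemma ketbra_carrier: "ketbra \<alpha> \<in> carrier_mat N N"
  using \<alpha> by (simp add: ketbra_def)

lemma kernel_of_pure_kernel:
  assumes A: "A \<in> carrier_mat N N" "\<And>a b. a < N \<Longrightarrow> b < N \<Longrightarrow> A $$ (a, b) = p a * cnj (p b)"
    and uv: "u \<in> words N t" "v \<in> words N t"
  shows "kernel_of N (kron_pow t A) u v = pure_kernel p u v"
  unfolding kernel_of_kron_pow[OF A(1) uv]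
  using uv
proof (induction t arbitrary: u v)
  case (Suc t)
  then obtain a u' b v' where "u = a # u'" "u' \<in> words N t" "a < N" "v = b # v'" "v' \<in> words N t" "b < N"
    by (elim words_SucE) auto
  then show ?case using Suc.IH A(2) by (simp add: pure_kernel_def entry_def)
qed (simp add: pure_kernel_def)

lemma kernel_of_initial:
  "u \<in> words N t \<Longrightarrow> v \<in> words N t \<Longrightarrow> kernel_of N (kron_pow t (ketbra \<alpha>)) u v = initial_kernel u v"
  by (rule kernel_of_pure_kernel[OF ketbra_carrier]) (use \<alpha> in \<open>auto simp: ketbra_def\<close>)

lemma kernel_of_haar_state:
  assumes uv: "u \<in> words N t" "v \<in> words N t"
  shows "kernel_of N (haar_state N t \<mu> (ketbra \<alpha>)) u v = S u v"
proof -
  have "kernel_of N (kron_pow t (mat N N f * ketbra \<alpha> * dag (mat N N f))) u v = pure_kernel (state_amp f) u v" for f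
  proof (rule kernel_of_pure_kernel[OF _ _ uv])
    let ?U = "mat N N f"
    show "?U * ketbra \<alpha> * dag ?U \<in> carrier_mat N N"
      using ketbra_carrier by (auto simp: dag_def)
    fix a b assume ab: "a < N" "b < N"
    have "(?U * ketbra \<alpha>) $$ (a, c) = state_amp f a * cnj (\<alpha> $ c)" if "c < N" for c
      using ketbra_carrier \<alpha> ab that
      by (simp add: scalar_prod_def atLeast0LessThan ketbra_def state_amp_def sum_distrib_right mult.assoc)
    then have "(?U * ketbra \<alpha> * dag ?U) $$ (a, b) = (\<Sum>c<N. state_amp f a * cnj (\<alpha> $ c) * cnj (f (b, c)))"
      using ketbra_carrier ab by (simp add: scalar_prod_def[of "row _ _"] atLeast0LessThan dag_def)
    also have "\<dots> = state_amp f a * cnj (state_amp f b)"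
      by (simp add: state_amp_def[of f b] cnj_sum sum_distrib_left ac_simps)
    finally show "(?U * ketbra \<alpha> * dag ?U) $$ (a, b) = state_amp f a * cnj (state_amp f b)" .
  qed
  then show ?thesis
    using encode_less[OF uv(1)] encode_less[OF uv(2)] by (simp add: kernel_of_def haar_state_def S_def)
qed

end

section \<open>The convergence bound\<close>

text \<open>A row depends only on its vector of letter counts. Hence \<open>A\<close> factors
  through the count vectors: \<open>E\<close> marks the count vector of each row and
  \<open>G\<close> holds one row for each of them. The vectors of \<open>N\<close> naturals with sum
  \<open>t\<close> number \<open>(N + t - 1) choose t\<close>.\<close>

lemma trace_norm_le_symmetric:
  assumes A: "A \<in> carrier_mat (N ^ t) (N ^ t)" and N: "0 < N"
    and sym: "\<And>u u' v. u \<in> words N t \<Longrightarrow> u' \<in> words N t \<Longrightarrow> v \<in> words N t \<Longrightarrow> mset u = mset u' \<Longrightarrow> kernel_of N A u v = kernel_of N A u' v"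
  shows "trace_norm A \<le> sqrt (real ((N + t - 1) choose t)) * sqrt (hs_norm_sq N t (kernel_of N A))"
proof -
  define L where "L = {l :: nat list. length l = N \<and> sum_list l = t}"
  define ty where "ty u = map (count_list u) [0..<N]" for u :: "nat list"
  define d where "d = card L"
  have d: "d = (N + t - 1) choose t" unfolding d_def L_def card_length_sum_list by (simp add: add.commute)
  have "finite L"
  proof (rule finite_subset)
    show "L \<subseteq> {l. set l \<subseteq> {..t} \<and> length l = N}"
      unfolding L_def by (auto dest: member_le_sum_list)
  qed (simp add: finite_lists_length_eq)
  then obtain h where h: "bij_betw h {0..<d} L" unfolding d_def using ex_bij_betw_nat_finite by blast
  have ty_L: "ty u \<in> L" if "u \<in> words N t" for u
  proof -
    have "sum_list (ty u) = (\<Sum>a<N. count_list u a)"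
      unfolding ty_def by (simp add: interv_sum_list_conv_sum_set_nat atLeast0LessThan)
    also have "\<dots> = length u"
      using that sum_count_set[of u "{..<N}"] by (simp add: words_def)
    finally show ?thesis using that by (simp add: L_def ty_def words_def)
  qed
  have ty_mset: "mset u = mset v" if "ty u = ty v" "u \<in> words N t" "v \<in> words N t" for u v
  proof (rule multiset_eqI)
    fix a
    have "count_list u a = count_list v a"
    proof (cases "a < N")
      case True
      then show ?thesis using that(1) by (auto simp: ty_def)
    next
      case False
      then have "a \<notin> set u" "a \<notin> set v" using that by (auto simp: words_def)
      then show ?thesis by (simp add: count_list_0_iff)
    qed
    then show "count (mset u) a = count (mset v) a" by (simp add: count_mset)
  qed
  \<comment> \<open>A word with the given count vector. That one exists is verified only where it is
    used, for the count vector of an actual row.\<close>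
  define rep where "rep m = (SOME u. u \<in> words N t \<and> ty u = h m)" for m
  define E where "E = mat (N ^ t) d (\<lambda>(i, m). if ty (decode N t i) = h m then 1 else 0 :: complex)"
  define G where "G = mat d (N ^ t) (\<lambda>(m, j). kernel_of N A (rep m) (decode N t j))"
  have "A = E * G"
  proof (rule eq_matI)
    fix i j assume "i < dim_row (E * G)" "j < dim_col (E * G)"
    then have ij: "i < N ^ t" "j < N ^ t" by (auto simp: E_def G_def)
    let ?u = "decode N t i" and ?v = "decode N t j"
    have uv: "?u \<in> words N t" "?v \<in> words N t" by (simp_all add: decode_in_words N)
    obtain m where m: "m < d" "h m = ty ?u"
      using ty_L[OF uv(1)] h unfolding bij_betw_def by force
    have rep: "rep m \<in> words N t \<and> ty (rep m) = h m"
      unfolding rep_def by (rule someI[of _ ?u]) (simp add: uv m)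
    have uniq: "ty ?u = h m' \<longleftrightarrow> m = m'" if "m' < d" for m'
      using h m that unfolding bij_betw_def inj_on_def by auto
    have "(E * G) $$ (i, j) = (\<Sum>m'<d. (if ty ?u = h m' then 1 else 0) * kernel_of N A (rep m') ?v)"
      using ij by (simp add: E_def G_def scalar_prod_def atLeast0LessThan)
    also have "\<dots> = (\<Sum>m'<d. if m = m' then kernel_of N A (rep m') ?v else 0)"
      by (intro sum.cong refl) (simp add: uniq)
    also have "\<dots> = kernel_of N A (rep m) ?v" using m(1) by simp
    also have "\<dots> = kernel_of N A ?u ?v"
      using rep uv m by (intro sym ty_mset) auto
    also have "\<dots> = A $$ (i, j)" using ij by (simp add: kernel_of_def encode_decode)
    finally show "A $$ (i, j) = (E * G) $$ (i, j)" ..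
  qed (use A in \<open>auto simp: E_def G_def\<close>)
  from trace_norm_le_rank[OF A this, of d]
  have "trace_norm A \<le> sqrt (real d) * sqrt (\<Sum>i<N ^ t. \<Sum>j<N ^ t. (cmod (A $$ (i, j)))\<^sup>2)"
    by (simp add: E_def G_def)
  also have "(\<Sum>i<N ^ t. \<Sum>j<N ^ t. (cmod (A $$ (i, j)))\<^sup>2) = hs_norm_sq N t (kernel_of N A)"
    by (simp add: sum_encode[OF N] hs_norm_sq_def kernel_of_def)
  finally show ?thesis unfolding d .
qed

text \<open>Every rotation lies in \<open>SU N\<close>, so the integrand of the angular average is
  constant and each pinching fixes the kernel.\<close>

lemma (in pauli_channel) twirl_fixed:
  assumes "\<And>V u v. V \<in> SU N \<Longrightarrow> u \<in> words N t \<Longrightarrow> v \<in> words N t \<Longrightarrow> conj_by N t (entry V) X u v = X u v"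
    and uv: "u \<in> words N t" "v \<in> words N t"
  shows "twirl t X u v = X u v"
proof -
  interpret U: prob_space "uniform_measure lborel {-pi<..<pi}" by (rule prob_space_uniform_pi)
  have "pinch A t X u v = X u v" if "A \<in> Paulis n" for A
    using pinch_eq_integral[OF that uv, of X] U.prob_space
    by (simp add: assms(1)[OF rotation_SU[OF that] uv])
  then show ?thesis using card_I_neq by (simp add: twirl_def)
qed

lemma (in pauli_channel) twirl_pow_diff_fixed:
  assumes fixed: "\<And>u v. u \<in> words N t \<Longrightarrow> v \<in> words N t \<Longrightarrow> twirl t Y u v = Y u v"
    and uv: "u \<in> words N t" "v \<in> words N t"
  shows "(twirl t ^^ k) (\<lambda>u v. X u v - Y u v) u v = (twirl t ^^ k) X u v - Y u v"
  using uv
proof (induction k arbitrary: u v)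
  case (Suc k)
  have "(twirl t ^^ Suc k) (\<lambda>u v. X u v - Y u v) u v = twirl t (\<lambda>u v. (twirl t ^^ k) X u v - Y u v) u v"
    using Suc.IH by (simp add: twirl_cong[of t "(twirl t ^^ k) (\<lambda>u v. X u v - Y u v)"])
  also have "\<dots> = (twirl t ^^ Suc k) X u v - Y u v" using Suc.prems by (simp add: twirl_diff fixed)
  finally show ?case .
qed simp

theorem theoremB1:
  fixes t k n :: nat and \<alpha> :: "complex vec" and \<mu> :: "(nat \<times> nat \<Rightarrow> complex) measure"
  assumes "t \<ge> 1" and "k \<ge> 1" and "n \<ge> 1"
    and "\<alpha> \<in> carrier_vec (2^n)"
    and "(\<Sum>i<2^n. (cmod (\<alpha> $ i))\<^sup>2) = 1"
    and "is_haar_SU (2^n) \<mu>"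
  shows "trace_norm ((chan n t ^^ k) (kron_pow t (ketbra \<alpha>)) - haar_state (2^n) t \<mu> (ketbra \<alpha>))
     \<le> sqrt (real ((2^n + t - 1) choose t))
        * (1 - 1 / (2 * real t) * (2^n / (2^n + 1)) - 2^n / (2 * ((2^n)\<^sup>2 - 1))) ^ k"
proof -
  have "\<forall>A\<in>Paulis n. \<exists>Wd. diagonalized (2 ^ n) A (fst Wd) (snd Wd)"
    using Paulis_diagonalized by (metis fst_conv snd_conv)
  then obtain Wd where "\<forall>A\<in>Paulis n. diagonalized (2 ^ n) A (fst (Wd A)) (snd (Wd A))"
    by (rule bchoice[THEN exE])
  then interpret pauli_channel n "\<lambda>A. fst (Wd A)" "\<lambda>A. snd (Wd A)"
    using assms(3) by unfold_locales auto
  interpret H: haar_state_frame N t \<mu> \<alpha>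
    using assms by unfold_locales auto
  let ?\<eta> = "kron_pow t (ketbra \<alpha>)" and ?S = "haar_state N t \<mu> (ketbra \<alpha>)"
  let ?A = "(chan n t ^^ k) ?\<eta> - ?S"
  let ?X = "\<lambda>u v. H.initial_kernel u v - H.S u v"
  have \<eta>: "?\<eta> \<in> carrier_mat (N ^ t) (N ^ t)" by (rule kron_pow_carrier[OF H.ketbra_carrier])
  have S: "?S \<in> carrier_mat (N ^ t) (N ^ t)" by (simp add: haar_state_def)
  have kerA: "kernel_of N ?A u v = (twirl t ^^ k) ?X u v" if uv: "u \<in> words N t" "v \<in> words N t" for u v
  proof -
    have "kernel_of N ?A u v = kernel_of N ((chan n t ^^ k) ?\<eta>) u v - kernel_of N ?S u v"
      using chan_pow_carrier[OF \<eta>, of k] S encode_less[OF uv(1)] encode_less[OF uv(2)] by (simp add: kernel_of_def)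
    also have "\<dots> = (twirl t ^^ k) (kernel_of N ?\<eta>) u v - H.S u v"
      by (simp add: kernel_of_chan_pow[OF \<eta> uv] H.kernel_of_haar_state[OF uv])
    also have "(twirl t ^^ k) (kernel_of N ?\<eta>) u v = (twirl t ^^ k) H.initial_kernel u v"
      by (rule twirl_pow_cong[OF H.kernel_of_initial uv])
    also have "(twirl t ^^ k) H.initial_kernel u v - H.S u v = (twirl t ^^ k) ?X u v"
      by (rule twirl_pow_diff_fixed[OF twirl_fixed[OF H.S_invariant] uv, symmetric])
    finally show ?thesis .
  qed
  have X: "herm_sym N t ?X"
    using herm_symD[OF H.initial_kernel_herm_sym] herm_symD[OF H.S_herm_sym]
    by (intro herm_symI) (metis complex_cnj_diff, metis)
  have trX: "full_tr N t ?X = 0"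
    using H.full_tr_initial_kernel H.full_tr_S by (simp add: full_tr_def sum_subtractf)
  have decay_rate: "0 < decay_rate t" using assms(1) by (intro decay_rate_pos) simp
  have "hs_norm_sq N t (kernel_of N ?A) = hs_norm_sq N t ((twirl t ^^ k) ?X)" by (rule hs_norm_sq_cong) (rule kerA)
  also have "\<dots> \<le> decay_rate t ^ (2 * k) * hs_norm_sq N t ?X" by (rule twirl_pow_contract[OF X trX])
  also have "\<dots> \<le> decay_rate t ^ (2 * k) * 1" using decay_rate by (intro mult_left_mono H.hs_norm_sq_diff_le) auto
  finally have "hs_norm_sq N t (kernel_of N ?A) \<le> (decay_rate t ^ k)\<^sup>2"
    by (simp add: mult.commute flip: power_mult)
  \<comment> \<open>Taking the root needs \<open>decay_rate t ^ k\<close> to be nonnegative, which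
    is where positivity of the rate enters once more.\<close>
  then have bound: "sqrt (hs_norm_sq N t (kernel_of N ?A)) \<le> decay_rate t ^ k" using decay_rate by (intro real_le_lsqrt) auto
  have "trace_norm ?A \<le> sqrt (real ((N + t - 1) choose t)) * sqrt (hs_norm_sq N t (kernel_of N ?A))"
  proof (rule trace_norm_le_symmetric)
    show "?A \<in> carrier_mat (N ^ t) (N ^ t)" by (rule minus_carrier_mat[OF S])
    show "kernel_of N ?A u v = kernel_of N ?A u' v"
      if "u \<in> words N t" "u' \<in> words N t" "v \<in> words N t" "mset u = mset u'" for u u' v
      using herm_symD(2)[OF twirl_pow_herm_sym[OF X] that] that by (simp add: kerA)
  qed simp
  also have "\<dots> \<le> sqrt (real ((N + t - 1) choose t)) * decay_rate t ^ k"
    by (intro mult_left_mono bound) simp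
  \<comment> \<open>With \<open>x = N\<close> this is the splitting
    \<open>x (x + t - 1) = x (x - 1) + x t\<close> over the denominator
    \<open>2 t (x - 1) (x + 1)\<close>.\<close>
  also have "decay_rate t = 1 - 1 / (2 * real t) * (2^n / (2^n + 1)) - 2^n / (2 * ((2^n)\<^sup>2 - 1))"
  proof -
    define x :: real where "x = 2 ^ n"
    have x: "1 < x" using assms(3) by (simp add: x_def)
    then have x2: "x\<^sup>2 - 1 = (x - 1) * (x + 1)" by (simp add: power2_eq_square algebra_simps)
    have "1 - x * (x + real t - 1) / (2 * real t * ((x - 1) * (x + 1))) =
       1 - 1 / (2 * real t) * (x / (x + 1)) - x / (2 * ((x - 1) * (x + 1)))"
      using x assms(1) by (simp add: divide_simps) (simp add: algebra_simps)
    then show ?thesis unfolding decay_rate_def x2[symmetric] by (simp add: x_def)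
  qed
  finally show ?thesis .
qed

end
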